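(* In each of the two cases (odd case and even case), there is an isomorphism $\overline{\iota}_*:\overline{\mathcal{A}}^c_{BCR}\to\overline{\mathcal{A}}_{BCR}$ of $\mathbb{Q}$-vector spaces, namely the linear map $\overline{\iota}_*$ induced on quotients by the inclusion $\iota:\mathcal{D}^c\to\mathcal{D}$ which regards a colored BCR chord diagram as a colored BCR graph without internal vertices.
   Context: All graphs are finite; loops and multiple edges are allowed unless excluded, and a loop at a vertex counts twice among the edges at that vertex. **BCR graphs.** A BCR graph is a connected graph such that: (1) there are (at most) two types of vertices, external and internal, and there is at least one external vertex; (2) there are (at most) two types of edges, dashed and solid; (3) each internal vertex has exactly three dashed edges and no solid edge; (4) each external vertex has exactly one dashed edge and at most two solid edges; (5) the subgraph formed by the external vertices and the solid edges is a disjoint union of broken lines, i.e. of paths (a single vertex is allowed); in particular there are no solid cycles, no solid loops and no double solid edges. A BCR chord diagram is a BCR graph without internal vertices. A chord is a dashed edge joining two external vertices. **Colorings.** Fix one of two cases. Odd case: a coloring is an orientation of every edge together with a labelling of the vertices by $1,\dots,n$ ($n$ the number of vertices). Even case: a coloring is a numbering of all edges (solid and dashed) by $1,\dots,m$ ($m$ the number of edges). Two colorings of isomorphic underlying graphs (isomorphisms preserve the types of vertices and edges) have the same (resp. opposite) orientation if they are related by an even (resp. odd) change, where the parity is the parity of the permutation of vertex labels plus the number of edges whose orientation is reversed (odd case), or the parity of the permutation of edge numbers (even case). $\mathcal{D}$ (resp. $\mathcal{D}^c$) is the $\mathbb{Q}$-vector space generated by colored BCR graphs (resp. colored BCR chord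 diagrams). Orientation relations: $D=D'$ if $D,D'$ have isomorphic underlying graphs and the same orientation; $D=-D'$ if they have opposite orientation. **Contraction.** For a non-loop edge $e$, the contraction of a colored graph along $e$ is defined, up to orientation relations, as follows. Odd case: change the coloring, recording the sign, so that $e$ is oriented from vertex $1$ to vertex $2$; collapse $e$, label the merged vertex $1$, decrease the labels of the vertices $3,4,\dots$ by one, and keep the orientations of the other edges. Even case: change the coloring, recording the sign, so that $e$ has number $1$; collapse $e$ and decrease all other edge numbers by one. **IHX relations.** Let $e$ be a dashed edge joining two distinct internal vertices. Contracting $e$ gives a vertex with four dashed half-edges. Let $D_1,D_2,D_3$ be the three graphs obtained by expanding this vertex into two internal vertices joined by a dashed edge (one graph for each partition of the four half-edges into two pairs), colored so that contracting the new edge gives the same oriented graph in all three cases. The IHX relation is $D_1+D_2+D_3=0$ (also written $D_1=D_2-D_3$ with the sign absorbed in the coloring). **STU relations.** Let $S$ be a colored BCR graph with a dashed edge $e$ joining an external vertex $v$ and an internal vertex $w$, and let $x,y$ be the other two dashed half-edges at $w$. (I) Suppose $v$ has one or two solid edges. Let $T,U$ be obtained from the contraction of $S$ along $e$ by replacing the merged vertex by two external vertices $p,q$ joined by a new solid edge; if $v$ has two solid half-edges $a,b$, then $a$ is attached to $p$ and $b$ to $q$; if $v$ has a single solid half-edge $a$, it is attached to $p$. In $T$, $x$ is attached to $p$ and $y$ to $q$; in $U$, $y$ is attached to $p$ and $x$ to $q$. Color $T$ and $U$ so that the contraction of each along the edge $pq$ gives the same oriented graph as the contraction of $S$ along $e$.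 The relation is $S+T+U=0$ (also written $S=T-U$ with the signs absorbed in the colorings). (II) Suppose $v$ has no solid edge. Let $T$ be obtained by replacing the merged vertex by two external vertices $p,q$ joined by a new solid edge, with $x$ attached to $p$ and $y$ to $q$, colored by the same rule. The relation is $S+T=0$ (also written $S=T$ with the sign absorbed). **4T relations.** Let $S$ be a colored BCR graph with exactly one internal vertex $w$, and let $e\neq e'$ be two dashed edges at $w$ each joining $w$ to an external vertex. The STU relations at $e$ and at $e'$ express $S$ as linear combinations $H_e$ and $H_{e'}$ of one or two BCR chord diagrams each (so $S=D_1-D_2$ and $S=D_3-D_4$ are STU relations, where $D_2$ and/or $D_4$ is absent if the corresponding external vertex has no solid edge). The 4T relation is $H_e=H_{e'}$ (i.e. $D_1-D_2=D_3-D_4$). **Chord relations.** Let $D_1$ be a colored BCR graph with a chord $e$ joining external vertices $u$ and $v$, where $u$ has two solid half-edges $a,b$. Assume that the contraction of $D_1$ along $e$ contains no cycle consisting only of solid edges and external vertices. The other terms are the BCR graphs obtained from the contraction by expanding the merged vertex into two external vertices joined by a chord, distributing the solid half-edges so that each of the two vertices gets at most two. All terms are colored so that contracting the chord gives the same oriented graph, and the chord relation says that their sum is zero. Explicitly: (I) if $v$ has one or two solid half-edges, there are three terms $D_1+D_2+D_3=0$: if $v$ has solid half-edges $c,d$, they correspond to the distributions $\{a,b\}|\{c,d\}$, $\{a,c\}|\{b,d\}$, $\{a,d\}|\{b,c\}$; if $v$ has a single solid half-edge $c$, to $\{a,b\}|\{c\}$, $\{a,c\}|\{b\}$, $\{b,c\}|\{a\}$.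 (II) If $v$ has no solid edge, there are two terms $D_1+D_2=0$, corresponding to $\{a,b\}|\varnothing$ and $\{a\}|\{b\}$. Only relations all of whose terms are BCR graphs are used. **Quotients.** $\overline{\mathcal{A}}_{BCR}$ is the quotient of $\mathcal{D}$ by the IHX, STU, orientation and chord relations. $\overline{\mathcal{A}}^c_{BCR}$ is the quotient of $\mathcal{D}^c$ by the orientation relations, the 4T relations, and those chord relations all of whose terms are BCR chord diagrams. *)

theory Defs
  imports Complex_Main "HOL-Library.Poly_Mapping" "HOL-Library.Set_Algebras"
    "HOL-Combinatorics.Permutations"
begin

section \<open>Graphs with two types of vertices and edges\<close>

text \<open>
  Vertices and edges are named by natural numbers; loops and multiple edges are allowed.
  An edge \<open>e\<close> consists of the two half-edges \<open>(e, False)\<close> and \<open>(e, True)\<close>, and \<open>att\<close> sends a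
  half-edge to the vertex it is attached to. The Boolean only serves to tell the two half-edges
  apart: isomorphisms may exchange them. Vertices not in \<open>ext\<close> are internal and edges not in
  \<open>solid\<close> are dashed. Values of \<open>att\<close> outside \<open>edges \<times> UNIV\<close> are irrelevant.
\<close>

record graph =
  verts :: "nat set"
  edges :: "nat set"
  ext :: "nat set"
  solid :: "nat set"
  att :: "nat \<times> bool \<Rightarrow> nat"

definition wf_graph :: "graph \<Rightarrow> bool" where
  "wf_graph G \<longleftrightarrow> finite (verts G) \<and> finite (edges G) \<and> ext G \<subseteq> verts G \<and> solid G \<subseteq> edges G \<and>
     (\<forall>h \<in> edges G \<times> UNIV. att G h \<in> verts G)"

definition internal :: "graph \<Rightarrow> nat set" where
  "internal G = verts G - ext G"

definition dashed :: "graph \<Rightarrow> nat set" where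
  "dashed G = edges G - solid G"

definition dashed_at :: "graph \<Rightarrow> nat \<Rightarrow> (nat \<times> bool) set" where
  "dashed_at G v = {h \<in> dashed G \<times> UNIV. att G h = v}"

definition solid_at :: "graph \<Rightarrow> nat \<Rightarrow> (nat \<times> bool) set" where
  "solid_at G v = {h \<in> solid G \<times> UNIV. att G h = v}"

definition joins :: "graph \<Rightarrow> nat \<Rightarrow> nat \<Rightarrow> nat \<Rightarrow> bool" where
  "joins G e u v \<longleftrightarrow> (\<exists>b. att G (e, b) = u \<and> att G (e, \<not> b) = v)"

definition connected_graph :: "graph \<Rightarrow> bool" where
  "connected_graph G \<longleftrightarrow>
     (\<forall>u \<in> verts G. \<forall>v \<in> verts G. (u, v) \<in> {(x, y). \<exists>e \<in> edges G. joins G e x y}\<^sup>*)"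

definition solid_path :: "graph \<Rightarrow> nat list \<Rightarrow> nat list \<Rightarrow> bool" where
  "solid_path G vs es \<longleftrightarrow> distinct vs \<and> length vs = Suc (length es) \<and>
     set vs \<subseteq> ext G \<and> set es \<subseteq> solid G \<and>
     (\<forall>i < length es. joins G (es ! i) (vs ! i) (vs ! Suc i))"

text \<open>The external vertices and solid edges form a disjoint union of paths.\<close>

definition broken_lines :: "graph \<Rightarrow> bool" where
  "broken_lines G \<longleftrightarrow> (\<exists>Ps. (\<forall>(vs, es) \<in> Ps. solid_path G vs es) \<and>
     (\<forall>p \<in> Ps. \<forall>q \<in> Ps. p \<noteq> q \<longrightarrow> set (fst p) \<inter> set (fst q) = {}) \<and>
     (\<Union>p \<in> Ps. set (fst p)) = ext G \<and> (\<Union>p \<in> Ps. set (snd p)) = solid G)"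

text \<open>A loop is a cycle of length 1, a pair of parallel edges is a cycle of length 2.\<close>

definition has_solid_cycle :: "graph \<Rightarrow> bool" where
  "has_solid_cycle G \<longleftrightarrow> (\<exists>vs es. vs \<noteq> [] \<and> distinct vs \<and> distinct es \<and> length es = length vs \<and>
     set vs \<subseteq> ext G \<and> set es \<subseteq> solid G \<and>
     (\<forall>i < length vs. joins G (es ! i) (vs ! i) (vs ! (Suc i mod length vs))))"

definition bcr_graph :: "graph \<Rightarrow> bool" where
  "bcr_graph G \<longleftrightarrow> wf_graph G \<and> connected_graph G \<and> ext G \<noteq> {} \<and>
     (\<forall>v \<in> internal G. card (dashed_at G v) = 3 \<and> solid_at G v = {}) \<and>
     (\<forall>v \<in> ext G. card (dashed_at G v) = 1 \<and> card (solid_at G v) \<le> 2) \<and>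
     broken_lines G"

definition bcr_chord_diagram :: "graph \<Rightarrow> bool" where
  "bcr_chord_diagram G \<longleftrightarrow> bcr_graph G \<and> internal G = {}"


section \<open>Isomorphisms and colorings\<close>

text \<open>
  An isomorphism is given by a map on vertices, a map on edges, and the set of edges whose two
  half-edges are exchanged: the half-edge \<open>(e, b)\<close> is sent to \<open>(fE e, b \<noteq> fl e)\<close>.
\<close>

type_synonym graph_map = "(nat \<Rightarrow> nat) \<times> (nat \<Rightarrow> nat) \<times> (nat \<Rightarrow> bool)"

fun is_iso :: "graph_map \<Rightarrow> graph \<Rightarrow> graph \<Rightarrow> bool" where
  "is_iso (fV, fE, fl) G G' \<longleftrightarrow>
     bij_betw fV (verts G) (verts G') \<and> bij_betw fE (edges G) (edges G') \<and>
     (\<forall>v \<in> verts G. fV v \<in> ext G' \<longleftrightarrow> v \<in> ext G) \<and>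
     (\<forall>e \<in> edges G. fE e \<in> solid G' \<longleftrightarrow> e \<in> solid G) \<and>
     (\<forall>e \<in> edges G. \<forall>b. att G' (fE e, b \<noteq> fl e) = fV (att G (e, b)))"

definition id_map :: graph_map where
  "id_map = (id, id, \<lambda>_. False)"

datatype orientation_case = Odd_Case | Even_Case

text \<open>
  \<open>Odd_Col l h\<close>: \<open>l\<close> labels the vertices, and the edge \<open>e\<close> is oriented from its half-edge
  \<open>(e, \<not> h e)\<close> towards its half-edge \<open>(e, h e)\<close>. \<open>Even_Col l\<close>: \<open>l\<close> numbers the edges.
\<close>

datatype coloring = Odd_Col "nat \<Rightarrow> nat" "nat \<Rightarrow> bool" | Even_Col "nat \<Rightarrow> nat"

type_synonym colored_graph = "graph \<times> coloring"

fun is_coloring :: "orientation_case \<Rightarrow> graph \<Rightarrow> coloring \<Rightarrow> bool" where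
  "is_coloring Odd_Case G (Odd_Col l h) \<longleftrightarrow> bij_betw l (verts G) {1..card (verts G)}"
| "is_coloring Even_Case G (Even_Col l) \<longleftrightarrow> bij_betw l (edges G) {1..card (edges G)}"
| "is_coloring _ _ _ \<longleftrightarrow> False"

text \<open>The permutation \<open>l a \<mapsto> l' a\<close> (\<open>a \<in> A\<close>) of the labels, where \<open>l\<close> and \<open>l'\<close> are labellings of
  \<open>A\<close> by the same labels.\<close>

definition label_perm :: "nat set \<Rightarrow> (nat \<Rightarrow> nat) \<Rightarrow> (nat \<Rightarrow> nat) \<Rightarrow> nat \<Rightarrow> nat" where
  "label_perm A l l' i = (if i \<in> l ` A then l' (inv_into A l i) else i)"

text \<open>The sign of the change from the coloring \<open>c\<close> of \<open>G\<close> to the coloring \<open>c'\<close> of a graph that is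
  identified with \<open>G\<close> by the given isomorphism: \<open>1\<close> for an even change, \<open>-1\<close> for an odd one.\<close>

fun change_sign :: "graph_map \<Rightarrow> graph \<Rightarrow> coloring \<Rightarrow> coloring \<Rightarrow> int" where
  "change_sign (fV, fE, fl) G (Odd_Col l h) (Odd_Col l' h') =
     sign (label_perm (verts G) l (l' \<circ> fV)) *
     (-1) ^ card {e \<in> edges G. h' (fE e) \<noteq> (h e \<noteq> fl e)}"
| "change_sign (fV, fE, fl) G (Even_Col l) (Even_Col l') =
     sign (label_perm (edges G) l (l' \<circ> fE))"
| "change_sign _ _ _ _ = 0"

definition colored_bcr :: "orientation_case \<Rightarrow> colored_graph set" where
  "colored_bcr k = {(G, c). bcr_graph G \<and> is_coloring k G c}"

definition colored_chord :: "orientation_case \<Rightarrow> colored_graph set" where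
  "colored_chord k = {(G, c). bcr_chord_diagram G \<and> is_coloring k G c}"


section \<open>Contraction and expansion\<close>

text \<open>
  The vertex obtained by merging the ends of \<open>e\<close> keeps the name of the end \<open>att G (e, False)\<close>.
  It is external if one of the ends is.
\<close>

definition contract :: "graph \<Rightarrow> nat \<Rightarrow> graph" where
  "contract G e =
     (let m = att G (e, False); q = att G (e, True) in
      \<lparr>verts = verts G - {q}, edges = edges G - {e},
       ext = (if m \<in> ext G \<or> q \<in> ext G then insert m (ext G - {q}) else ext G),
       solid = solid G - {e},
       att = (\<lambda>h. if att G h = q then m else att G h)\<rparr>)"

text \<open>\<open>normalized G e c\<close>: in the odd case \<open>e\<close> is oriented from vertex 1 to vertex 2, in the even
  case \<open>e\<close> has number 1.\<close>

fun normalized :: "graph \<Rightarrow> nat \<Rightarrow> coloring \<Rightarrow> bool" where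
  "normalized G e (Odd_Col l h) \<longleftrightarrow> l (att G (e, \<not> h e)) = 1 \<and> l (att G (e, h e)) = 2"
| "normalized G e (Even_Col l) \<longleftrightarrow> l e = 1"

fun contract_col :: "graph \<Rightarrow> nat \<Rightarrow> coloring \<Rightarrow> coloring" where
  "contract_col G e (Odd_Col l h) =
     Odd_Col (\<lambda>v. if v = att G (e, False) then 1 else l v - 1) h"
| "contract_col G e (Even_Col l) = Even_Col (\<lambda>e'. l e' - 1)"

text \<open>\<open>contraction k G c e s d\<close>: the contraction of \<open>(G, c)\<close> along \<open>e\<close> is the colored graph
  \<open>(contract G e, d)\<close> with the sign \<open>s\<close>. Both depend on the choice of the normalized coloring, but
  only up to orientation relations.\<close>

definition contraction ::
    "orientation_case \<Rightarrow> graph \<Rightarrow> coloring \<Rightarrow> nat \<Rightarrow> int \<Rightarrow> coloring \<Rightarrow> bool" where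
  "contraction k G c e s d \<longleftrightarrow>
     (\<exists>c1. is_coloring k G c1 \<and> normalized G e c1 \<and>
        s = change_sign id_map G c c1 \<and> d = contract_col G e c1)"

text \<open>The contractions of two colored graphs along \<open>e\<close> are the same oriented graph. The contracted
  graphs are identified by the identity and not by an arbitrary isomorphism; otherwise the
  orientations could not be compared when the contracted graph has an orientation-reversing
  automorphism.\<close>

fun same_contraction ::
    "orientation_case \<Rightarrow> nat \<Rightarrow> colored_graph \<Rightarrow> colored_graph \<Rightarrow> bool" where
  "same_contraction k e (G, c) (G', c') \<longleftrightarrow>
     is_iso id_map (contract G e) (contract G' e) \<and>
     (\<exists>s d s' d'. contraction k G c e s d \<and> contraction k G' c' e s' d' \<and>
        s * s' * change_sign id_map (contract G e) d d' = 1)"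

text \<open>
  \<open>expand K m q e x s P\<close> replaces the vertex \<open>m\<close> of \<open>K\<close> by two vertices \<open>m\<close> and \<open>q\<close>, external
  iff \<open>x\<close>, joined by a new edge \<open>e\<close>, solid iff \<open>s\<close>. Among the half-edges at \<open>m\<close>, those in \<open>P\<close> stay
  at \<open>m\<close> and the others go to \<open>q\<close>. The new names \<open>q\<close> and \<open>e\<close> must not occur in \<open>K\<close>.
\<close>

definition expand ::
    "graph \<Rightarrow> nat \<Rightarrow> nat \<Rightarrow> nat \<Rightarrow> bool \<Rightarrow> bool \<Rightarrow> (nat \<times> bool) set \<Rightarrow> graph" where
  "expand K m q e x s P =
     \<lparr>verts = insert q (verts K), edges = insert e (edges K),
      ext = (if x then insert m (insert q (ext K)) else ext K - {m, q}),
      solid = (if s then insert e (solid K) else solid K),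
      att = (\<lambda>h. if fst h = e then (if snd h then q else m)
                 else if att K h = m \<and> h \<notin> P then q else att K h)\<rparr>"

text \<open>Contract \<open>e\<close>, then expand the merged vertex again. The names of \<open>e\<close> and its ends, which the
  contraction has made available, are reused.\<close>

definition reexpand :: "graph \<Rightarrow> nat \<Rightarrow> bool \<Rightarrow> bool \<Rightarrow> (nat \<times> bool) set \<Rightarrow> graph" where
  "reexpand G e x s P = expand (contract G e) (att G (e, False)) (att G (e, True)) e x s P"


section \<open>Relations\<close>

definition gen :: "colored_graph \<Rightarrow> colored_graph \<Rightarrow>\<^sub>0 rat" where
  "gen X = Poly_Mapping.single X 1"

definition qscale :: "rat \<Rightarrow> ('a \<Rightarrow>\<^sub>0 rat) \<Rightarrow> ('a \<Rightarrow>\<^sub>0 rat)" where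
  "qscale r x = Poly_Mapping.map ((*) r) x"

lemma lookup_qscale [simp]: "Poly_Mapping.lookup (qscale r x) a = r * Poly_Mapping.lookup x a"
  unfolding qscale_def by transfer (simp add: when_def)

global_interpretation qvs: vector_space "qscale :: rat \<Rightarrow> ('a \<Rightarrow>\<^sub>0 rat) \<Rightarrow> _"
  by unfold_locales (auto intro!: poly_mapping_eqI simp: lookup_add algebra_simps)

text \<open>Below, \<open>\<G>\<close> is the set of colored graphs all terms are required to be in.\<close>

definition orientation_rels :: "colored_graph set \<Rightarrow> (colored_graph \<Rightarrow>\<^sub>0 rat) set" where
  "orientation_rels \<G> =
     {gen (G, c) - qscale (of_int (change_sign f G c c')) (gen (G', c')) | f G c G' c'.
        (G, c) \<in> \<G> \<and> (G', c') \<in> \<G> \<and> is_iso f G G'}"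

inductive_set ihx_rels :: "orientation_case \<Rightarrow> (colored_graph \<Rightarrow>\<^sub>0 rat) set"
  for k :: orientation_case where
  "\<lbrakk>bcr_graph G; e \<in> dashed G;
    u = att G (e, False); w = att G (e, True); u \<noteq> w; u \<in> internal G; w \<in> internal G;
    dashed_at G u \<union> dashed_at G w - {(e, False), (e, True)} = {h1, h2, h3, h4};
    distinct [h1, h2, h3, h4];
    D1 = (reexpand G e False False {h1, h2}, c1);
    D2 = (reexpand G e False False {h1, h3}, c2);
    D3 = (reexpand G e False False {h1, h4}, c3);
    {D1, D2, D3} \<subseteq> colored_bcr k;
    same_contraction k e D1 D2; same_contraction k e D1 D3\<rbrakk>
   \<Longrightarrow> gen D1 + gen D2 + gen D3 \<in> ihx_rels k"

text \<open>
  \<open>stu k S e H\<close>: the STU relation at the dashed edge \<open>e\<close> of \<open>S\<close> reads \<open>S = H\<close>. The half-edge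
  \<open>(e, b)\<close> of \<open>e\<close> is at the external vertex \<open>v\<close>, the other one at the internal vertex \<open>w\<close>. In
  the first rule the second solid half-edge at \<open>v\<close>, if there is one, goes to \<open>q\<close>, as it is not
  in the set of half-edges staying at \<open>p\<close>.
\<close>

inductive stu :: "orientation_case \<Rightarrow> colored_graph \<Rightarrow> nat \<Rightarrow> (colored_graph \<Rightarrow>\<^sub>0 rat) \<Rightarrow> bool"
  for k :: orientation_case where
  solid: "\<lbrakk>(G, c) \<in> colored_bcr k; e \<in> dashed G;
    v = att G (e, b); w = att G (e, \<not> b); v \<in> ext G; w \<in> internal G;
    dashed_at G w - {(e, \<not> b)} = {x, y}; x \<noteq> y;
    a \<in> solid_at G v;
    T = (reexpand G e True True {a, x}, cT);
    U = (reexpand G e True True {a, y}, cU);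
    {T, U} \<subseteq> colored_bcr k;
    same_contraction k e (G, c) T; same_contraction k e (G, c) U\<rbrakk>
   \<Longrightarrow> stu k (G, c) e (- gen T - gen U)"
| no_solid: "\<lbrakk>(G, c) \<in> colored_bcr k; e \<in> dashed G;
    v = att G (e, b); w = att G (e, \<not> b); v \<in> ext G; w \<in> internal G;
    dashed_at G w - {(e, \<not> b)} = {x, y}; x \<noteq> y;
    solid_at G v = {};
    T = (reexpand G e True True {x}, cT);
    T \<in> colored_bcr k;
    same_contraction k e (G, c) T\<rbrakk>
   \<Longrightarrow> stu k (G, c) e (- gen T)"

definition stu_rels :: "orientation_case \<Rightarrow> (colored_graph \<Rightarrow>\<^sub>0 rat) set" where
  "stu_rels k = {gen S - H | S e H. stu k S e H}"

definition four_term_rels :: "orientation_case \<Rightarrow> (colored_graph \<Rightarrow>\<^sub>0 rat) set" where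
  "four_term_rels k =
     {H - H' | S e e' H H'. card (internal (fst S)) = 1 \<and> e \<noteq> e' \<and> stu k S e H \<and> stu k S e' H'}"

inductive_set chord_rels ::
    "orientation_case \<Rightarrow> colored_graph set \<Rightarrow> (colored_graph \<Rightarrow>\<^sub>0 rat) set"
  for k :: orientation_case and \<G> :: "colored_graph set" where
  two_solid: "\<lbrakk>D1 = (G, c); e \<in> dashed G;
    u = att G (e, i); v = att G (e, \<not> i); u \<in> ext G; v \<in> ext G;
    solid_at G u = {a, b}; a \<noteq> b; \<not> has_solid_cycle (contract G e);
    solid_at G v = {c', d}; c' \<noteq> d;
    D2 = (reexpand G e True False {a, c'}, c2);
    D3 = (reexpand G e True False {a, d}, c3);
    {D1, D2, D3} \<subseteq> \<G>;
    same_contraction k e D1 D2; same_contraction k e D1 D3\<rbrakk>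
   \<Longrightarrow> gen D1 + gen D2 + gen D3 \<in> chord_rels k \<G>"
| one_solid: "\<lbrakk>D1 = (G, c); e \<in> dashed G;
    u = att G (e, i); v = att G (e, \<not> i); u \<in> ext G; v \<in> ext G;
    solid_at G u = {a, b}; a \<noteq> b; \<not> has_solid_cycle (contract G e);
    solid_at G v = {c'};
    D2 = (reexpand G e True False {a, c'}, c2);
    D3 = (reexpand G e True False {b, c'}, c3);
    {D1, D2, D3} \<subseteq> \<G>;
    same_contraction k e D1 D2; same_contraction k e D1 D3\<rbrakk>
   \<Longrightarrow> gen D1 + gen D2 + gen D3 \<in> chord_rels k \<G>"
| no_solid: "\<lbrakk>D1 = (G, c); e \<in> dashed G;
    u = att G (e, i); v = att G (e, \<not> i); u \<in> ext G; v \<in> ext G;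
    solid_at G u = {a, b}; a \<noteq> b; \<not> has_solid_cycle (contract G e);
    solid_at G v = {};
    D2 = (reexpand G e True False {a}, c2);
    {D1, D2} \<subseteq> \<G>;
    same_contraction k e D1 D2\<rbrakk>
   \<Longrightarrow> gen D1 + gen D2 \<in> chord_rels k \<G>"


section \<open>Quotient spaces\<close>

definition bcr_space :: "orientation_case \<Rightarrow> (colored_graph \<Rightarrow>\<^sub>0 rat) set" where
  "bcr_space k = {x. Poly_Mapping.keys x \<subseteq> colored_bcr k}"

definition chord_space :: "orientation_case \<Rightarrow> (colored_graph \<Rightarrow>\<^sub>0 rat) set" where
  "chord_space k = {x. Poly_Mapping.keys x \<subseteq> colored_chord k}"

definition bcr_relations :: "orientation_case \<Rightarrow> (colored_graph \<Rightarrow>\<^sub>0 rat) set" where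
  "bcr_relations k = qvs.span
     (ihx_rels k \<union> stu_rels k \<union> orientation_rels (colored_bcr k) \<union> chord_rels k (colored_bcr k))"

definition chord_relations :: "orientation_case \<Rightarrow> (colored_graph \<Rightarrow>\<^sub>0 rat) set" where
  "chord_relations k = qvs.span
     (orientation_rels (colored_chord k) \<union> four_term_rels k \<union> chord_rels k (colored_chord k))"

text \<open>The quotient of \<open>V\<close> by a subspace \<open>R\<close> consists of the cosets \<open>x +o R\<close>; the sum of two cosets
  is their sum as sets. Adding \<open>R\<close> in the scalar multiplication matters only for the scalar 0.\<close>

definition quot_space :: "('a \<Rightarrow>\<^sub>0 rat) set \<Rightarrow> ('a \<Rightarrow>\<^sub>0 rat) set \<Rightarrow> ('a \<Rightarrow>\<^sub>0 rat) set set" where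
  "quot_space V R = (\<lambda>x. x +o R) ` V"

definition quot_scale :: "('a \<Rightarrow>\<^sub>0 rat) set \<Rightarrow> rat \<Rightarrow> ('a \<Rightarrow>\<^sub>0 rat) set \<Rightarrow> ('a \<Rightarrow>\<^sub>0 rat) set" where
  "quot_scale R r X = qscale r ` X + R"

lemma quot_add:
  assumes "qvs.subspace R"
  shows "(x +o R) + (y +o R) = (x + y) +o R"
proof -
  have "R + R = R"
  proof
    show "R + R \<subseteq> R" using qvs.subspace_add[OF assms] by (auto elim!: set_plus_elim)
    show "R \<subseteq> R + R"
      using set_plus_intro[OF qvs.subspace_0[OF assms], of _ R] by fastforce
  qed
  then show ?thesis by (simp add: set_plus_rearrange)
qed

lemma quot_scale:
  assumes "qvs.subspace R"
  shows "quot_scale R r (x +o R) = qscale r x +o R"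
proof
  show "quot_scale R r (x +o R) \<subseteq> qscale r x +o R"
  proof
    fix z assume "z \<in> quot_scale R r (x +o R)"
    then obtain a b where "a \<in> R" "b \<in> R" "z = qscale r (x + a) + b"
      by (auto simp: quot_scale_def elt_set_plus_def elim!: set_plus_elim)
    then show "z \<in> qscale r x +o R"
      using qvs.subspace_add[OF assms qvs.subspace_scale[OF assms]]
      by (auto simp: elt_set_plus_def qvs.scale_right_distrib add.assoc)
  qed
  show "qscale r x +o R \<subseteq> quot_scale R r (x +o R)"
  proof
    fix z assume "z \<in> qscale r x +o R"
    then obtain b where b: "b \<in> R" "z = qscale r x + b"
      by (auto simp: elt_set_plus_def)
    have "x \<in> x +o R"
      using qvs.subspace_0[OF assms] by (force simp: elt_set_plus_def)
    then show "z \<in> quot_scale R r (x +o R)"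
      unfolding quot_scale_def b(2) by (intro set_plus_intro imageI b(1))
  qed
qed

text \<open>\<open>\<phi>\<close> is an isomorphism of vector spaces from \<open>V / R\<close> to \<open>W / S\<close>.\<close>

definition quot_iso :: "('a \<Rightarrow>\<^sub>0 rat) set \<Rightarrow> ('a \<Rightarrow>\<^sub>0 rat) set \<Rightarrow>
    ('b \<Rightarrow>\<^sub>0 rat) set \<Rightarrow> ('b \<Rightarrow>\<^sub>0 rat) set \<Rightarrow> (('a \<Rightarrow>\<^sub>0 rat) set \<Rightarrow> ('b \<Rightarrow>\<^sub>0 rat) set) \<Rightarrow> bool" where
  "quot_iso V R W S \<phi> \<longleftrightarrow>
     bij_betw \<phi> (quot_space V R) (quot_space W S) \<and>
     (\<forall>X \<in> quot_space V R. \<forall>Y \<in> quot_space V R. \<phi> (X + Y) = \<phi> X + \<phi> Y) \<and>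
     (\<forall>r. \<forall>X \<in> quot_space V R. \<phi> (quot_scale R r X) = quot_scale S r (\<phi> X))"

text \<open>The inclusion \<open>\<iota>\<close> regards a chord diagram as a BCR graph, so that \<open>chord_space k\<close> is a
  subspace of \<open>bcr_space k\<close>.\<close>

definition iota :: "(colored_graph \<Rightarrow>\<^sub>0 rat) \<Rightarrow> (colored_graph \<Rightarrow>\<^sub>0 rat)" where
  "iota x = x"

lemma iota_chord_space: "iota ` chord_space k \<subseteq> bcr_space k"
  by (auto simp: iota_def chord_space_def bcr_space_def colored_chord_def colored_bcr_def
      bcr_chord_diagram_def)

end

theory Submission
  imports Defs
begin

text \<open>
  An STU relation replaces a graph by graphs with one internal vertex less, and in a connected graph
  with internal vertices some dashed edge joins an internal to an external vertex. So chord diagrams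
  span. For injectivity, a linear functional on chord diagrams that kills the relations is extended
  to all BCR graphs by resolving the internal vertices one after another; it has to be shown that
  the value does not depend on the chosen edges. Resolutions at different internal vertices commute.
  Let \<open>e\<close> and \<open>e'\<close> be two edges from the same internal vertex \<open>w\<close> to external vertices. If \<open>w\<close> is
  the only internal vertex, this is the 4T relation. If the third edge \<open>f\<close> at \<open>w\<close> leads to an external
  vertex, compare both with a resolution at another internal vertex. If \<open>f\<close> leads to an internal
  vertex, the Jacobi identity along the solid line shows that the resolutions at \<open>e\<close> of the three
  terms of the IHX relation at \<open>f\<close> sum to zero, and likewise for \<open>e'\<close>; in the two other terms \<open>e\<close> and
  \<open>e'\<close> are at different internal vertices. The extended functional satisfies the IHX relations by the
  same identity, and the chord relations because they commute with resolutions.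

  Contraction and expansion keep the names of the vertices and edges. Hence all terms of a relation
  can be given the same coloring, and signs only come from isomorphisms.
\<close>

section \<open>Signs of changes of colorings\<close>

text \<open>The obstacle is that a resolution involves several choices: the edge, the order of the
  two new external vertices, and the type of the STU relation. The last two disappear in
  \<open>stu_sum\<close>, since exchanging the ends of the new solid edge is an isomorphism of sign
  1. The Jacobi identity needs a sign -1; it comes from exchanging two consecutive solid edges
  together with two vertices of the line. The solid half-edges that continue the line on either side
  are mere spectators there, so the cancellation takes place for every fixed distribution of them,
  whatever their number. For a chord relation there is a further obstacle: resolving it ends in sums
  over chord diagrams, and such a sum is a relation only if the contraction of the chord has no
  solid cycle. This condition is recovered at the chord diagrams from the fact that all terms are
  BCR graphs, by counting half-edges modulo 2.\<close>

definition relabel :: "nat set \<Rightarrow> (nat \<Rightarrow> nat) \<Rightarrow> (nat \<Rightarrow> nat) \<Rightarrow> nat \<Rightarrow> nat" where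
  "relabel A l l' a = (if a \<in> A then inv_into A l (l' a) else a)"

lemma relabel_permutes:
  assumes "bij_betw l A B" "bij_betw l' A B"
  shows "relabel A l l' permutes A"
proof (rule bij_imp_permutes)
  have "bij_betw (inv_into A l \<circ> l') A A"
    using assms by (intro bij_betw_trans[OF assms(2)] bij_betw_inv_into)
  then show "bij_betw (relabel A l l') A A"
    by (subst bij_betw_cong[of A _ "inv_into A l \<circ> l'"]) (auto simp: relabel_def)
qed (auto simp: relabel_def)

lemma relabel_apply:
  assumes "bij_betw l A B" "bij_betw l' A B" "a \<in> A"
  shows "l (relabel A l l' a) = l' a"
proof -
  have "l' a \<in> l ` A" using assms by (auto simp: bij_betw_def)
  then show ?thesis using assms(3) by (simp add: relabel_def f_inv_into_f)
qed

lemma relabel_eqI: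
  assumes "inj_on l A" "a \<in> A" "b \<in> A" "l b = l' a"
  shows "relabel A l l' a = b"
  using assms by (metis inv_into_f_f relabel_def)

text \<open>Contraction shifts the labels but keeps the names of vertices and edges. Transported
  from the labels to the labelled objects, the permutations before and after a contraction can be
  compared directly.\<close>

lemma label_perm_eq:
  assumes "bij_betw l A B" "bij_betw l' A B"
  shows "label_perm A l l' = map_permutation A l (relabel A l l')"
proof
  fix i
  show "label_perm A l l' i = map_permutation A l (relabel A l l') i"
  proof (cases "i \<in> l ` A")
    case True
    then have "inv_into A l i \<in> A" by (rule inv_into_into)
    then show ?thesis using True relabel_apply[OF assms]
      by (simp add: label_perm_def map_permutation_def restrict_id_def)
  qed (simp add: label_perm_def map_permutation_def restrict_id_def)
qed

lemma label_perm_permutes: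
  assumes "bij_betw l A B" "bij_betw l' A B"
  shows "label_perm A l l' permutes B"
  unfolding label_perm_eq[OF assms]
  by (rule map_permutation_permutes[OF assms(1) relabel_permutes[OF assms]])

lemma sign_label_perm:
  assumes "finite A" "bij_betw l A B" "bij_betw l' A B"
  shows "sign (label_perm A l l') = sign (relabel A l l')"
  unfolding label_perm_eq[OF assms(2,3)]
  using assms relabel_permutes[OF assms(2,3)]
  by (intro sign_map_permutation) (auto simp: bij_betw_def)

lemma label_perm_refl [simp]: "label_perm A l l = id"
  by (rule ext) (auto simp: label_perm_def f_inv_into_f)

lemma sign_label_perm_trans:
  assumes "finite A" "bij_betw l A B" "bij_betw l' A B" "bij_betw l'' A B"
  shows "sign (label_perm A l l'') = sign (label_perm A l l') * sign (label_perm A l' l'')"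
proof -
  have fB: "finite B" using assms(1,2) bij_betw_finite by blast
  have img: "l ` A = B" "l' ` A = B" and inj: "inj_on l' A"
    using assms by (auto simp: bij_betw_def)
  have "label_perm A l l'' i = (label_perm A l' l'' \<circ> label_perm A l l') i" for i
  proof (cases "i \<in> B")
    case True
    then have "inv_into A l i \<in> A" using img inv_into_into by metis
    then show ?thesis using True img inj by (auto simp: label_perm_def)
  qed (auto simp: label_perm_def img)
  then have "label_perm A l l'' = label_perm A l' l'' \<circ> label_perm A l l'" by blast
  moreover have "permutation (label_perm A l' l'')" "permutation (label_perm A l l')"
    using permutes_imp_permutation[OF fB] label_perm_permutes assms(2,3,4) by blast+
  ultimately show ?thesis by (simp add: sign_compose mult.commute)
qed

lemma sign_label_perm_transpose:
  assumes "finite A" "bij_betw l A B" "a \<in> A" "b \<in> A" "a \<noteq> b"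
  shows "sign (label_perm A l (l \<circ> transpose a b)) = -1"
proof -
  have b: "bij_betw (l \<circ> transpose a b) A B"
    by (rule bij_betw_trans[OF permutes_imp_bij[OF permutes_swap_id[OF assms(3,4)]] assms(2)])
  have inj: "inj_on l A" using assms by (auto simp: bij_betw_def)
  have "relabel A l (l \<circ> transpose a b) x = transpose a b x" for x
  proof (cases "x \<in> A")
    case True
    then have "transpose a b x \<in> A" using assms by (auto simp: transpose_def)
    then show ?thesis using relabel_eqI[OF inj True] by auto
  next
    case False
    then show ?thesis using assms by (auto simp: relabel_def transpose_def)
  qed
  then have "relabel A l (l \<circ> transpose a b) = transpose a b" by blast
  then show ?thesis using sign_label_perm[OF assms(1,2) b] assms(5) by (simp add: sign_swap_id)
qed

text \<open>Written as a product of signs over \<open>E\<close>, the identity holds factor by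
  factor.\<close>

lemma neg1_power_card_sym_diff:
  fixes P Q R :: "'a \<Rightarrow> bool"
  assumes "finite E"
  shows "(-1::int) ^ card {e \<in> E. P e \<noteq> R e} =
    (-1) ^ card {e \<in> E. P e \<noteq> Q e} * (-1) ^ card {e \<in> E. Q e \<noteq> R e}"
proof -
  have p: "(-1::int) ^ card {e \<in> E. S e} = (\<Prod>e\<in>E. if S e then -1 else 1)" for S
    using assms by (simp add: prod.inter_filter[symmetric])
  show ?thesis unfolding p prod.distrib[symmetric] by (intro prod.cong) auto
qed

lemma change_sign_trans:
  assumes "finite (verts G)" "finite (edges G)"
    "is_coloring k G c" "is_coloring k G c'" "is_coloring k G c''"
  shows "change_sign id_map G c c'' = change_sign id_map G c c' * change_sign id_map G c' c''"
proof (cases k)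
  case Odd_Case
  obtain l h l' h' l'' h'' where c: "c = Odd_Col l h" "c' = Odd_Col l' h'" "c'' = Odd_Col l'' h''"
    using assms Odd_Case by (cases c; cases c'; cases c'') auto
  have "sign (label_perm (verts G) l l'') =
      sign (label_perm (verts G) l l') * sign (label_perm (verts G) l' l'')"
    using assms Odd_Case by (intro sign_label_perm_trans[where B="{1..card (verts G)}"]) (auto simp: c)
  then show ?thesis
    using neg1_power_card_sym_diff[OF assms(2), of h'' h h']
    by (simp only: c id_map_def change_sign.simps o_id id_apply simp_thms mult.assoc) (simp add: ac_simps)
next
  case Even_Case
  obtain l l' l'' where c: "c = Even_Col l" "c' = Even_Col l'" "c'' = Even_Col l''"
    using assms Even_Case by (cases c; cases c'; cases c'') auto
  have "sign (label_perm (edges G) l l'') =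
      sign (label_perm (edges G) l l') * sign (label_perm (edges G) l' l'')"
    using assms Even_Case by (intro sign_label_perm_trans[where B="{1..card (edges G)}"]) (auto simp: c)
  then show ?thesis by (simp add: c id_map_def)
qed

lemma change_sign_refl:
  assumes "is_coloring k G c"
  shows "change_sign id_map G c c = 1"
  using assms by (cases k; cases c) (auto simp: id_map_def)

lemma change_sign_square:
  assumes "is_coloring k G c" "is_coloring k G c'"
  shows "change_sign f G c c' * change_sign f G c c' = 1"
  using assms
  by (cases f; cases k; cases c; cases c')
    (simp_all add: mult.assoc mult.left_commute)

lemma change_sign_sym:
  assumes "finite (verts G)" "finite (edges G)" "is_coloring k G c" "is_coloring k G c'"
  shows "change_sign id_map G c' c = change_sign id_map G c c'"
proof -
  have "change_sign id_map G c c' * change_sign id_map G c' c = 1"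
    using change_sign_trans[OF assms(1,2,3,4,3)] change_sign_refl[OF assms(3)] by simp
  then show ?thesis using change_sign_square[OF assms(3,4), of id_map]
    by (metis mult.assoc mult.right_neutral mult_1)
qed

text \<open>The permutation of the vertices underlying a change of a normalized coloring fixes or
  exchanges the two ends of \<open>e\<close>; in the second case \<open>e\<close> is reversed as well.\<close>

lemma change_sign_contract:
  assumes fin: "finite (verts G)" "finite (edges G)" and e: "e \<in> edges G"
    and mv: "m \<in> verts G" "q \<in> verts G" "m \<noteq> q"
    and att: "att G (e, False) = m" "att G (e, True) = q"
    and col: "is_coloring k G c" "is_coloring k G c'"
    and nrm: "normalized G e c" "normalized G e c'"
  shows "change_sign id_map (contract G e) (contract_col G e c) (contract_col G e c') =
    change_sign id_map G c c'"
proof (cases k)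
  case Even_Case
  obtain l l' where c: "c = Even_Col l" "c' = Even_Col l'"
    using col Even_Case by (cases c; cases c') auto
  define n where "n = card (edges G)"
  define A where "A = edges G - {e}"
  have b: "bij_betw l (edges G) {1..n}" "bij_betw l' (edges G) {1..n}" and le: "l e = 1" "l' e = 1"
    using col nrm Even_Case by (auto simp: c n_def)
  have inj: "inj_on l (edges G)" "inj_on l' (edges G)" using b by (auto simp: bij_betw_def)
  have bb: "bij_betw (\<lambda>e'. l1 e' - 1) A {1..n-1}"
    if l1: "bij_betw l1 (edges G) {1..n}" "l1 e = 1" for l1
  proof -
    have "l1 e \<in> {1..n}" using bij_betwE[OF l1(1)] e by blast
    then have "1 \<le> n" using l1(2) by simp
    then have "bij_betw l1 A ({1..n} - {1})"
      using bij_betw_DiffI[OF l1(1) , of "{e}" "{1}"] l1(2) e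
      by (auto simp: A_def bij_betw_def)
    moreover have "bij_betw (\<lambda>i. i - 1) ({1..n} - {1}) {1..n-1}"
      by (rule bij_betw_byWitness[where f'=Suc]) auto
    ultimately show ?thesis using bij_betw_trans[of l1 A _ "\<lambda>i. i - 1" "{1..n-1}"]
      by (simp add: o_def)
  qed
  have "relabel A (\<lambda>e'. l e' - 1) (\<lambda>e'. l' e' - 1) = relabel (edges G) l l'"
  proof
    fix x
    show "relabel A (\<lambda>e'. l e' - 1) (\<lambda>e'. l' e' - 1) x = relabel (edges G) l l' x"
    proof (cases "x \<in> edges G")
      case True
      define y where "y = relabel (edges G) l l' x"
      have y: "y \<in> edges G" "l y = l' x"
        unfolding y_def using permutes_in_image[OF relabel_permutes[OF b], of x] True
        by (simp_all add: relabel_apply[OF b True])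
      show ?thesis
      proof (cases "x = e")
        case True
        then have "y = e" using inj y le e by (auto simp: inj_on_def)
        then show ?thesis using True unfolding y_def[symmetric] by (simp add: relabel_def A_def)
      next
        case False
        then have xA: "x \<in> A" "y \<in> A" using True y le e inj unfolding A_def
          by (auto simp: inj_on_def)
        show ?thesis unfolding y_def[symmetric]
          using bb[OF b(1) le(1)] xA y by (intro relabel_eqI) (auto simp: bij_betw_def)
      qed
    qed (auto simp: relabel_def A_def)
  qed
  then have "sign (label_perm A (\<lambda>e'. l e' - 1) (\<lambda>e'. l' e' - 1)) = sign (label_perm (edges G) l l')"
    using sign_label_perm fin b bb[OF b(1) le(1)] bb[OF b(2) le(2)]
    by (metis A_def finite_Diff)
  then show ?thesis using fin by (simp add: c id_map_def contract_def Let_def A_def)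
next
  case Odd_Case
  obtain l h l' h' where c: "c = Odd_Col l h" "c' = Odd_Col l' h'"
    using col Odd_Case by (cases c; cases c') auto
  define n where "n = card (verts G)"
  define A where "A = verts G - {q}"
  let ?L = "\<lambda>l v. if v = m then 1 else l v - (1::nat)"
  have b: "bij_betw l (verts G) {1..n}" "bij_betw l' (verts G) {1..n}"
    using col Odd_Case by (auto simp: c n_def)
  have inj: "inj_on l (verts G)" "inj_on l' (verts G)" using b by (auto simp: bij_betw_def)
  have lmq: "l m = (if h e then 1 else 2)" "l q = (if h e then 2 else 1)"
    "l' m = (if h' e then 1 else 2)" "l' q = (if h' e then 2 else 1)"
    using nrm att by (cases "h e"; cases "h' e"; simp add: c)+
  \<comment> \<open>The ends of \<open>e\<close> occupy the labels 1 and 2. The merged vertex takes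
    1, and the labels from 3 on move down by one.\<close>
  have bb: "bij_betw (?L l1) A {1..n-1}"
    if l1: "bij_betw l1 (verts G) {1..n}" "{l1 m, l1 q} = {1,2}" for l1
  proof -
    have "2 \<in> l1 ` {m, q}" using l1(2) by auto
    then have "2 \<in> {1..n}" using l1(1) mv unfolding bij_betw_def by blast
    then have n2: "2 \<le> n" by simp
    have "bij_betw l1 (verts G - {m,q}) (l1 ` (verts G - {m, q}))"
      using l1(1) by (auto simp: bij_betw_def inj_on_def)
    moreover have "l1 ` (verts G - {m, q}) = {1..n} - l1 ` {m, q}"
      using inj_on_image_set_diff[of l1 "verts G" "verts G" "{m, q}"] l1(1) mv
      by (simp add: bij_betw_def)
    moreover have "l1 ` {m, q} = {1, 2}" using l1(2) by simp
    moreover have "{1..n} - {1, 2} = {3..n}" by auto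
    moreover have "verts G - {m, q} = A - {m}" by (auto simp: A_def)
    ultimately have "bij_betw l1 (A - {m}) {3..n}" by metis
    moreover have "bij_betw (\<lambda>i. i - 1) {3..n} {2..n-1}"
      by (rule bij_betw_byWitness[where f'=Suc]) auto
    ultimately have "bij_betw (\<lambda>v. l1 v - 1) (A - {m}) {2..n-1}"
      using bij_betw_trans[of l1 "A - {m}" _ "\<lambda>i. i - 1" "{2..n-1}"] by (simp add: o_def)
    then have "bij_betw (?L l1) (A - {m}) {2..n-1}"
      by (subst bij_betw_cong[where g="\<lambda>v. l1 v - 1"]) auto
    moreover have "bij_betw (?L l1) {m} {1}" by (simp add: bij_betw_def)
    ultimately have "bij_betw (?L l1) ({m} \<union> (A - {m})) ({1} \<union> {2..n-1})"
      by (intro bij_betw_combine) auto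
    moreover have "{m} \<union> (A - {m}) = A" using mv by (auto simp: A_def)
    moreover have "{1} \<union> {2..n-1} = {1..n-1}" using n2 by auto
    ultimately show ?thesis by metis
  qed
  have lL: "bij_betw (?L l) A {1..n-1}" "bij_betw (?L l') A {1..n-1}"
    by (rule bb[OF b(1)], simp add: lmq insert_commute, rule bb[OF b(2)], simp add: lmq insert_commute)
  define \<pi> where "\<pi> = relabel (verts G) l l'"
  have \<pi>: "\<pi> permutes verts G" "\<And>x. x \<in> verts G \<Longrightarrow> l (\<pi> x) = l' x"
    unfolding \<pi>_def using relabel_permutes[OF b] relabel_apply[OF b] by auto
  define \<rho> where "\<rho> = relabel A (?L l) (?L l')"
  have \<pi>in: "\<pi> x \<in> verts G" if "x \<in> verts G" for x using that \<pi>(1) permutes_in_image by metis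
  have \<pi>m: "\<pi> m = (if h e = h' e then m else q)" "\<pi> q = (if h e = h' e then q else m)"
    using \<pi>(2)[of m] \<pi>(2)[of q] mv lmq inj(1) \<pi>in[of m] \<pi>in[of q]
    by (auto simp: inj_on_def split: if_splits)
  \<comment> \<open>Off the two ends, \<open>\<rho>\<close> is \<open>\<pi>\<close>. It fixes
    \<open>m\<close>, which has label 1 in both contracted colorings, and \<open>q\<close>, which
    has disappeared from \<open>A\<close>.\<close>
  have \<rho>: "\<rho> x = (if x = m then m else if x = q then q else \<pi> x)" for x
  proof (cases "x \<in> A - {m}")
    case True
    then have x: "x \<in> verts G" "x \<noteq> m" "x \<noteq> q" "x \<in> A" by (auto simp: A_def)
    have inj\<pi>: "inj \<pi>" using \<pi>(1) permutes_inj by blast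
    have "\<pi> x \<noteq> m" "\<pi> x \<noteq> q" using \<pi>m inj\<pi> x by (metis injD)+
    then have "\<pi> x \<in> A" using \<pi>in x by (auto simp: A_def)
    moreover have "?L l (\<pi> x) = ?L l' x" using \<open>\<pi> x \<noteq> m\<close> x \<pi>(2) by auto
    ultimately have "\<rho> x = \<pi> x" unfolding \<rho>_def
      using lL x by (intro relabel_eqI) (auto simp: bij_betw_def)
    then show ?thesis using x by simp
  next
    case False
    show ?thesis
    proof (cases "x = m")
      case True
      have "m \<in> A" using mv by (auto simp: A_def)
      then show ?thesis unfolding \<rho>_def True using lL(1) by (simp, intro relabel_eqI) (auto simp: bij_betw_def)
    next
      case False
      then have "x \<notin> A" using \<open>x \<notin> A - {m}\<close> by auto
      then have "x \<in> verts G \<Longrightarrow> x = q" by (auto simp: A_def)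
      then have "x = q \<or> \<pi> x = x" using permutes_not_in[OF \<pi>(1), of x] by blast
      moreover have "\<rho> x = x" using \<open>x \<notin> A\<close> by (simp add: \<rho>_def relabel_def)
      ultimately show ?thesis using False by (metis (full_types))
    qed
  qed
  have s1: "sign (label_perm (verts G) l l') = sign \<pi>"
    unfolding \<pi>_def by (rule sign_label_perm[OF fin(1) b])
  have s2: "sign (label_perm A (?L l) (?L l')) = sign \<rho>"
    unfolding \<rho>_def by (rule sign_label_perm[OF _ lL]) (use fin in \<open>simp add: A_def\<close>)
  let ?K = "{e' \<in> edges G - {e}. h' e' \<noteq> h e'}"
  have main: "sign \<rho> * (-1) ^ card ?K = sign \<pi> * (-1) ^ card {e' \<in> edges G. h' e' \<noteq> h e'}"
  proof (cases "h e = h' e")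
    case True
    then have "\<rho> = \<pi>" using \<rho> \<pi>m by auto
    moreover have "?K = {e' \<in> edges G. h' e' \<noteq> h e'}" using True by auto
    ultimately show ?thesis by simp
  next
    case False
    have "\<rho> x = (\<pi> \<circ> transpose m q) x" for x
      using \<rho>[of x] \<pi>m False by (auto simp: transpose_def)
    then have "\<rho> = \<pi> \<circ> transpose m q" by blast
    then have "sign \<rho> = - sign \<pi>"
      using sign_compose[of \<pi> "transpose m q"] permutes_imp_permutation[OF fin(1) \<pi>(1)] mv(3)
      by (simp add: sign_swap_id permutation_swap_id)
    moreover have "{e' \<in> edges G. h' e' \<noteq> h e'} = insert e ?K" using False e by auto
    then have "card {e' \<in> edges G. h' e' \<noteq> h e'} = Suc (card ?K)" using fin by simp
    ultimately show ?thesis by simp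
  qed
  have "{e' \<in> edges G. e' \<noteq> e \<and> h' e' = (\<not> h e')} = ?K"
    "{e' \<in> edges G. h' e' = (\<not> h e')} = {e' \<in> edges G. h' e' \<noteq> h e'}" by auto
  then show ?thesis using main s1 s2
    by (simp add: c id_map_def contract_def Let_def A_def att cong: if_cong)
qed

lemma exists_normalized:
  assumes fin: "finite (verts G)" "finite (edges G)" and e: "e \<in> edges G"
    and mv: "att G (e, False) \<in> verts G" "att G (e, True) \<in> verts G"
      "att G (e, False) \<noteq> att G (e, True)"
    and col: "is_coloring k G c"
  obtains c1 where "is_coloring k G c1" "normalized G e c1"
proof (cases k)
  case Odd_Case
  then obtain l h where c: "c = Odd_Col l h" using col by (cases c) auto
  define n where "n = card (verts G)"
  let ?m = "att G (e, False)" and ?q = "att G (e, True)"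
  have b: "bij_betw l (verts G) {1..n}" using col Odd_Case by (auto simp: c n_def)
  \<comment> \<open>\<open>y\<close> is the label of \<open>?q\<close> after the first
    transposition. It differs from 1, so moving it to 2 leaves the label 1 of \<open>?m\<close> in
    place.\<close>
  define y where "y = transpose (l ?m) 1 (l ?q)"
  define s where "s = transpose y 2 \<circ> transpose (l ?m) 1"
  have lne: "l ?m \<noteq> l ?q" using b mv by (auto simp: bij_betw_def inj_on_def)
  have lin: "l ?m \<in> {1..n}" "l ?q \<in> {1..n}" using b mv by (auto dest: bij_betwE)
  have n2: "2 \<le> n" using lin lne by auto
  have y: "y \<in> {1..n}" "y \<noteq> 1" using lin lne n2 by (auto simp: y_def transpose_def)
  have "s permutes {1..n}" unfolding s_def using y lin n2
    by (intro permutes_compose permutes_swap_id) auto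
  then have "bij_betw (s \<circ> l) (verts G) {1..n}"
    using bij_betw_trans[OF b permutes_imp_bij] by blast
  moreover have "s (l ?m) = 1" "s (l ?q) = 2" using y by (auto simp: s_def y_def transpose_def)
  ultimately show ?thesis
    using that[of "Odd_Col (s \<circ> l) (h(e := True))"] Odd_Case by (auto simp: n_def)
next
  case Even_Case
  then obtain l where c: "c = Even_Col l" using col by (cases c) auto
  define n where "n = card (edges G)"
  have b: "bij_betw l (edges G) {1..n}" using col Even_Case by (auto simp: c n_def)
  have "l e \<in> {1..n}" using b e by (auto dest: bij_betwE)
  then have "transpose (l e) 1 permutes {1..n}" by (intro permutes_swap_id) auto
  then have "bij_betw (transpose (l e) 1 \<circ> l) (edges G) {1..n}"
    using bij_betw_trans[OF b permutes_imp_bij] by blast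
  then show ?thesis
    using that[of "Even_Col (transpose (l e) 1 \<circ> l)"] Even_Case by (auto simp: n_def)
qed

lemma is_coloring_cong:
  "verts G = verts G' \<Longrightarrow> edges G = edges G' \<Longrightarrow> is_coloring k G c = is_coloring k G' c"
  by (cases k; cases c) auto

lemma change_sign_cong:
  "verts G = verts G' \<Longrightarrow> edges G = edges G' \<Longrightarrow> change_sign f G c c' = change_sign f G' c c'"
  by (cases f; cases c; cases c') auto

lemma normalized_cong:
  assumes "\<And>b. att G (e, b) = att G' (e, b)"
  shows "normalized G e c = normalized G' e c"
  by (cases c) (auto simp: assms)

lemma contract_col_cong:
  assumes "\<And>b. att G (e, b) = att G' (e, b)"
  shows "contract_col G e c = contract_col G' e c"
  by (cases c) (auto simp: assms)

text \<open>Re-expanding an edge keeps the names of its ends, so \<open>same_contraction\<close> just says that the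
  two colorings, read on the same vertices and edges, differ by an even change.\<close>

lemma same_contraction_change_sign:
  assumes G: "finite (verts G)" "finite (edges G)" "e \<in> edges G"
      "att G (e, False) \<in> verts G" "att G (e, True) \<in> verts G"
      "att G (e, False) \<noteq> att G (e, True)"
    and G': "verts G' = verts G" "edges G' = edges G" "\<And>b. att G' (e, b) = att G (e, b)"
    and col: "is_coloring k G c" "is_coloring k G' c'"
    and sc: "same_contraction k e (G, c) (G', c')"
  shows "change_sign id_map G c c' = 1"
proof -
  obtain s d s' d' where con: "contraction k G c e s d" "contraction k G' c' e s' d'"
    and eq: "s * s' * change_sign id_map (contract G e) d d' = 1"
    using sc by auto
  obtain c1 where c1: "is_coloring k G c1" "normalized G e c1"
    "s = change_sign id_map G c c1" "d = contract_col G e c1"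
    using con(1) by (auto simp: contraction_def)
  obtain c1' where "is_coloring k G' c1'" "normalized G' e c1'"
    "s' = change_sign id_map G' c' c1'" "d' = contract_col G' e c1'"
    using con(2) by (auto simp: contraction_def)
  then have c1': "is_coloring k G c1'" "normalized G e c1'"
    "s' = change_sign id_map G c' c1'" "d' = contract_col G e c1'"
    using is_coloring_cong[OF G'(1,2)] normalized_cong[of G' e G] contract_col_cong[of G' e G]
      change_sign_cong[OF G'(1,2)] G'(3) by auto
  have c': "is_coloring k G c'" using col(2) is_coloring_cong[OF G'(1,2)] by auto
  have "change_sign id_map (contract G e) d d' = change_sign id_map G c1 c1'"
    unfolding c1 c1' by (rule change_sign_contract[OF G(1-6) refl refl c1(1) c1'(1) c1(2) c1'(2)])
  then have "change_sign id_map G c c1 * change_sign id_map G c' c1' * change_sign id_map G c1 c1' = 1"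
    using eq c1 c1' by simp
  moreover have "change_sign id_map G c c' =
      change_sign id_map G c c1 * (change_sign id_map G c1 c1' * change_sign id_map G c1' c')"
    using change_sign_trans[OF G(1,2)] col(1) c' c1(1) c1'(1) by metis
  moreover have "change_sign id_map G c1' c' = change_sign id_map G c' c1'"
    using change_sign_sym[OF G(1,2) c' c1'(1)] .
  ultimately show ?thesis by (simp add: ac_simps)
qed

text \<open>A partial converse: if both graphs carry the coloring \<open>c\<close>, one normalized
  coloring \<open>c1\<close> serves for both, the contracted colorings coincide, and the sign of the
  change to \<open>c1\<close> occurs squared.\<close>

lemma same_contraction_same_coloring:
  assumes G: "finite (verts G)" "finite (edges G)" "e \<in> edges G"
      "att G (e, False) \<in> verts G" "att G (e, True) \<in> verts G"
      "att G (e, False) \<noteq> att G (e, True)"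
    and G': "verts G' = verts G" "edges G' = edges G" "\<And>b. att G' (e, b) = att G (e, b)"
    and col: "is_coloring k G c"
    and iso: "is_iso id_map (contract G e) (contract G' e)"
  shows "same_contraction k e (G, c) (G', c)"
proof -
  obtain c1 where c1: "is_coloring k G c1" "normalized G e c1"
    using exists_normalized[OF G col] by blast
  let ?s = "change_sign id_map G c c1" and ?d = "contract_col G e c1"
  have "contraction k G c e ?s ?d" using c1 by (auto simp: contraction_def)
  moreover have "contraction k G' c e ?s ?d"
    unfolding contraction_def
    using c1 is_coloring_cong[OF G'(1,2)] normalized_cong[of G' e G] contract_col_cong[of G' e G]
      change_sign_cong[OF G'(1,2)] G'(3) by metis
  moreover have "?s * ?s * change_sign id_map (contract G e) ?d ?d = 1"
    using change_sign_square[OF col c1(1)]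
    by (cases c1) (auto simp: id_map_def)
  ultimately show ?thesis using iso
    by (simp only: same_contraction.simps) blast
qed

section \<open>Moving half-edges between the ends of an edge\<close>

lemma bcrD:
  assumes "bcr_graph G"
  shows "wf_graph G" "finite (verts G)" "finite (edges G)" "ext G \<subseteq> verts G" "solid G \<subseteq> edges G"
    "\<And>e b. e \<in> edges G \<Longrightarrow> att G (e, b) \<in> verts G"
    "connected_graph G" "ext G \<noteq> {}"
    "\<And>v. v \<in> internal G \<Longrightarrow> card (dashed_at G v) = 3"
    "\<And>v. v \<in> internal G \<Longrightarrow> solid_at G v = {}"
    "\<And>v. v \<in> ext G \<Longrightarrow> card (dashed_at G v) = 1"
    "\<And>v. v \<in> ext G \<Longrightarrow> card (solid_at G v) \<le> 2"
    "broken_lines G"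
  using assms by (auto simp: bcr_graph_def wf_graph_def)

lemma finite_at [simp]:
  assumes "bcr_graph G"
  shows "finite (dashed_at G v)" "finite (solid_at G v)" "finite (internal G)"
proof -
  have "finite (edges G \<times> (UNIV::bool set))" using bcrD(3)[OF assms] by simp
  moreover have "dashed_at G v \<subseteq> edges G \<times> UNIV" "solid_at G v \<subseteq> edges G \<times> UNIV"
    using bcrD(5)[OF assms] by (auto simp: dashed_at_def solid_at_def dashed_def)
  ultimately show "finite (dashed_at G v)" "finite (solid_at G v)" by (auto intro: finite_subset)
  show "finite (internal G)" using bcrD(2)[OF assms] by (simp add: internal_def)
qed

lemma solid_att_ext:
  assumes "bcr_graph G" "s \<in> solid G"
  shows "att G (s, b) \<in> ext G"
proof (rule ccontr)
  assume "att G (s, b) \<notin> ext G"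
  then have "att G (s, b) \<in> internal G" using bcrD(5,6)[OF assms(1)] assms(2) by (auto simp: internal_def)
  then show False using bcrD(10)[OF assms(1)] assms(2) by (auto simp: solid_at_def)
qed

lemma dashed_at_ext:
  assumes "bcr_graph G" "e \<in> dashed G" "att G (e, b) \<in> ext G"
  shows "dashed_at G (att G (e, b)) = {(e, b)}"
proof -
  have "(e, b) \<in> dashed_at G (att G (e, b))" using assms by (auto simp: dashed_at_def)
  then show ?thesis using bcrD(11)[OF assms(1,3)] by (metis card_1_singletonE singletonD)
qed

text \<open>The combined effect of a contraction and an expansion, where \<open>b\<close> selects the end of \<open>e\<close> that
  receives \<open>P\<close>; \<open>reexpand\<close> is the case \<open>b = False\<close>.\<close>

definition resplit :: "bool \<Rightarrow> graph \<Rightarrow> nat \<Rightarrow> bool \<Rightarrow> (nat \<times> bool) set \<Rightarrow> graph" where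
  "resplit s G e b P =
    G\<lparr>ext := if s then insert (att G (e, b)) (insert (att G (e, \<not> b)) (ext G)) else ext G,
      solid := if s then insert e (solid G) else solid G,
      att := \<lambda>h. if fst h = e \<or> att G h \<notin> {att G (e, b), att G (e, \<not> b)} then att G h
                 else if h \<in> P then att G (e, b) else att G (e, \<not> b)\<rparr>"

lemma resplit_simps [simp]:
  "verts (resplit s G e b P) = verts G"
  "edges (resplit s G e b P) = edges G"
  "ext (resplit s G e b P) =
     (if s then insert (att G (e, b)) (insert (att G (e, \<not> b)) (ext G)) else ext G)"
  "solid (resplit s G e b P) = (if s then insert e (solid G) else solid G)"
  "dashed (resplit s G e b P) = (if s then dashed G - {e} else dashed G)"
  "internal (resplit s G e b P) =
     (if s then internal G - {att G (e, b), att G (e, \<not> b)} else internal G)"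
  "att (resplit s G e b P) (e, b') = att G (e, b')"
  by (auto simp: resplit_def dashed_def internal_def)

lemma att_resplit:
  "att (resplit s G e b P) h =
     (if fst h = e \<or> att G h \<notin> {att G (e, b), att G (e, \<not> b)} then att G h
      else if h \<in> P then att G (e, b) else att G (e, \<not> b))"
  by (simp add: resplit_def)

lemma graph_eqI:
  fixes G G' :: graph
  assumes "verts G = verts G'" "edges G = edges G'" "ext G = ext G'" "solid G = solid G'"
    "\<And>h. att G h = att G' h"
  shows "G = G'"
  using assms by (intro graph.equality) auto

text \<open>Each re-expansion moves only half-edges at the two ends of its own edge. All arguments
  by which relations commute with resolutions rest on this.\<close>

lemma resplit_commute:
  assumes "{att G (e, b), att G (e, \<not> b)} \<inter> {att G (e', b'), att G (e', \<not> b')} = {}"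
  shows "resplit s (resplit s' G e' b' P') e b P = resplit s' (resplit s G e b P) e' b' P'"
proof -
  have "att (resplit s' G e' b' P') (e, c) = att G (e, c)" for c
    using assms by (cases c; cases b; auto simp: att_resplit)
  moreover have "att (resplit s G e b P) (e', c) = att G (e', c)" for c
    using assms by (cases c; cases b'; auto simp: att_resplit)
  moreover have "att (resplit s (resplit s' G e' b' P') e b P) h =
      att (resplit s' (resplit s G e b P) e' b' P') h" for h
  proof -
    have ends: "att G (f, d) \<in> {att G (f, c), att G (f, \<not> c)}" for f c d
      by (cases c; cases d) auto
    have "fst h = e \<Longrightarrow> att G h \<in> {att G (e, b), att G (e, \<not> b)}"
      "fst h = e' \<Longrightarrow> att G h \<in> {att G (e', b'), att G (e', \<not> b')}"
      using ends[of "fst h" "snd h" b] ends[of "fst h" "snd h" b'] by auto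
    then consider "att G h \<in> {att G (e, b), att G (e, \<not> b)}" "fst h \<noteq> e'"
        "att G h \<notin> {att G (e', b'), att G (e', \<not> b')}"
      | "att G h \<in> {att G (e', b'), att G (e', \<not> b')}" "fst h \<noteq> e"
        "att G h \<notin> {att G (e, b), att G (e, \<not> b)}"
      | "att G h \<notin> {att G (e, b), att G (e, \<not> b)}" "att G h \<notin> {att G (e', b'), att G (e', \<not> b')}"
      using assms by blast
    then show ?thesis
      unfolding att_resplit[of _ "resplit _ _ _ _ _"] calculation att_resplit[of _ G]
      by cases (use assms in simp_all)
  qed
  ultimately show ?thesis by (intro graph_eqI) auto
qed

text \<open>The three cases are those of the STU, chord and IHX relations. They turn all terms of a
  relation into graphs on the vertices and edges of \<open>G\<close> itself.\<close>

lemma reexpand_eq_resplit: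
  assumes "att G (e, False) \<noteq> att G (e, True)" "att G (e, False) \<in> verts G"
    "att G (e, True) \<in> verts G" "e \<in> dashed G"
  shows "att G (e, False) \<in> ext G \<or> att G (e, True) \<in> ext G \<Longrightarrow>
      reexpand G e True True P = resplit True G e False P"
    "att G (e, False) \<in> ext G \<Longrightarrow> att G (e, True) \<in> ext G \<Longrightarrow>
      reexpand G e True False P = resplit False G e False P"
    "att G (e, False) \<notin> ext G \<Longrightarrow> att G (e, True) \<notin> ext G \<Longrightarrow>
      reexpand G e False False P = resplit False G e False P"
  using assms
  by (auto intro!: graph_eqI simp: reexpand_def expand_def contract_def Let_def dashed_def att_resplit
      split: if_splits)

section \<open>Resolutions at an edge from an external to an internal vertex\<close>

definition stu_edge :: "graph \<Rightarrow> nat \<Rightarrow> bool \<Rightarrow> bool" where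
  "stu_edge G e b \<longleftrightarrow> e \<in> dashed G \<and> att G (e, b) \<in> ext G \<and> att G (e, \<not> b) \<in> internal G"

text \<open>The ways to distribute the solid half-edges of the external vertex over the two new
  vertices: each of these also carries the new solid edge, so it has room for one more. With one or
  two solid half-edges there are two ways, with none there is one.\<close>

definition balanced :: "(nat \<times> bool) set \<Rightarrow> (nat \<times> bool) set set" where
  "balanced S = {A. A \<subseteq> S \<and> card A \<le> 1 \<and> card (S - A) \<le> 1}"

lemma resplit_at_other:
  assumes "z \<noteq> att G (e, b)" "z \<noteq> att G (e, \<not> b)"
  shows "dashed_at (resplit s G e b P) z = dashed_at G z"
    "solid_at (resplit s G e b P) z = solid_at G z"
proof -
  have "att (resplit s G e b P) h = z \<longleftrightarrow> att G h = z" for h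
    using assms by (auto simp: att_resplit)
  moreover have "att G (e, c) \<noteq> z" for c using assms by (cases c; cases b) auto
  ultimately show "dashed_at (resplit s G e b P) z = dashed_at G z"
    "solid_at (resplit s G e b P) z = solid_at G z"
    by (auto simp: dashed_at_def solid_at_def)
qed

lemma resplit_at:
  assumes "att G (e, b) \<noteq> att G (e, \<not> b)" "e \<in> dashed G" "e \<notin> solid G"
  shows "dashed_at (resplit s G e b P) (att G (e, b)) = (if s then {} else {(e, b)}) \<union>
      (dashed_at G (att G (e, b)) \<union> dashed_at G (att G (e, \<not> b)) - {(e, b), (e, \<not> b)}) \<inter> P"
    "dashed_at (resplit s G e b P) (att G (e, \<not> b)) = (if s then {} else {(e, \<not> b)}) \<union>
      (dashed_at G (att G (e, b)) \<union> dashed_at G (att G (e, \<not> b)) - {(e, b), (e, \<not> b)} - P)"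
    "solid_at (resplit s G e b P) (att G (e, b)) = (if s then {(e, b)} else {}) \<union>
      (solid_at G (att G (e, b)) \<union> solid_at G (att G (e, \<not> b))) \<inter> P"
    "solid_at (resplit s G e b P) (att G (e, \<not> b)) = (if s then {(e, \<not> b)} else {}) \<union>
      (solid_at G (att G (e, b)) \<union> solid_at G (att G (e, \<not> b)) - P)"
proof -
  let ?H = "resplit s G e b P" and ?v = "att G (e, b)" and ?w = "att G (e, \<not> b)"
  have e: "att ?H (e, c) = ?v \<longleftrightarrow> c = b" "att ?H (e, c) = ?w \<longleftrightarrow> c = (\<not> b)" for c
    using assms(1) by (cases "c = b"; auto)+
  have f: "att ?H (f, c) = ?v \<longleftrightarrow> att G (f, c) \<in> {?v, ?w} \<and> (f, c) \<in> P"
    "att ?H (f, c) = ?w \<longleftrightarrow> att G (f, c) \<in> {?v, ?w} \<and> (f, c) \<notin> P" if "f \<noteq> e" for f c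
    using assms(1) that by (auto simp: att_resplit)
  show "dashed_at ?H ?v = (if s then {} else {(e, b)}) \<union>
      (dashed_at G ?v \<union> dashed_at G ?w - {(e, b), (e, \<not> b)}) \<inter> P"
  proof (rule set_eqI)
    fix h show "h \<in> dashed_at ?H ?v \<longleftrightarrow> h \<in> (if s then {} else {(e, b)}) \<union>
        (dashed_at G ?v \<union> dashed_at G ?w - {(e, b), (e, \<not> b)}) \<inter> P"
      using assms e f by (cases h; cases "fst h = e") (auto simp: dashed_at_def)
  qed
  show "dashed_at ?H ?w = (if s then {} else {(e, \<not> b)}) \<union>
      (dashed_at G ?v \<union> dashed_at G ?w - {(e, b), (e, \<not> b)} - P)"
  proof (rule set_eqI)
    fix h show "h \<in> dashed_at ?H ?w \<longleftrightarrow> h \<in> (if s then {} else {(e, \<not> b)}) \<union>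
        (dashed_at G ?v \<union> dashed_at G ?w - {(e, b), (e, \<not> b)} - P)"
      using assms e f by (cases h; cases "fst h = e") (auto simp: dashed_at_def)
  qed
  show "solid_at ?H ?v = (if s then {(e, b)} else {}) \<union> (solid_at G ?v \<union> solid_at G ?w) \<inter> P"
  proof (rule set_eqI)
    fix h show "h \<in> solid_at ?H ?v \<longleftrightarrow>
        h \<in> (if s then {(e, b)} else {}) \<union> (solid_at G ?v \<union> solid_at G ?w) \<inter> P"
      using assms e f by (cases h; cases "fst h = e") (auto simp: solid_at_def)
  qed
  show "solid_at ?H ?w = (if s then {(e, \<not> b)} else {}) \<union> (solid_at G ?v \<union> solid_at G ?w - P)"
  proof (rule set_eqI)
    fix h show "h \<in> solid_at ?H ?w \<longleftrightarrow>
        h \<in> (if s then {(e, \<not> b)} else {}) \<union> (solid_at G ?v \<union> solid_at G ?w - P)"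
      using assms e f by (cases h; cases "fst h = e") (auto simp: solid_at_def)
  qed
qed

text \<open>Every half-edge stays at its vertex or moves to the other end of \<open>e\<close>. As
  \<open>e\<close> still joins its two ends, each step in the old graph can be imitated.\<close>

lemma connected_resplit:
  assumes "connected_graph G" "e \<in> edges G"
  shows "connected_graph (resplit s G e b P)"
proof -
  let ?G' = "resplit s G e b P"
  let ?v = "att G (e, b)" and ?w = "att G (e, \<not> b)"
  define R where "R = {(x, y). \<exists>e \<in> edges G. joins G e x y}"
  define R' where "R' = {(x, y). \<exists>e \<in> edges ?G'. joins ?G' e x y}"
  have "joins ?G' e ?v ?w" "joins ?G' e ?w ?v" unfolding joins_def
    by (auto intro: exI[of _ b] exI[of _ "\<not> b"])
  then have vw: "(?v, ?w) \<in> R'" "(?w, ?v) \<in> R'" using assms(2) by (auto simp: R'_def)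
  have near: "(att G h, att ?G' h) \<in> R'\<^sup>*" "(att ?G' h, att G h) \<in> R'\<^sup>*" for h
    using vw by (auto simp: att_resplit)
  have "(x, y) \<in> R'\<^sup>*" if xy: "(x, y) \<in> R" for x y
  proof -
    obtain f c where f: "f \<in> edges G" "att G (f, c) = x" "att G (f, \<not> c) = y"
      using xy by (auto simp: R_def joins_def)
    then have "(att ?G' (f, c), att ?G' (f, \<not> c)) \<in> R'" by (auto simp: R'_def joins_def)
    then show ?thesis using near(1)[of "(f, c)"] near(2)[of "(f, \<not> c)"] f
      by (meson r_into_rtrancl rtrancl_trans)
  qed
  then have "R\<^sup>* \<subseteq> R'\<^sup>*" by (metis rtrancl_subset_rtrancl subrelI)
  then show ?thesis using assms(1) unfolding connected_graph_def R_def[symmetric] R'_def[symmetric]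
    by auto
qed

context
  fixes G e b
  assumes G: "bcr_graph G" and stu: "stu_edge G e b"
begin

abbreviation (input) "sv \<equiv> att G (e, b)"
abbreviation (input) "sw \<equiv> att G (e, \<not> b)"

lemma stu_edgeD:
  "e \<in> dashed G" "e \<in> edges G" "e \<notin> solid G" "sv \<in> ext G" "sw \<in> internal G" "sw \<notin> ext G" "sv \<noteq> sw"
  "sv \<in> verts G" "sw \<in> verts G" "dashed_at G sv = {(e, b)}" "solid_at G sw = {}"
  "(e, \<not> b) \<in> dashed_at G sw" "card (dashed_at G sw - {(e, \<not> b)}) = 2"
proof -
  show 1: "e \<in> dashed G" "sv \<in> ext G" "sw \<in> internal G" using stu by (auto simp: stu_edge_def)
  then show "e \<in> edges G" "e \<notin> solid G" "sw \<notin> ext G" "sv \<noteq> sw" "sv \<in> verts G" "sw \<in> verts G"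
    using bcrD(4)[OF G] by (auto simp: dashed_def internal_def)
  show "dashed_at G sv = {(e, b)}" using dashed_at_ext[OF G 1(1,2)] .
  show "solid_at G sw = {}" using bcrD(10)[OF G 1(3)] .
  show 2: "(e, \<not> b) \<in> dashed_at G sw" using 1 by (auto simp: dashed_at_def)
  show "card (dashed_at G sw - {(e, \<not> b)}) = 2" using bcrD(9)[OF G 1(3)] 2 by simp
qed

lemma split_at:
  assumes "A \<subseteq> solid_at G sv" "x \<in> dashed_at G sw - {(e, \<not> b)}"
  shows "dashed_at (resplit True G e b (insert x A)) sv = {x}"
    "dashed_at (resplit True G e b (insert x A)) sw = dashed_at G sw - {(e, \<not> b), x}"
    "solid_at (resplit True G e b (insert x A)) sv = insert (e, b) A"
    "solid_at (resplit True G e b (insert x A)) sw = insert (e, \<not> b) (solid_at G sv - A)"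
proof -
  note D = stu_edgeD
  have M: "dashed_at G sv \<union> dashed_at G sw - {(e, b), (e, \<not> b)} = dashed_at G sw - {(e, \<not> b)}"
    "solid_at G sv \<union> solid_at G sw = solid_at G sv"
    using D(7) unfolding D(10,11) by (auto simp: dashed_at_def)
  have "dashed_at G sw \<inter> A = {}" "x \<notin> solid_at G sv"
    using assms by (auto simp: dashed_at_def solid_at_def dashed_def)
  then show "dashed_at (resplit True G e b (insert x A)) sv = {x}"
    "dashed_at (resplit True G e b (insert x A)) sw = dashed_at G sw - {(e, \<not> b), x}"
    "solid_at (resplit True G e b (insert x A)) sv = insert (e, b) A"
    "solid_at (resplit True G e b (insert x A)) sw = insert (e, \<not> b) (solid_at G sv - A)"
    unfolding resplit_at[OF D(7,1,3)] M using assms by auto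
qed

text \<open>In the path through \<open>sv\<close>, this vertex is replaced by the two ends of
  \<open>e\<close>, with \<open>e\<close> between them. Their order along the path is dictated by
  which end received the half-edge of the preceding edge. All other paths survive.\<close>

lemma broken_lines_split:
  assumes A: "A \<in> balanced (solid_at G sv)" and x: "x \<in> dashed_at G sw - {(e, \<not> b)}"
  shows "broken_lines (resplit True G e b (insert x A))"
proof -
  note D = stu_edgeD
  let ?G' = "resplit True G e b (insert x A)"
  have A': "A \<subseteq> solid_at G sv" "card A \<le> 1" "card (solid_at G sv - A) \<le> 1"
    using A by (auto simp: balanced_def)
  have "finite (solid_at G sv)" using G by simp
  then have fin: "finite (solid_at G sv)" "finite A" using finite_subset[OF A'(1)] by blast+
  have x': "x \<notin> solid G \<times> UNIV" using x unfolding dashed_at_def dashed_def by blast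
  obtain Ps where Ps0: "\<forall>(vs, es) \<in> Ps. solid_path G vs es"
    "\<forall>p \<in> Ps. \<forall>q \<in> Ps. p \<noteq> q \<longrightarrow> set (fst p) \<inter> set (fst q) = {}"
    and Ps34: "(\<Union>p \<in> Ps. set (fst p)) = ext G" "(\<Union>p \<in> Ps. set (snd p)) = solid G"
    using bcrD(13)[OF G] unfolding broken_lines_def by (elim exE conjE)
  have Ps: "\<And>vs es. (vs, es) \<in> Ps \<Longrightarrow> solid_path G vs es"
    "\<And>p q. p \<in> Ps \<Longrightarrow> q \<in> Ps \<Longrightarrow> p \<noteq> q \<Longrightarrow> set (fst p) \<inter> set (fst q) = {}"
    "(\<Union>p \<in> Ps. set (fst p)) = ext G" "(\<Union>p \<in> Ps. set (snd p)) = solid G"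
    using Ps0 Ps34 by blast+
  have "sv \<in> (\<Union>p \<in> Ps. set (fst p))" using Ps(3) D(4) by simp
  then obtain vs es where p0: "(vs, es) \<in> Ps" "sv \<in> set vs" by (metis UN_E prod.collapse)
  obtain i where i: "i < length vs" "vs ! i = sv" using p0(2) by (metis in_set_conv_nth)
  have path: "distinct vs" "length vs = Suc (length es)" "set vs \<subseteq> ext G" "set es \<subseteq> solid G"
    "\<And>j. j < length es \<Longrightarrow> joins G (es ! j) (vs ! j) (vs ! Suc j)"
    using Ps(1)[OF p0(1)] by (auto simp: solid_path_def)
  have at: "att ?G' h = (if h \<in> A then sv else sw)" if "h \<in> solid_at G sv" for h
  proof -
    have "h \<noteq> x" "fst h \<noteq> e" "att G h = sv" using that x' D(3) by (auto simp: solid_at_def)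
    then show ?thesis by (auto simp: att_resplit)
  qed
  \<comment> \<open>A solid edge that avoids \<open>sv\<close> is unaffected, because the internal
    vertex \<open>sw\<close> is on no solid edge.\<close>
  have keep: "joins ?G' s y z" if s: "s \<in> solid G" "joins G s y z" "y \<noteq> sv" "z \<noteq> sv" for s y z
  proof -
    obtain c where c: "att G (s, c) = y" "att G (s, \<not> c) = z" using s(2) by (auto simp: joins_def)
    have "y \<noteq> sw" "z \<noteq> sw" using c solid_att_ext[OF G s(1)] D(6) by metis+
    then have "att ?G' (s, c) = y" "att ?G' (s, \<not> c) = z" using c s(3,4)
      by (auto simp: att_resplit)
    then show ?thesis unfolding joins_def by blast
  qed
  have pr: "\<exists>h. h \<in> solid_at G sv \<and> fst h = es ! (i - 1) \<and> joins ?G' (es ! (i - 1)) (vs ! (i - 1)) (att ?G' h)"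
    if "0 < i"
  proof -
    have l: "i - 1 < length es" using that i path(2) by simp
    have "joins G (es ! (i - 1)) (vs ! (i - 1)) sv" using path(5)[OF l] that i by simp
    then obtain c where c: "att G (es ! (i - 1), c) = vs ! (i - 1)" "att G (es ! (i - 1), \<not> c) = sv"
      by (auto simp: joins_def)
    have s: "es ! (i - 1) \<in> solid G" using path(4) l by (meson nth_mem subsetD)
    have ne: "vs ! (i - 1) \<noteq> sv" "vs ! (i - 1) \<noteq> sw"
      using i that nth_eq_iff_index_eq[OF path(1), of "i - 1" i] solid_att_ext[OF G s, of c] D(6) c(1)
      by auto
    have "att ?G' (es ! (i - 1), c) = vs ! (i - 1)" using c ne by (simp add: att_resplit)
    then show ?thesis using c s
      by (intro exI[of _ "(es ! (i - 1), \<not> c)"]) (auto simp: solid_at_def joins_def)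
  qed
  have nx: "\<exists>h. h \<in> solid_at G sv \<and> fst h = es ! i \<and> joins ?G' (es ! i) (att ?G' h) (vs ! Suc i)"
    if l: "i < length es"
  proof -
    have "joins G (es ! i) sv (vs ! Suc i)" using path(5)[OF l] i by simp
    then obtain c where c: "att G (es ! i, c) = sv" "att G (es ! i, \<not> c) = vs ! Suc i"
      by (auto simp: joins_def)
    have s: "es ! i \<in> solid G" using path(4) l by (meson nth_mem subsetD)
    have "vs ! Suc i \<noteq> vs ! i" using nth_eq_iff_index_eq[OF path(1), of "Suc i" i] l path(2) by simp
    then have ne: "vs ! Suc i \<noteq> sv" "vs ! Suc i \<noteq> sw"
      using i solid_att_ext[OF G s, of "\<not> c"] D(6) c(2) by auto
    have "att ?G' (es ! i, \<not> c) = vs ! Suc i" using c ne by (simp add: att_resplit)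
    then show ?thesis using c s
      by (intro exI[of _ "(es ! i, c)"]) (auto simp: solid_at_def joins_def)
  qed
  have "\<exists>v1 v2. {v1, v2} = {sv, sw} \<and> (0 < i \<longrightarrow> joins ?G' (es ! (i - 1)) (vs ! (i - 1)) v1) \<and>
      (i < length es \<longrightarrow> joins ?G' (es ! i) v2 (vs ! Suc i))"
  proof (cases "0 < i")
    case True
    then obtain h1 where h1: "h1 \<in> solid_at G sv" "fst h1 = es ! (i - 1)"
      "joins ?G' (es ! (i - 1)) (vs ! (i - 1)) (att ?G' h1)" using pr by blast
    show ?thesis
    proof (cases "i < length es")
      case True
      then obtain h2 where h2: "h2 \<in> solid_at G sv" "fst h2 = es ! i"
        "joins ?G' (es ! i) (att ?G' h2) (vs ! Suc i)" using nx by blast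
      \<comment> \<open>The half-edges \<open>h1\<close> and \<open>h2\<close> belong to different
        edges, hence are different, and a balanced set \<open>A\<close> contains exactly one of
        them.\<close>
      have "es ! (i - 1) \<noteq> es ! i"
      proof
        assume eq: "es ! (i - 1) = es ! i"
        have "joins G (es ! i) (vs ! (i - 1)) (vs ! i)" "joins G (es ! i) (vs ! i) (vs ! Suc i)"
          using path(5)[of "i - 1"] path(5)[OF True] \<open>0 < i\<close> True eq by auto
        then have "{vs ! (i - 1), vs ! i} = {vs ! i, vs ! Suc i}"
          unfolding joins_def by (smt (verit) insert_commute)
        moreover have "vs ! (i - 1) \<noteq> vs ! i" "vs ! (i - 1) \<noteq> vs ! Suc i"
          using nth_eq_iff_index_eq[OF path(1)] \<open>0 < i\<close> True path(2) by auto
        ultimately show False by auto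
      qed
      then have "h1 \<noteq> h2" using h1 h2 by auto
      moreover have "card {h1, h2} \<le> 1" if "{h1, h2} \<subseteq> A"
        using card_mono[OF fin(2) that] A'(2) by simp
      moreover have "card {h1, h2} \<le> 1" if "{h1, h2} \<subseteq> solid_at G sv - A"
        using card_mono[OF _ that] fin(1) A'(3) by simp
      ultimately have "(h1 \<in> A) \<noteq> (h2 \<in> A)" using h1 h2 by auto
      then have "{att ?G' h1, att ?G' h2} = {sv, sw}" using at h1 h2 by auto
      then show ?thesis using h1 h2 by blast
    next
      case False
      \<comment> \<open>The old path ends at \<open>sv\<close>. The end of \<open>e\<close> that did
        not receive \<open>h1\<close> becomes its new last vertex.\<close>
      have "\<exists>v2. {att ?G' h1, v2} = {sv, sw}" using at[OF h1(1)] by (cases "h1 \<in> A") auto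
      then show ?thesis using h1 False by blast
    qed
  next
    case False
    show ?thesis
    proof (cases "i < length es")
      case True
      then obtain h2 where h2: "h2 \<in> solid_at G sv" "fst h2 = es ! i"
        "joins ?G' (es ! i) (att ?G' h2) (vs ! Suc i)" using nx by blast
      have "\<exists>v1. {v1, att ?G' h2} = {sv, sw}" using at[OF h2(1)] by (cases "h2 \<in> A") auto
      then show ?thesis using h2 False by blast
    qed (use False in blast)
  qed
  then obtain v1 v2 where v12: "{v1, v2} = {sv, sw}"
    and j1: "0 < i \<Longrightarrow> joins ?G' (es ! (i - 1)) (vs ! (i - 1)) v1"
    and j2: "i < length es \<Longrightarrow> joins ?G' (es ! i) v2 (vs ! Suc i)" by blast
  define vs' where "vs' = take i vs @ [v1, v2] @ drop (Suc i) vs"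
  define es' where "es' = take i es @ [e] @ drop i es"
  have ile: "i \<le> length es" using i path(2) by simp
  have len: "length vs' = Suc (length es')" "length es' = Suc (length es)"
    using i path(2) by (auto simp: vs'_def es'_def)
  have nv: "vs' ! j = (if j < i then vs ! j else if j = i then v1 else if j = Suc i then v2 else vs ! (j - 1))"
    if "j < length vs'" for j
  proof -
    have "drop (Suc i) vs ! (j - 2 - i) = vs ! (j - 1)" if "Suc i < j" "j < length vs'"
    proof -
      have "Suc i + (j - 2 - i) = j - 1" using that(1) by simp
      then show ?thesis using that len path(2) by (metis nth_drop Suc_leI i(1))
    qed
    then show ?thesis using that i by (auto simp: vs'_def nth_append nth_Cons' min_def diff_diff_left)
  qed
  have ne: "es' ! j = (if j < i then es ! j else if j = i then e else es ! (j - 1))"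
    if "j < length es'" for j
    using that ile len by (auto simp: es'_def nth_append nth_Cons' min_def)
  have vsdec: "vs = take i vs @ sv # drop (Suc i) vs" using i by (metis id_take_nth_drop)
  have setvs: "set vs = set (take i vs) \<union> {sv} \<union> set (drop (Suc i) vs)"
    by (subst vsdec) auto
  have setvs': "set vs' = insert sw (set vs)"
    using v12 unfolding setvs by (auto simp: vs'_def)
  have setes': "set es' = insert e (set es)"
  proof -
    have "set (take i es) \<union> set (drop i es) = set es" by (metis append_take_drop_id set_append)
    then show ?thesis by (auto simp: es'_def)
  qed
  have e12: "joins ?G' e v1 v2"
  proof -
    have "(v1 = sv \<and> v2 = sw) \<or> (v1 = sw \<and> v2 = sv)" using v12 by (auto simp: doubleton_eq_iff)
    then show ?thesis unfolding joins_def by (auto intro: exI[of _ b] exI[of _ "\<not> b"])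
  qed
  have "distinct (take i vs @ sv # drop (Suc i) vs)" using path(1) vsdec by metis
  moreover have "sw \<notin> set vs" using path(3) D(6) by auto
  ultimately have dist: "distinct vs'" using v12 D(7) unfolding vs'_def setvs
    by (auto simp: doubleton_eq_iff)
  have nthne: "vs ! j \<noteq> sv" if "j < length vs" "j \<noteq> i" for j
    using nth_eq_iff_index_eq[OF path(1) that(1) i(1)] that i by auto
  have edge: "joins ?G' (es' ! j) (vs' ! j) (vs' ! Suc j)" if j: "j < length es'" for j
  proof -
    have keepj: "joins ?G' (es ! m) (vs ! m) (vs ! Suc m)"
      if "m < length es" "m \<noteq> i" "Suc m \<noteq> i" for m
      using that path(2,4) nthne[of m] nthne[of "Suc m"] path(5)
      by (intro keep) auto
    have n: "es' ! j = (if j < i then es ! j else if j = i then e else es ! (j - 1))"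
      "vs' ! j = (if j < i then vs ! j else if j = i then v1 else if j = Suc i then v2 else vs ! (j - 1))"
      "vs' ! Suc j = (if Suc j < i then vs ! Suc j else if Suc j = i then v1 else if j = i then v2 else vs ! j)"
      using ne[OF j] nv[of j] nv[of "Suc j"] j len by auto
    consider "Suc j < i" | "Suc j = i" | "j = i" | "j = Suc i" | "Suc i < j" by linarith
    then show ?thesis
    proof cases
      case 1
      then show ?thesis unfolding n using keepj[of j] ile by simp
    next
      case 2
      then show ?thesis unfolding n using j1 by auto
    next
      case 3
      then show ?thesis unfolding n using e12 by simp
    next
      case 4
      then show ?thesis unfolding n using j2 j len by simp
    next
      case 5
      then obtain m where "j = Suc m" "i < m" by (metis Suc_lessE Suc_less_SucD)
      then show ?thesis unfolding n using keepj[of m] j len by simp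
    qed
  qed
  have path': "solid_path ?G' vs' es'"
    unfolding solid_path_def using dist len(1) setvs' setes' path(3,4) edge D(4) by auto
  have other: "solid_path ?G' us fs" if q: "(us, fs) \<in> Ps" "(us, fs) \<noteq> (vs, es)" for us fs
  proof -
    have p: "distinct us" "length us = Suc (length fs)" "set us \<subseteq> ext G" "set fs \<subseteq> solid G"
      "\<And>j. j < length fs \<Longrightarrow> joins G (fs ! j) (us ! j) (us ! Suc j)"
      using Ps(1)[OF q(1)] by (auto simp: solid_path_def)
    have svn: "sv \<notin> set us" using Ps(2)[OF q(1) p0(1) q(2)] p0(2) by auto
    have "joins ?G' (fs ! j) (us ! j) (us ! Suc j)" if "j < length fs" for j
    proof (rule keep)
      show "fs ! j \<in> solid G" using that p(4) by (meson nth_mem subsetD)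
      show "us ! j \<noteq> sv" "us ! Suc j \<noteq> sv"
        using svn that p(2) by (metis Suc_less_eq less_SucI nth_mem)+
    qed (use that p(5) in blast)
    then show ?thesis using p by (auto simp: solid_path_def)
  qed
  define Qs where "Qs = insert (vs', es') (Ps - {(vs, es)})"
  have Q1: "\<forall>(vs, es) \<in> Qs. solid_path ?G' vs es" using path' other by (auto simp: Qs_def)
  have Q2: "set (fst p) \<inter> set (fst q) = {}" if "p \<in> Qs" "q \<in> Qs" "p \<noteq> q" for p q
  proof -
    have *: "set vs' \<inter> set (fst r) = {}" if "r \<in> Ps - {(vs, es)}" for r
    proof -
      have "set vs \<inter> set (fst r) = {}" using Ps(2)[OF p0(1), of r] that by auto
      moreover have "sw \<notin> set (fst r)" using Ps(3) that D(6) by auto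
      ultimately show ?thesis using setvs' by auto
    qed
    show ?thesis using that *[of p] *[of q] Ps(2)[of p q] by (auto simp: Qs_def)
  qed
  have Q3: "(\<Union>p \<in> Qs. set (fst p)) = ext ?G'"
  proof -
    have "(\<Union>p \<in> Qs. set (fst p)) = insert sw (set vs \<union> (\<Union>p \<in> Ps - {(vs, es)}. set (fst p)))"
      by (auto simp: Qs_def setvs')
    also have "set vs \<union> (\<Union>p \<in> Ps - {(vs, es)}. set (fst p)) = (\<Union>p \<in> Ps. set (fst p))"
      using p0(1) by force
    finally show ?thesis using Ps(3) D(4) by auto
  qed
  have Q4: "(\<Union>p \<in> Qs. set (snd p)) = solid ?G'"
  proof -
    have "(\<Union>p \<in> Qs. set (snd p)) = insert e (set es \<union> (\<Union>p \<in> Ps - {(vs, es)}. set (snd p)))"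
      by (auto simp: Qs_def setes')
    also have "set es \<union> (\<Union>p \<in> Ps - {(vs, es)}. set (snd p)) = (\<Union>p \<in> Ps. set (snd p))"
      using p0(1) by force
    finally show ?thesis using Ps(4) by auto
  qed
  show ?thesis unfolding broken_lines_def using Q2 by (intro exI[of _ Qs] conjI Q1 Q3 Q4) blast
qed

lemma bcr_split:
  assumes A: "A \<in> balanced (solid_at G sv)" and x: "x \<in> dashed_at G sw - {(e, \<not> b)}"
  shows "bcr_graph (resplit True G e b (insert x A))"
    "internal (resplit True G e b (insert x A)) = internal G - {sw}"
proof -
  note D = stu_edgeD
  let ?G' = "resplit True G e b (insert x A)"
  have A': "A \<subseteq> solid_at G sv" "card A \<le> 1" "card (solid_at G sv - A) \<le> 1"
    using A by (auto simp: balanced_def)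
  have "finite (solid_at G sv)" using G by simp
  then have fin: "finite (solid_at G sv)" "finite A" using finite_subset[OF A'(1)] by blast+
  note at = split_at[OF A'(1) x]
  show int: "internal ?G' = internal G - {sw}" using D(4) by (auto simp: internal_def)
  have "wf_graph ?G'" using bcrD(1)[OF G] D by (auto simp: wf_graph_def att_resplit)
  moreover have "connected_graph ?G'" using connected_resplit[OF bcrD(7)[OF G] D(2)] .
  moreover have "card (dashed_at ?G' v) = 3 \<and> solid_at ?G' v = {}" if "v \<in> internal ?G'" for v
  proof -
    have "v \<in> internal G" "v \<noteq> sv" "v \<noteq> sw" using that int D(4) by (auto simp: internal_def)
    then show ?thesis using resplit_at_other[of v G e b] bcrD(9,10)[OF G] by metis
  qed
  moreover have "card (dashed_at ?G' v) = 1 \<and> card (solid_at ?G' v) \<le> 2" if v: "v \<in> ext ?G'" for v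
  proof -
    consider "v = sv" | "v = sw" | "v \<in> ext G" "v \<noteq> sv" "v \<noteq> sw" using v by auto
    then show ?thesis
    proof cases
      case 1
      then show ?thesis using at A'(2) fin by (auto simp: card_insert_if)
    next
      case 2
      have "dashed_at G sw - {(e, \<not> b), x} = (dashed_at G sw - {(e, \<not> b)}) - {x}" by auto
      then have "card (dashed_at G sw - {(e, \<not> b), x}) = 1" using D(13) x by simp
      then show ?thesis using at A'(3) fin 2 by (auto simp: card_insert_if)
    next
      case 3
      then show ?thesis using resplit_at_other[of v G e b] bcrD(11,12)[OF G] by metis
    qed
  qed
  moreover have "ext ?G' \<noteq> {}" by simp
  ultimately show "bcr_graph ?G'" using broken_lines_split[OF A x]
    unfolding bcr_graph_def by blast
qed

end

text \<open>A re-expansion between internal vertices leaves all solid edges in place, so only the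
  dashed half-edges at the two ends have to be counted: four of them are shared out two and
  two.\<close>

lemma bcr_move:
  assumes G: "bcr_graph G" and e: "e \<in> dashed G" "att G (e, b) \<noteq> att G (e, \<not> b)"
    "att G (e, b) \<in> internal G" "att G (e, \<not> b) \<in> internal G"
    and P: "P \<subseteq> dashed_at G (att G (e, b)) \<union> dashed_at G (att G (e, \<not> b)) - {(e, b), (e, \<not> b)}" "card P = 2"
  shows "bcr_graph (resplit False G e b P)"
    "dashed_at (resplit False G e b P) (att G (e, b)) = insert (e, b) P"
    "dashed_at (resplit False G e b P) (att G (e, \<not> b)) = insert (e, \<not> b)
       (dashed_at G (att G (e, b)) \<union> dashed_at G (att G (e, \<not> b)) - {(e, b), (e, \<not> b)} - P)"
    "card (dashed_at G (att G (e, b)) \<union> dashed_at G (att G (e, \<not> b)) - {(e, b), (e, \<not> b)} - P) = 2"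
proof -
  let ?G' = "resplit False G e b P"
  let ?v = "att G (e, b)" and ?w = "att G (e, \<not> b)"
  let ?M = "dashed_at G ?v \<union> dashed_at G ?w - {(e, b), (e, \<not> b)}"
  have eb: "(e, b) \<in> dashed_at G ?v" "(e, \<not> b) \<in> dashed_at G ?w" using e by (auto simp: dashed_at_def)
  have disj: "dashed_at G ?v \<inter> dashed_at G ?w = {}" using e(2) by (auto simp: dashed_at_def)
  have "card ?M = 4"
  proof -
    have "?M = (dashed_at G ?v - {(e, b)}) \<union> (dashed_at G ?w - {(e, \<not> b)})" using disj eb by auto
    moreover have "card (dashed_at G ?v - {(e, b)}) = 2" "card (dashed_at G ?w - {(e, \<not> b)}) = 2"
      using bcrD(9)[OF G] e eb by auto
    ultimately show ?thesis using disj G by (simp add: card_Un_disjoint Diff_Int_distrib2 Int_Diff disjoint_iff)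
  qed
  moreover have fP: "finite P" using P(2) card.infinite by force
  ultimately show cM: "card (?M - P) = 2" using P by (simp add: card_Diff_subset)
  have es: "e \<notin> solid G" using e(1) by (simp add: dashed_def)
  show dv: "dashed_at ?G' ?v = insert (e, b) P" and dw: "dashed_at ?G' ?w = insert (e, \<not> b) (?M - P)"
    unfolding resplit_at[OF e(2,1) es] using P(1) by auto
  have sol: "att ?G' (s, c) = att G (s, c)" if "s \<in> solid G" for s c
    using solid_att_ext[OF G that, of c] e(3,4) by (auto simp: att_resplit internal_def)
  have sat: "solid_at ?G' z = solid_at G z" for z
    using sol by (auto simp: solid_at_def)
  have "wf_graph ?G'" using bcrD(1)[OF G] e by (auto simp: wf_graph_def att_resplit internal_def)
  moreover have "connected_graph ?G'"
    using connected_resplit[OF bcrD(7)[OF G]] e(1) by (auto simp: dashed_def)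
  moreover have "card (dashed_at ?G' z) = 3" if "z \<in> internal G" for z
  proof -
    consider "z = ?v" | "z = ?w" | "z \<noteq> ?v" "z \<noteq> ?w" by auto
    then show ?thesis
    proof cases
      case 1
      have "(e, b) \<notin> P" using P(1) by auto
      then show ?thesis using dv 1 P(2) fP by simp
    next
      case 2
      have "finite (?M - P)" using G by simp
      moreover have "(e, \<not> b) \<notin> ?M - P" by simp
      ultimately have "card (insert (e, \<not> b) (?M - P)) = Suc (card (?M - P))"
        by (rule card_insert_disjoint)
      then show ?thesis unfolding 2 dw cM by simp
    next
      case 3
      then show ?thesis using resplit_at_other[of z G e b] bcrD(9)[OF G that] by simp
    qed
  qed
  moreover have "card (dashed_at ?G' z) = 1" if "z \<in> ext G" for z
  proof -
    have "z \<noteq> ?v" "z \<noteq> ?w" using that e(3,4) by (auto simp: internal_def)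
    then show ?thesis using resplit_at_other(1)[of z G e b] bcrD(11)[OF G that] by simp
  qed
  moreover have "broken_lines ?G'"
  proof -
    have "joins ?G' s y z = joins G s y z" if "s \<in> solid G" for s y z
      using sol[OF that] by (simp add: joins_def)
    then have "solid_path ?G' vs es = solid_path G vs es" for vs es
      by (auto simp: solid_path_def) (meson nth_mem subsetD)+
    then have "solid_path ?G' = solid_path G" by blast
    then show ?thesis using bcrD(13)[OF G] unfolding broken_lines_def by simp
  qed
  moreover have ie: "internal ?G' = internal G" "ext ?G' = ext G" by simp_all
  moreover have "\<forall>z \<in> internal G. solid_at ?G' z = {}" "\<forall>z \<in> ext G. card (solid_at ?G' z) \<le> 2"
    "ext G \<noteq> {}" using bcrD(8,10,12)[OF G] sat by simp_all
  ultimately show "bcr_graph ?G'" unfolding bcr_graph_def ie by blast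
qed

text \<open>As \<open>G\<close> is connected, some edge leads from \<open>X\<close> to its complement.\<close>

lemma exists_stu_edge:
  assumes G: "bcr_graph G" and X: "X \<noteq> {}" "X \<subseteq> internal G"
    and cl: "\<And>e b. e \<in> dashed G \<Longrightarrow> att G (e, b) \<in> X \<Longrightarrow> att G (e, \<not> b) \<in> X \<union> ext G"
  obtains e b where "stu_edge G e b" "att G (e, \<not> b) \<in> X"
proof -
  define R where "R = {(x, y). \<exists>e \<in> edges G. joins G e x y}"
  obtain x z where xz: "x \<in> X" "z \<in> ext G" using X bcrD(8)[OF G] by blast
  have "(x, z) \<in> R\<^sup>*" using bcrD(4,7)[OF G] xz X by (auto simp: R_def connected_graph_def internal_def)
  moreover have "y \<in> X \<or> (\<exists>p q. p \<in> X \<and> q \<notin> X \<and> (p, q) \<in> R)" if "(x, y) \<in> R\<^sup>*" for y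
    using that by (induction rule: rtrancl_induct) (use xz in auto)
  moreover have "z \<notin> X" using xz X by (auto simp: internal_def)
  ultimately obtain p q where pq: "p \<in> X" "q \<notin> X" "(p, q) \<in> R" by blast
  then obtain e c where e: "e \<in> edges G" "att G (e, c) = p" "att G (e, \<not> c) = q"
    by (auto simp: R_def joins_def)
  have "(e, c) \<notin> solid_at G p" using bcrD(10)[OF G] pq(1) X by blast
  then have ed: "e \<in> dashed G" using e by (simp add: dashed_def solid_at_def)
  have "q \<in> ext G" using cl[OF ed, of c] e pq by simp
  moreover have "p \<in> internal G" using pq(1) X(2) by blast
  ultimately have "stu_edge G e (\<not> c)" using e ed by (simp add: stu_edge_def)
  moreover have "att G (e, \<not> \<not> c) \<in> X" using e(2) pq(1) by simp
  ultimately show ?thesis by (rule that)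
qed

section \<open>Weights of graphs with few internal vertices\<close>

lemma is_coloring_resplit [simp]: "is_coloring k (resplit s G e b P) c = is_coloring k G c"
  by (rule is_coloring_cong) simp_all

lemma change_sign_resplit [simp]:
  "change_sign f (resplit s G e b P) c c' = change_sign f G c c'"
  by (rule change_sign_cong) simp_all

section \<open>Transport along isomorphisms\<close>

fun hmap :: "graph_map \<Rightarrow> nat \<times> bool \<Rightarrow> nat \<times> bool" where
  "hmap (fV, fE, fl) (e, b) = (fE e, b \<noteq> fl e)"

lemma image_filter_eq: "{y \<in> f ` A. P y} = f ` {x \<in> A. P (f x)}"
  by auto

lemma inj_on_hmap:
  assumes "inj_on fE E"
  shows "inj_on (hmap (fV, fE, fl)) (E \<times> UNIV)"
  using assms by (auto simp: inj_on_def)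

lemma hmap_image:
  assumes "fE ` E = E'"
  shows "hmap (fV, fE, fl) ` (E \<times> UNIV) = E' \<times> UNIV"
proof (intro equalityI subsetI)
  fix h assume "h \<in> E' \<times> (UNIV :: bool set)"
  then obtain e b where "h = (fE e, b)" "e \<in> E" using assms by (cases h) auto
  then have "h = hmap (fV, fE, fl) (e, b \<noteq> fl e)" by auto
  then show "h \<in> hmap (fV, fE, fl) ` (E \<times> UNIV)" using \<open>e \<in> E\<close> by blast
qed (use assms in auto)

context
  fixes fV fE fl G G'
  assumes G: "bcr_graph G" and G': "bcr_graph G'" and iso: "is_iso (fV, fE, fl) G G'"
begin

abbreviation (input) "hm \<equiv> hmap (fV, fE, fl)"

lemma iso_inj: "inj_on fV (verts G)" "inj_on fE (edges G)"
  "fV ` verts G = verts G'" "fE ` edges G = edges G'"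
  using iso unfolding is_iso.simps bij_betw_def by blast+

lemma iso_mem:
  "v \<in> verts G \<Longrightarrow> fV v \<in> ext G' \<longleftrightarrow> v \<in> ext G"
  "e \<in> edges G \<Longrightarrow> fE e \<in> solid G' \<longleftrightarrow> e \<in> solid G"
  using iso unfolding is_iso.simps by blast+

lemma iso_att: "fst h \<in> edges G \<Longrightarrow> att G' (hm h) = fV (att G h)"
proof -
  assume h: "fst h \<in> edges G"
  have "\<forall>e \<in> edges G. \<forall>b. att G' (fE e, b \<noteq> fl e) = fV (att G (e, b))"
    using iso unfolding is_iso.simps by blast
  then have "att G' (fE (fst h), snd h \<noteq> fl (fst h)) = fV (att G (fst h, snd h))" using h by blast
  moreover have "hm h = (fE (fst h), snd h \<noteq> fl (fst h))" by (cases h) simp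
  ultimately show ?thesis by simp
qed

lemma iso_solid_dashed: "fE ` solid G = solid G'" "fE ` dashed G = dashed G'"
proof -
  note s = iso_mem(2)
  show 1: "fE ` solid G = solid G'"
  proof
    show "fE ` solid G \<subseteq> solid G'" using s bcrD(5)[OF G] by blast
    show "solid G' \<subseteq> fE ` solid G"
    proof
      fix e' assume e': "e' \<in> solid G'"
      then have "e' \<in> fE ` edges G" using bcrD(5)[OF G'] iso_inj(4) by blast
      then obtain e where "e \<in> edges G" "e' = fE e" by blast
      then show "e' \<in> fE ` solid G" using s[of e] e' by blast
    qed
  qed
  show "fE ` dashed G = dashed G'" unfolding dashed_def
    using inj_on_image_set_diff[OF iso_inj(2) Diff_subset bcrD(5)[OF G]] 1 iso_inj(4) by simp
qed

lemma iso_at: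
  assumes "v \<in> verts G"
  shows "dashed_at G' (fV v) = hm ` dashed_at G v" "solid_at G' (fV v) = hm ` solid_at G v"
proof -
  have gen: "{h \<in> F' \<times> UNIV. att G' h = fV v} = hm ` {h \<in> F \<times> UNIV. att G h = v}"
    if F: "F \<subseteq> edges G" "fE ` F = F'" for F F'
  proof -
    have "{h \<in> F' \<times> UNIV. att G' h = fV v} = hm ` {h \<in> F \<times> UNIV. att G' (hm h) = fV v}"
      unfolding hmap_image[OF F(2), of fV fl, symmetric] image_filter_eq ..
    moreover have *: "att G' (hm h) = fV v \<longleftrightarrow> att G h = v" if "h \<in> F \<times> UNIV" for h
    proof -
      have "fst h \<in> edges G" using that F by auto
      then have "att G h \<in> verts G" using bcrD(6)[OF G] by (cases h) auto
      then show ?thesis using iso_att[OF \<open>fst h \<in> edges G\<close>] iso_inj(1) assms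
        by (auto simp: inj_on_def)
    qed
    have "{h \<in> F \<times> UNIV. att G' (hm h) = fV v} = {h \<in> F \<times> UNIV. att G h = v}"
      using * by blast
    ultimately show ?thesis by simp
  qed
  show "dashed_at G' (fV v) = hm ` dashed_at G v" unfolding dashed_at_def
    by (rule gen) (use iso_solid_dashed in \<open>auto simp: dashed_def\<close>)
  show "solid_at G' (fV v) = hm ` solid_at G v" unfolding solid_at_def
    by (rule gen) (use iso_solid_dashed bcrD(5)[OF G] in auto)
qed

lemma iso_ext_internal:
  assumes "v \<in> verts G"
  shows "fV v \<in> ext G' \<longleftrightarrow> v \<in> ext G" "fV v \<in> internal G' \<longleftrightarrow> v \<in> internal G"
  using iso_mem(1)[OF assms] iso_inj(3) assms by (auto simp: internal_def)

lemma iso_card_internal: "card (internal G') = card (internal G)"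
proof -
  have "fV ` internal G = internal G'"
    using iso_ext_internal iso_inj(3) by (force simp: internal_def)
  then show ?thesis using card_image[of fV "internal G"] iso_inj(1)
    by (metis Diff_subset inj_on_subset internal_def)
qed

lemma iso_stu_edge:
  assumes "stu_edge G e b"
  shows "stu_edge G' (fE e) (b \<noteq> fl e)" "att G' (fE e, b \<noteq> fl e) = fV (att G (e, b))"
    "att G' (fE e, \<not> (b \<noteq> fl e)) = fV (att G (e, \<not> b))"
proof -
  have e: "e \<in> dashed G" "e \<in> edges G" "att G (e, b) \<in> ext G" "att G (e, \<not> b) \<in> internal G"
    using assms by (auto simp: stu_edge_def dashed_def)
  show a: "att G' (fE e, b \<noteq> fl e) = fV (att G (e, b))"
    "att G' (fE e, \<not> (b \<noteq> fl e)) = fV (att G (e, \<not> b))"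
    using iso_att[of "(e, b)"] iso_att[of "(e, \<not> b)"] e(2) by auto
  have "fE e \<in> dashed G'" using iso_solid_dashed e(1) by blast
  then show "stu_edge G' (fE e) (b \<noteq> fl e)" unfolding stu_edge_def a
    using iso_ext_internal bcrD(6)[OF G e(2)] e by blast
qed

text \<open>The isomorphism is given by the same maps before and after, so its sign does not change
  under re-expansion. \<open>P\<close> has to consist of half-edges of \<open>G\<close>, since
  \<open>fE\<close> is injective only there.\<close>

lemma iso_resplit:
  assumes e: "e \<in> edges G" and P: "P \<subseteq> edges G \<times> UNIV"
  shows "is_iso (fV, fE, fl) (resplit s G e b P) (resplit s G' (fE e) (b \<noteq> fl e) (hm ` P))"
proof -
  have att: "att G' (hm h) = fV (att G h)" if "h \<in> edges G \<times> UNIV" for h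
    using iso_att[of h] that by auto
  have ends: "att G' (fE e, b \<noteq> fl e) = fV (att G (e, b))"
    "att G' (fE e, \<not> (b \<noteq> fl e)) = fV (att G (e, \<not> b))"
    using iso_att[of "(e, b)"] iso_att[of "(e, \<not> b)"] e by auto
  have V: "att G (e, c) \<in> verts G" for c using bcrD(6)[OF G e] .
  have main: "att (resplit s G' (fE e) (b \<noteq> fl e) (hm ` P)) (hm h) = fV (att (resplit s G e b P) h)"
    if h: "h \<in> edges G \<times> UNIV" for h
  proof -
    have 1: "fst (hm h) = fE e \<longleftrightarrow> fst h = e" using h e iso_inj(2) by (cases h) (auto simp: inj_on_def)
    have 2: "hm h \<in> hm ` P \<longleftrightarrow> h \<in> P"
      using inj_on_hmap[OF iso_inj(2)] P h by (metis inj_on_image_mem_iff)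
    have "att G h \<in> verts G" using bcrD(6)[OF G] h by (cases h) auto
    then have 3: "fV (att G h) = fV (att G (e, c)) \<longleftrightarrow> att G h = att G (e, c)" for c
      using V iso_inj(1) by (auto simp: inj_on_def)
    show ?thesis unfolding att_resplit ends att[OF h] 1 2 using 3 by simp
  qed
  have "\<forall>v \<in> verts G. fV v \<in> ext (resplit s G' (fE e) (b \<noteq> fl e) (hm ` P)) \<longleftrightarrow>
      v \<in> ext (resplit s G e b P)"
  proof
    fix v assume v: "v \<in> verts G"
    then have "fV v = fV (att G (e, c)) \<longleftrightarrow> v = att G (e, c)" for c
      using V iso_inj(1) by (auto simp: inj_on_def)
    then show "fV v \<in> ext (resplit s G' (fE e) (b \<noteq> fl e) (hm ` P)) \<longleftrightarrow>
      v \<in> ext (resplit s G e b P)" using iso_ext_internal(1)[OF v] unfolding resplit_simps ends by auto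
  qed
  moreover have "\<forall>x \<in> edges G. fE x \<in> solid (resplit s G' (fE e) (b \<noteq> fl e) (hm ` P)) \<longleftrightarrow>
      x \<in> solid (resplit s G e b P)"
    using iso_mem(2) e iso_inj(2) by (auto simp: inj_on_def)
  moreover have "\<forall>x \<in> edges G. \<forall>c. att (resplit s G' (fE e) (b \<noteq> fl e) (hm ` P)) (fE x, c \<noteq> fl x) =
      fV (att (resplit s G e b P) (x, c))"
    using main by (metis SigmaI UNIV_I hmap.simps)
  moreover have "bij_betw fV (verts G) (verts G')" "bij_betw fE (edges G) (edges G')"
    using iso_inj by (simp_all add: bij_betw_def)
  ultimately show ?thesis unfolding is_iso.simps resplit_simps(1,2) by blast
qed

end

text \<open>In a pair \<open>(A, x)\<close>, the set \<open>A\<close> contains the solid half-edges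
  and \<open>x\<close> is the dashed half-edge that the external end of \<open>e\<close> receives.
  The formerly internal end receives the others.\<close>

definition stu_pairs :: "graph \<Rightarrow> nat \<Rightarrow> bool \<Rightarrow> ((nat \<times> bool) set \<times> nat \<times> bool) set" where
  "stu_pairs G e b = balanced (solid_at G (att G (e, b))) \<times>
     (dashed_at G (att G (e, \<not> b)) - {(e, \<not> b)})"

text \<open>Summing over all distributions of the half-edges counts every term of the STU relation at
  \<open>e\<close> twice, since the two ends of the new solid edge can be exchanged. The relation thus reads
  \<open>2 f(G) + stu_sum f G e b = 0\<close>, with the same coloring for all terms, and with no distinction
  between the types (I) and (II).\<close>

definition stu_sum :: "(graph \<Rightarrow> rat) \<Rightarrow> graph \<Rightarrow> nat \<Rightarrow> bool \<Rightarrow> rat" where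
  "stu_sum f G e b = (\<Sum>p\<in>stu_pairs G e b. f (resplit True G e b (insert (snd p) (fst p))))"

lemma balanced_image:
  assumes "inj_on h S"
  shows "balanced (h ` S) = (`) h ` balanced S"
proof -
  have c: "card (h ` A) = card A" "card (h ` S - h ` A) = card (S - A)" if "A \<subseteq> S" for A
    using that assms inj_on_image_set_diff[OF assms, of S A]
    by (metis card_image inj_on_subset, metis card_image Diff_subset inj_on_subset order_refl)
  show ?thesis
  proof (intro equalityI subsetI)
    fix B assume B: "B \<in> balanced (h ` S)"
    then obtain A where A: "A \<subseteq> S" "B = h ` A" unfolding balanced_def by (metis (no_types, lifting) mem_Collect_eq subset_image_iff)
    then have "A \<in> balanced S" using B c[OF A(1)] by (simp add: balanced_def)
    then show "B \<in> (`) h ` balanced S" using A by blast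
  next
    fix B assume "B \<in> (`) h ` balanced S"
    then obtain A where A: "A \<in> balanced S" "B = h ` A" by blast
    then have "A \<subseteq> S" by (simp add: balanced_def)
    then show "B \<in> balanced (h ` S)" using A c[OF \<open>A \<subseteq> S\<close>] by (auto simp: balanced_def)
  qed
qed

lemma stu_pairs_subset:
  assumes "bcr_graph G" "p \<in> stu_pairs G e b"
  shows "insert (snd p) (fst p) \<subseteq> edges G \<times> UNIV"
  using assms bcrD(5)[OF assms(1)]
  by (auto simp: stu_pairs_def balanced_def solid_at_def dashed_at_def dashed_def)

lemma stu_pairs_iso:
  assumes "bcr_graph G" "bcr_graph G'" "is_iso (fV, fE, fl) G G'" "stu_edge G e b"
  shows "stu_pairs G' (fE e) (b \<noteq> fl e) =
      map_prod ((`) (hmap (fV, fE, fl))) (hmap (fV, fE, fl)) ` stu_pairs G e b"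
    "inj_on (map_prod ((`) (hmap (fV, fE, fl))) (hmap (fV, fE, fl))) (stu_pairs G e b)"
proof -
  let ?hm = "hmap (fV, fE, fl)"
  note i = iso_stu_edge[OF assms] 
  have e: "e \<in> edges G" using assms(4) by (auto simp: stu_edge_def dashed_def)
  have inj: "inj_on ?hm (edges G \<times> UNIV)" using inj_on_hmap iso_inj(2)[OF assms(1-3)] by blast
  have sub: "solid_at G v \<subseteq> edges G \<times> UNIV" "dashed_at G v \<subseteq> edges G \<times> UNIV" for v
    using bcrD(5)[OF assms(1)] by (auto simp: solid_at_def dashed_at_def dashed_def)
  note at = iso_at[OF assms(1-3) bcrD(6)[OF assms(1) e]]
  have "dashed_at G' (fV (att G (e, \<not> b))) - {(fE e, \<not> (b \<noteq> fl e))} =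
      ?hm ` (dashed_at G (att G (e, \<not> b)) - {(e, \<not> b)})"
  proof -
    have "(fE e, \<not> (b \<noteq> fl e)) = ?hm (e, \<not> b)" by auto
    moreover have "?hm ` (dashed_at G (att G (e, \<not> b)) - {(e, \<not> b)}) =
        ?hm ` dashed_at G (att G (e, \<not> b)) - ?hm ` {(e, \<not> b)}"
      by (rule inj_on_image_set_diff[OF inj]) (use sub e in auto)
    ultimately show ?thesis unfolding at by simp
  qed
  moreover have "balanced (solid_at G' (fV (att G (e, b)))) =
      (`) ?hm ` balanced (solid_at G (att G (e, b)))"
    unfolding at by (rule balanced_image) (use inj sub in \<open>auto intro: inj_on_subset\<close>)
  ultimately show "stu_pairs G' (fE e) (b \<noteq> fl e) = map_prod ((`) ?hm) ?hm ` stu_pairs G e b"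
    unfolding stu_pairs_def i by (simp only: map_prod_surj_on[OF refl refl])
  show "inj_on (map_prod ((`) ?hm) ?hm) (stu_pairs G e b)"
  proof (rule inj_onI)
    fix p q assume pq: "p \<in> stu_pairs G e b" "q \<in> stu_pairs G e b"
      "map_prod ((`) ?hm) ?hm p = map_prod ((`) ?hm) ?hm q"
    have s: "insert (snd p) (fst p) \<subseteq> edges G \<times> UNIV" "insert (snd q) (fst q) \<subseteq> edges G \<times> UNIV"
      using stu_pairs_subset[OF assms(1)] pq(1,2) by auto
    have "?hm (snd p) = ?hm (snd q)" "?hm ` fst p = ?hm ` fst q" using pq(3)
      by (metis snd_map_prod, metis fst_map_prod)
    then have "snd p = snd q" "fst p = fst q"
      using s inj by (meson inj_onD insert_subset, meson inj_on_image_eq_iff insert_subset)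
    then show "p = q" by (simp add: prod_eq_iff)
  qed
qed

lemma stu_sum_iso:
  assumes iso: "bcr_graph G" "bcr_graph G'" "is_iso (fV, fE, fl) G G'" "stu_edge G e b"
    and f: "\<And>P. P \<in> (\<lambda>p. insert (snd p) (fst p)) ` stu_pairs G e b \<Longrightarrow>
      f (resplit True G e b P) =
      s * g (resplit True G' (fE e) (b \<noteq> fl e) (hmap (fV, fE, fl) ` P))"
  shows "stu_sum f G e b = s * stu_sum g G' (fE e) (b \<noteq> fl e)"
proof -
  let ?hm = "hmap (fV, fE, fl)"
  have eq: "stu_sum g G' (fE e) (b \<noteq> fl e) = (\<Sum>p\<in>stu_pairs G e b.
      g (resplit True G' (fE e) (b \<noteq> fl e) (?hm ` insert (snd p) (fst p))))"
    unfolding stu_sum_def stu_pairs_iso(1)[OF iso] sum.reindex[OF stu_pairs_iso(2)[OF iso]]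
    by simp
  show ?thesis unfolding eq sum_distrib_left unfolding stu_sum_def
    by (intro sum.cong refl f) blast
qed

lemma stu_pairs_bcr:
  assumes "bcr_graph G" "stu_edge G e b" "p \<in> stu_pairs G e b"
  shows "bcr_graph (resplit True G e b (insert (snd p) (fst p)))"
    "internal (resplit True G e b (insert (snd p) (fst p))) = internal G - {att G (e, \<not> b)}"
    "card (internal (resplit True G e b (insert (snd p) (fst p)))) = card (internal G) - 1"
proof -
  have p: "fst p \<in> balanced (solid_at G (att G (e, b)))"
    "snd p \<in> dashed_at G (att G (e, \<not> b)) - {(e, \<not> b)}"
    using assms(3) by (auto simp: stu_pairs_def)
  note b = bcr_split[OF assms(1,2) p]
  show "bcr_graph (resplit True G e b (insert (snd p) (fst p)))" by (rule b(1))
  show i: "internal (resplit True G e b (insert (snd p) (fst p))) = internal G - {att G (e, \<not> b)}"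
    by (rule b(2))
  show "card (internal (resplit True G e b (insert (snd p) (fst p)))) = card (internal G) - 1"
    unfolding i using assms(2) finite_at(3)[OF assms(1)] by (auto simp: stu_edge_def)
qed

text \<open>Here and in \<open>stu_inv\<close> the condition is cut off at \<open>n\<close> internal
  vertices, so that both can serve as induction hypothesis while the functional is still under
  construction.\<close>

definition orient_inv :: "orientation_case \<Rightarrow> nat \<Rightarrow> (colored_graph \<Rightarrow> rat) \<Rightarrow> bool" where
  "orient_inv k n W \<longleftrightarrow> (\<forall>f G c G' c'. bcr_graph G \<longrightarrow> bcr_graph G' \<longrightarrow> is_coloring k G c \<longrightarrow>
     is_coloring k G' c' \<longrightarrow> is_iso f G G' \<longrightarrow> card (internal G) \<le> n \<longrightarrow>
     W (G, c) = of_int (change_sign f G c c') * W (G', c'))"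

definition stu_inv :: "orientation_case \<Rightarrow> nat \<Rightarrow> (colored_graph \<Rightarrow> rat) \<Rightarrow> bool" where
  "stu_inv k n W \<longleftrightarrow> (\<forall>G c e b. bcr_graph G \<longrightarrow> is_coloring k G c \<longrightarrow> card (internal G) \<le> n \<longrightarrow>
     stu_edge G e b \<longrightarrow> 2 * W (G, c) = - stu_sum (\<lambda>H. W (H, c)) G e b)"

text \<open>Graphs that agree on their half-edges need not be equal, because \<open>att\<close> is
  arbitrary elsewhere. Complements of sets of half-edges, for instance, give equal graphs only in
  this weaker sense.\<close>

lemma iso_cong_right:
  assumes "is_iso f G H" "verts H = verts G'" "edges H = edges G'" "ext H = ext G'"
    "solid H = solid G'" "\<And>h. fst h \<in> edges G' \<Longrightarrow> att H h = att G' h"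
  shows "is_iso f G G'"
proof -
  obtain fV fE fl where f: "f = (fV, fE, fl)" by (metis prod_cases3)
  have i: "bij_betw fV (verts G) (verts G')" "bij_betw fE (edges G) (edges G')"
    "\<forall>v \<in> verts G. fV v \<in> ext G' \<longleftrightarrow> v \<in> ext G" "\<forall>e \<in> edges G. fE e \<in> solid G' \<longleftrightarrow> e \<in> solid G"
    and att: "\<forall>e \<in> edges G. \<forall>b. att H (fE e, b \<noteq> fl e) = fV (att G (e, b))"
    using assms(1) unfolding f is_iso.simps assms(2-5) by blast+
  have "att G' (fE e, b \<noteq> fl e) = fV (att G (e, b))" if e: "e \<in> edges G" for e b
  proof -
    have "fE e \<in> edges G'" using bij_betwE[OF i(2)] e by blast
    then have "att H (fE e, b \<noteq> fl e) = att G' (fE e, b \<noteq> fl e)" by (intro assms(6)) simp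
    then show ?thesis using att e by metis
  qed
  then show ?thesis unfolding f is_iso.simps using i by blast
qed

lemma iso_exchange_ends:
  assumes "e \<in> edges G" "att G (e, b) \<in> verts G" "att G (e, \<not> b) \<in> verts G"
    "s \<or> (att G (e, b) \<in> ext G \<longleftrightarrow> att G (e, \<not> b) \<in> ext G)"
  shows "is_iso (transpose (att G (e, b)) (att G (e, \<not> b)), id, \<lambda>x. x = e)
    (resplit s G e b P) (resplit s G e (\<not> b) P)"
proof -
  let ?v = "att G (e, b)" and ?w = "att G (e, \<not> b)"
  have "att (resplit s G e (\<not> b) P) (x, c \<noteq> (x = e)) = transpose ?v ?w (att (resplit s G e b P) (x, c))"
    for x c
  proof (cases "x = e")
    case True
    then show ?thesis by (cases c; cases b) auto
  next
    case False
    then show ?thesis by (auto simp: att_resplit transpose_def)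
  qed
  moreover have "bij_betw (transpose ?v ?w) (verts G) (verts G)"
    by (intro permutes_imp_bij permutes_swap_id assms(2,3))
  moreover have "\<forall>v \<in> verts G. transpose ?v ?w v \<in> ext (resplit s G e (\<not> b) P) \<longleftrightarrow>
      v \<in> ext (resplit s G e b P)"
  proof -
    have "ext (resplit s G e (\<not> b) P) = ext (resplit s G e b P)" by (simp add: insert_commute)
    moreover have "?v \<in> ext (resplit s G e b P) \<longleftrightarrow> ?w \<in> ext (resplit s G e b P)"
      using assms(4) by (cases s) simp_all
    then have "transpose ?v ?w x \<in> ext (resplit s G e b P) \<longleftrightarrow> x \<in> ext (resplit s G e b P)" for x
      unfolding transpose_def by presburger
    ultimately show ?thesis by blast
  qed
  ultimately show ?thesis unfolding is_iso.simps resplit_simps(1,2,4) by simp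
qed

text \<open>In the odd case the transposition of the two vertices and the reversal of
  \<open>e\<close> contribute -1 each. In the even case no edge changes its number.\<close>

lemma change_sign_exchange_ends:
  assumes "finite (verts G)" "finite (edges G)" "is_coloring k G c"
    "e \<in> edges G" "v \<in> verts G" "w \<in> verts G" "v \<noteq> w"
  shows "change_sign (transpose v w, id, \<lambda>x. x = e) G c c = 1"
proof (cases c)
  case (Odd_Col l h)
  then have l: "bij_betw l (verts G) {1..card (verts G)}" using assms(3) by (cases k) auto
  have "{x \<in> edges G. h x = (h x = (x = e))} = {e}" using assms(4) by auto
  then show ?thesis using sign_label_perm_transpose[OF assms(1) l assms(5-7)] by (simp add: Odd_Col)
qed simp

text \<open>Sending a set of half-edges to one end amounts to sending the complementary set to the
  other end; among the half-edges in question, the complement of \<open>insert x A\<close> is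
  \<open>insert y (S - A)\<close> with \<open>S\<close> the solid half-edges at the external
  end.\<close>

lemma att_split_complement:
  assumes G: "bcr_graph G" "stu_edge G e b" and A: "A \<subseteq> solid_at G (att G (e, b))"
    and xy: "dashed_at G (att G (e, \<not> b)) - {(e, \<not> b)} = {x, y}" "x \<noteq> y"
    and h: "fst h \<in> edges G"
  shows "att (resplit True G e (\<not> b) (insert x A)) h =
    att (resplit True G e b (insert y (solid_at G (att G (e, b)) - A))) h"
proof -
  let ?v = "att G (e, b)" and ?w = "att G (e, \<not> b)"
  let ?S = "solid_at G ?v"
  note D = stu_edgeD[OF G]
  show ?thesis
  proof (cases "fst h \<noteq> e \<and> (att G h = ?v \<or> att G h = ?w)")
    case True
    have "h \<in> dashed_at G ?v \<union> solid_at G ?v \<union> dashed_at G ?w \<union> solid_at G ?w"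
      using True h by (cases h) (auto simp: dashed_at_def solid_at_def dashed_def)
    then have hh: "h \<in> ?S \<or> h \<in> {x, y}"
      using D(10,11) xy True by auto
    have "x \<notin> ?S" "y \<notin> ?S" using xy(1) by (auto simp: dashed_at_def solid_at_def dashed_def)
    then have "h \<in> insert x A \<longleftrightarrow> h \<notin> insert y (?S - A)" using hh xy(2) A by auto
    then show ?thesis using True by (auto simp: att_resplit)
  next
    case False
    then show ?thesis by (auto simp: att_resplit)
  qed
qed

lemma balanced_empty [simp]: "balanced {} = {{}}"
  by (auto simp: balanced_def)

lemma balanced_mem:
  assumes "finite S" "card S \<le> 2" "s \<in> S"
  shows "balanced S = {{s}, S - {s}}"
proof (intro equalityI subsetI)
  fix A assume A: "A \<in> balanced S"
  then have fA: "A \<subseteq> S" "finite A" "finite (S - A)" "card A \<le> 1" "card (S - A) \<le> 1"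
    using assms(1) finite_subset by (auto simp: balanced_def)
  show "A \<in> {{s}, S - {s}}"
  proof (cases "s \<in> A")
    case True
    then have "A = {s}" using fA(4) card_le_Suc0_iff_eq[OF fA(2)] by auto
    then show ?thesis by simp
  next
    case False
    then have "s \<in> S - A" using assms by simp
    then have "S - A = {s}" using fA(3,5) card_le_Suc0_iff_eq[OF fA(3)] by auto
    then show ?thesis using fA(1) by auto
  qed
next
  fix A assume "A \<in> {{s}, S - {s}}"
  then show "A \<in> balanced S" using assms by (auto simp: balanced_def double_diff)
qed

section \<open>STU sums of a functional that is known up to \<open>n\<close> internal
  vertices\<close>

locale weight =
  fixes k :: orientation_case and n :: nat and W :: "colored_graph \<Rightarrow> rat"
  assumes orient: "orient_inv k n W" and stu: "stu_inv k n W"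
begin

lemma orientD:
  assumes "bcr_graph G" "bcr_graph G'" "is_coloring k G c" "is_coloring k G' c'" "is_iso f G G'"
    "card (internal G) \<le> n"
  shows "W (G, c) = of_int (change_sign f G c c') * W (G', c')"
  using orient assms unfolding orient_inv_def by blast

lemma stuD:
  assumes "bcr_graph G" "is_coloring k G c" "card (internal G) \<le> n" "stu_edge G e b"
  shows "2 * W (G, c) = - stu_sum (\<lambda>H. W (H, c)) G e b"
  using stu assms unfolding stu_inv_def by blast

lemma weight_cong:
  assumes "bcr_graph G" "bcr_graph G'" "is_coloring k G c" "card (internal G) \<le> n"
    "verts G = verts G'" "edges G = edges G'" "ext G = ext G'" "solid G = solid G'"
    "\<And>h. fst h \<in> edges G \<Longrightarrow> att G h = att G' h"
  shows "W (G, c) = W (G', c)"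
proof -
  have "is_iso id_map G G'" using assms(5-9) by (simp add: id_map_def)
  moreover have "is_coloring k G' c" using assms(3,5,6) is_coloring_cong by blast
  ultimately have "W (G, c) = of_int (change_sign id_map G c c) * W (G', c)"
    using assms(1-4) by (intro orientD)
  then show ?thesis using change_sign_refl[OF assms(3)] by simp
qed

text \<open>The terms of the sum have one internal vertex less than \<open>G\<close>. So a
  functional known up to \<open>n\<close> controls the sums up to \<open>Suc n\<close>, and the next
  stage of the extension, defined by such sums, respects orientations.\<close>

lemma stu_sum_transport:
  assumes G: "bcr_graph G" "bcr_graph G'" "is_coloring k G c" "is_coloring k G' c'"
    and iso: "is_iso (fV, fE, fl) G G'" and n: "card (internal G) \<le> Suc n" and e: "stu_edge G e b"
  shows "stu_sum (\<lambda>H. W (H, c)) G e b = of_int (change_sign (fV, fE, fl) G c c') *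
    stu_sum (\<lambda>H. W (H, c')) G' (fE e) (b \<noteq> fl e)"
proof (rule stu_sum_iso[OF G(1,2) iso e])
  fix P assume "P \<in> (\<lambda>p. insert (snd p) (fst p)) ` stu_pairs G e b"
  then obtain p where p: "p \<in> stu_pairs G e b" "P = insert (snd p) (fst p)" by blast
  let ?H = "resplit True G e b P" and ?H' = "resplit True G' (fE e) (b \<noteq> fl e) (hmap (fV, fE, fl) ` P)"
  have "map_prod ((`) (hmap (fV, fE, fl))) (hmap (fV, fE, fl)) p \<in> stu_pairs G' (fE e) (b \<noteq> fl e)"
    using stu_pairs_iso(1)[OF G(1,2) iso e] p by blast
  then have H': "bcr_graph ?H'"
    using stu_pairs_bcr(1)[OF G(2) iso_stu_edge(1)[OF G(1,2) iso e]] p by fastforce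
  have e': "e \<in> edges G" using e by (auto simp: stu_edge_def dashed_def)
  have iso': "is_iso (fV, fE, fl) ?H ?H'"
    using iso_resplit[OF G(1,2) iso e'] stu_pairs_subset[OF G(1) p(1)] p(2) by blast
  have H: "bcr_graph ?H" "card (internal ?H) \<le> n"
    using stu_pairs_bcr(1,3)[OF G(1) e p(1)] n unfolding p(2) by simp_all
  have "is_coloring k ?H c" "is_coloring k ?H' c'" using G(3,4) by simp_all
  then have "W (?H, c) = of_int (change_sign (fV, fE, fl) ?H c c') * W (?H', c')"
    by (rule orientD[OF H(1) H' _ _ iso' H(2)])
  then show "W (?H, c) = of_int (change_sign (fV, fE, fl) G c c') * W (?H', c')" by simp
qed

text \<open>Exchanging the two ends of \<open>e\<close> and reversing \<open>e\<close> identifies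
  the two terms, with sign 1. This is the reason why every term is met twice in
  \<open>stu_sum\<close>.\<close>

lemma stu_swap:
  assumes G: "bcr_graph G" "is_coloring k G c" "card (internal G) \<le> Suc n" "stu_edge G e b"
    and A: "A \<in> balanced (solid_at G (att G (e, b)))"
    and xy: "dashed_at G (att G (e, \<not> b)) - {(e, \<not> b)} = {x, y}" "x \<noteq> y"
  shows "W (resplit True G e b (insert x A), c) =
    W (resplit True G e b (insert y (solid_at G (att G (e, b)) - A)), c)"
proof -
  let ?v = "att G (e, b)" and ?w = "att G (e, \<not> b)"
  let ?S = "solid_at G ?v"
  note D = stu_edgeD[OF G(1,4)]
  have AS: "A \<subseteq> ?S" using A by (simp add: balanced_def)
  have A': "?S - A \<in> balanced ?S" using A by (auto simp: balanced_def double_diff)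
  have p: "(A, x) \<in> stu_pairs G e b" "(?S - A, y) \<in> stu_pairs G e b"
    using A A' xy by (auto simp: stu_pairs_def)
  let ?H = "resplit True G e b (insert x A)" and ?H' = "resplit True G e b (insert y (?S - A))"
  let ?H'' = "resplit True G e (\<not> b) (insert x A)"
  note H = stu_pairs_bcr[OF G(1,4) p(1), simplified fst_conv snd_conv]
  note H' = stu_pairs_bcr[OF G(1,4) p(2), simplified fst_conv snd_conv]
  have att: "att ?H'' h = att ?H' h" if "fst h \<in> edges G" for h
    by (rule att_split_complement[OF G(1,4) AS xy that])
  have col: "is_coloring k ?H c" "is_coloring k ?H' c" using G(2) by simp_all
  have n: "card (internal ?H) \<le> n" using H(3) G(3) by simp
  have "is_iso (transpose ?v ?w, id, \<lambda>x. x = e) ?H ?H''"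
    using D(2,8,9) by (intro iso_exchange_ends) simp_all
  then have iso: "is_iso (transpose ?v ?w, id, \<lambda>x. x = e) ?H ?H'"
    by (rule iso_cong_right) (simp_all add: insert_commute att)
  have "W (?H, c) = of_int (change_sign (transpose ?v ?w, id, \<lambda>x. x = e) ?H c c) * W (?H', c)"
    by (rule orientD[OF H(1) H'(1) col iso n])
  moreover have "change_sign (transpose ?v ?w, id, \<lambda>x. x = e) ?H c c = 1"
    using D bcrD(2,3)[OF G(1)] col(1) by (intro change_sign_exchange_ends) auto
  ultimately show ?thesis by simp
qed

text \<open>There are four pairs, and \<open>stu_swap\<close> matches them in twos. Either choice of
  \<open>A\<close>, combined with \<open>x\<close> and with \<open>y\<close>, meets both
  classes.\<close>

lemma stu_sum_solid:
  assumes G: "bcr_graph G" "is_coloring k G c" "card (internal G) \<le> Suc n" "stu_edge G e b"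
    and s: "s \<in> solid_at G (att G (e, b))"
    and xy: "dashed_at G (att G (e, \<not> b)) - {(e, \<not> b)} = {x, y}" "x \<noteq> y"
    and A: "A = {s} \<or> A = solid_at G (att G (e, b)) - {s}"
  shows "stu_sum (\<lambda>H. W (H, c)) G e b =
    2 * (W (resplit True G e b (insert x A), c) + W (resplit True G e b (insert y A), c))"
proof -
  let ?S = "solid_at G (att G (e, b))"
  have v: "att G (e, b) \<in> ext G" using G(4) by (auto simp: stu_edge_def)
  have bal: "balanced ?S = {{s}, ?S - {s}}"
    using balanced_mem finite_at(2)[OF G(1)] bcrD(12)[OF G(1) v] s by blast
  let ?f = "\<lambda>A x. W (resplit True G e b (insert x A), c)"
  have sw: "?f (?S - {s}) y = ?f {s} x" "?f (?S - {s}) x = ?f {s} y"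
    using stu_swap[OF G _ xy, of "{s}"] stu_swap[OF G _ xy(1)[unfolded insert_commute[of x]], of "{s}"]
      xy(2) bal by auto
  have "stu_sum (\<lambda>H. W (H, c)) G e b = (\<Sum>A\<in>{{s}, ?S - {s}}. \<Sum>x\<in>{x, y}. ?f A x)"
    unfolding stu_sum_def stu_pairs_def bal xy sum.cartesian_product
    by (simp add: case_prod_beta)
  also have "{s} \<noteq> ?S - {s}" by auto
  then have "(\<Sum>A\<in>{{s}, ?S - {s}}. \<Sum>x\<in>{x, y}. ?f A x) =
      ?f {s} x + ?f {s} y + (?f (?S - {s}) x + ?f (?S - {s}) y)" using xy(2) by simp
  finally show ?thesis using sw A by auto
qed

lemma stu_sum_no_solid:
  assumes G: "bcr_graph G" "is_coloring k G c" "card (internal G) \<le> Suc n" "stu_edge G e b"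
    and s: "solid_at G (att G (e, b)) = {}"
    and xy: "dashed_at G (att G (e, \<not> b)) - {(e, \<not> b)} = {x, y}" "x \<noteq> y"
  shows "stu_sum (\<lambda>H. W (H, c)) G e b = 2 * W (resplit True G e b {x}, c)"
proof -
  let ?f = "\<lambda>A x. W (resplit True G e b (insert x A), c)"
  have "stu_sum (\<lambda>H. W (H, c)) G e b = (\<Sum>A\<in>{{}}. \<Sum>x\<in>{x, y}. ?f A x)"
    unfolding stu_sum_def stu_pairs_def s balanced_empty xy sum.cartesian_product
    by (simp add: case_prod_beta)
  also have "\<dots> = ?f {} x + ?f {} y" using xy(2) by simp
  also have "?f {} y = ?f {} x" using stu_swap[OF G _ xy, of "{}"] s by simp
  finally show ?thesis by simp
qed

text \<open>Resolving the other edge in every term of one sum leads to a double sum in which the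
  order of the two resolutions is irrelevant by \<open>resplit_commute\<close>.\<close>

lemma stu_sum_commute:
  assumes G: "bcr_graph G" "is_coloring k G c" "card (internal G) \<le> Suc n"
    and e: "stu_edge G e b" and e': "stu_edge G e' b'"
    and ne: "att G (e, \<not> b) \<noteq> att G (e', \<not> b')"
  shows "stu_sum (\<lambda>H. W (H, c)) G e b = stu_sum (\<lambda>H. W (H, c)) G e' b'"
proof -
  let ?F = "\<lambda>H e b p. resplit True H e b (insert (snd p) (fst p))"
  have main: "2 * stu_sum (\<lambda>H. W (H, c)) G e b =
      - (\<Sum>p\<in>stu_pairs G e b. \<Sum>p'\<in>stu_pairs G e' b'. W (?F (?F G e b p) e' b' p', c))"
    if e: "stu_edge G e b" and e': "stu_edge G e' b'"
      and disj: "{att G (e, b), att G (e, \<not> b)} \<inter> {att G (e', b'), att G (e', \<not> b')} = {}"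
    for e b e' b'
  proof -
    have "2 * W (?F G e b p, c) = - (\<Sum>p'\<in>stu_pairs G e' b'. W (?F (?F G e b p) e' b' p', c))"
      if p: "p \<in> stu_pairs G e b" for p
    proof -
      let ?H = "?F G e b p"
      note H = stu_pairs_bcr[OF G(1) e p]
      have at: "att ?H (e', b') = att G (e', b')" "att ?H (e', \<not> b') = att G (e', \<not> b')"
        using disj by (auto simp: att_resplit)
      have "e' \<noteq> e" using disj by (cases b; cases b') auto
      then have "stu_edge ?H e' b'" using e' disj unfolding stu_edge_def at by auto
      moreover have "is_coloring k ?H c" using G(2) by simp
      moreover have "stu_pairs ?H e' b' = stu_pairs G e' b'"
        unfolding stu_pairs_def at using disj by (simp add: resplit_at_other)
      ultimately show ?thesis using stuD[of ?H c e' b'] H G(3) by (simp add: stu_sum_def)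
    qed
    then show ?thesis unfolding stu_sum_def sum_distrib_left by (simp add: sum_negf)
  qed
  \<comment> \<open>Different internal ends force different external ends, because an external
    vertex has a single dashed half-edge.\<close>
  have vv: "att G (e, b) \<noteq> att G (e', b')"
  proof
    assume "att G (e, b) = att G (e', b')"
    then have "{(e, b)} = {(e', b')}"
      using stu_edgeD(10)[OF G(1) e] stu_edgeD(10)[OF G(1) e'] by metis
    then show False using ne by simp
  qed
  have "att G (e, b) \<in> ext G" "att G (e', b') \<in> ext G" "att G (e, \<not> b) \<notin> ext G"
    "att G (e', \<not> b') \<notin> ext G"
    using e e' by (simp_all add: stu_edge_def internal_def)
  then have "att G (e, b) \<noteq> att G (e', \<not> b')" "att G (e, \<not> b) \<noteq> att G (e', b')" by metis+
  then have disj: "{att G (e, b), att G (e, \<not> b)} \<inter> {att G (e', b'), att G (e', \<not> b')} = {}"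
    using ne vv by simp
  have "2 * stu_sum (\<lambda>H. W (H, c)) G e b =
      - (\<Sum>p\<in>stu_pairs G e b. \<Sum>p'\<in>stu_pairs G e' b'. W (?F (?F G e b p) e' b' p', c))"
    by (rule main[OF e e' disj])
  also have "\<dots> = - (\<Sum>p'\<in>stu_pairs G e' b'. \<Sum>p\<in>stu_pairs G e b. W (?F (?F G e' b' p') e b p, c))"
    by (subst sum.swap) (simp only: resplit_commute[OF disj])
  also have "\<dots> = 2 * stu_sum (\<lambda>H. W (H, c)) G e' b'"
    by (rule main[OF e' e, symmetric]) (use disj in blast)
  finally show ?thesis by simp
qed

end

section \<open>The Jacobi identity\<close>

lemma bcr_cong:
  assumes G: "bcr_graph G"
    and eq: "verts G' = verts G" "edges G' = edges G" "ext G' = ext G" "solid G' = solid G"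
    and att: "\<And>h. fst h \<in> edges G \<Longrightarrow> att G' h = att G h"
  shows "bcr_graph G'"
proof -
  have sets: "internal G' = internal G" "dashed G' = dashed G"
    by (simp_all add: internal_def dashed_def eq)
  have at: "dashed_at G' v = dashed_at G v" "solid_at G' v = solid_at G v" for v
  proof -
    have *: "att G' h = att G h" if "h \<in> dashed G \<times> UNIV \<or> h \<in> solid G \<times> UNIV" for h
    proof (rule att)
      show "fst h \<in> edges G" using that bcrD(5)[OF G] by (auto simp: dashed_def)
    qed
    show "dashed_at G' v = dashed_at G v" "solid_at G' v = solid_at G v"
      unfolding dashed_at_def solid_at_def sets eq by (intro Collect_cong, use * in metis)+
  qed
  have j: "joins G' f = joins G f" if "f \<in> edges G" for f
    using att that by (simp add: joins_def fun_eq_iff)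
  have "solid_path G' vs es \<longleftrightarrow> solid_path G vs es" for vs es
  proof -
    have "set es \<subseteq> solid G \<Longrightarrow> \<forall>i < length es. joins G' (es ! i) = joins G (es ! i)"
      using j bcrD(5)[OF G] by (meson nth_mem subsetD)
    then show ?thesis unfolding solid_path_def eq by (auto)
  qed
  then have sp: "solid_path G' = solid_path G" by blast
  have "{(x, y). \<exists>e \<in> edges G. joins G' e x y} = {(x, y). \<exists>e \<in> edges G. joins G e x y}"
    using j by (intro Collect_cong) (simp add: case_prod_beta)
  then have cg: "connected_graph G' = connected_graph G" by (simp add: connected_graph_def eq)
  have "wf_graph G'" using bcrD(1)[OF G] att by (auto simp: wf_graph_def eq)
  moreover have bl: "broken_lines G' = broken_lines G" unfolding broken_lines_def sp eq ..
  ultimately show ?thesis using G unfolding bcr_graph_def cg bl at sets eq by blast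
qed

text \<open>An IHX term depends only on the partition of the four half-edges into two pairs:
  exchanging the ends of \<open>e\<close> exchanges the pairs.\<close>

lemma iso_move_complement:
  assumes "bcr_graph G" "e \<in> dashed G" "att G (e, b) \<in> internal G" "att G (e, \<not> b) \<in> internal G"
    and P: "P \<union> Q = dashed_at G (att G (e, b)) \<union> dashed_at G (att G (e, \<not> b)) - {(e, b), (e, \<not> b)}"
      "P \<inter> Q = {}"
  shows "is_iso (transpose (att G (e, b)) (att G (e, \<not> b)), id, \<lambda>x. x = e)
    (resplit False G e b P) (resplit False G e b Q)"
proof (rule iso_cong_right)
  show "is_iso (transpose (att G (e, b)) (att G (e, \<not> b)), id, \<lambda>x. x = e)
      (resplit False G e b P) (resplit False G e (\<not> b) P)"
    using assms(2-4) by (intro iso_exchange_ends) (auto simp: internal_def dashed_def)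
  fix h :: "nat \<times> bool" assume "fst h \<in> edges (resplit False G e b Q)"
  then have h: "fst h \<in> edges G" by simp
  show "att (resplit False G e (\<not> b) P) h = att (resplit False G e b Q) h"
  proof (cases "fst h = e \<or> att G h \<notin> {att G (e, b), att G (e, \<not> b)}")
    case False
    have "h \<notin> solid_at G (att G h)" using bcrD(10)[OF assms(1)] assms(3,4) False by auto
    then have "h \<in> dashed_at G (att G h)" using h by (cases h) (auto simp: dashed_at_def solid_at_def dashed_def)
    then have "h \<in> P \<union> Q" using False unfolding P(1) by auto
    then have "h \<in> P \<longleftrightarrow> h \<notin> Q" using P(2) by blast
    then show ?thesis using False by (auto simp: att_resplit)
  qed (auto simp: att_resplit)
qed (simp_all add: insert_commute)

text \<open>The half-edges in \<open>P\<close> are already at the end that receives them, so nothing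
  moves. Thus one of the three IHX terms is \<open>G\<close> again.\<close>

lemma iso_move_trivial:
  assumes "bcr_graph G" "e \<in> dashed G" "att G (e, b) \<in> internal G" "att G (e, \<not> b) \<in> internal G"
    "att G (e, b) \<noteq> att G (e, \<not> b)"
    and P: "P = dashed_at G (att G (e, b)) - {(e, b)}"
  shows "is_iso id_map G (resplit False G e b P)"
proof -
  have "att (resplit False G e b P) h = att G h" if h: "fst h \<in> edges G" for h
  proof (cases "fst h = e \<or> att G h \<notin> {att G (e, b), att G (e, \<not> b)}")
    case False
    have "h \<notin> solid_at G (att G h)" using bcrD(10)[OF assms(1)] assms(3,4) False by auto
    then have "h \<in> dashed_at G (att G h)" using h by (cases h) (auto simp: dashed_at_def solid_at_def dashed_def)
    then have "h \<in> P \<longleftrightarrow> att G h = att G (e, b)" using False unfolding P by (auto simp: dashed_at_def)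
    then show ?thesis using False assms(5) by (auto simp: att_resplit)
  qed (auto simp: att_resplit)
  then show ?thesis by (simp add: id_map_def)
qed

text \<open>In the odd case the transposition of \<open>u\<close> and \<open>w\<close> gives -1,
  while the edges that change their orientation are none or both of \<open>g\<close> and
  \<open>e\<close>. In the even case the transposition of \<open>g\<close> and \<open>e\<close>
  gives -1. This is the antisymmetry behind the Jacobi identity.\<close>

lemma change_sign_two_edges:
  assumes fin: "finite (verts G)" "finite (edges G)" and c: "is_coloring k G c"
    and "u \<in> verts G" "w \<in> verts G" "u \<noteq> w" "g \<in> edges G" "e \<in> edges G" "g \<noteq> e"
  shows "change_sign (transpose u w, transpose g e, \<lambda>x. x \<in> {g, e} \<and> d) G c c = -1"
proof (cases c)
  case (Odd_Col l h)
  then have l: "bij_betw l (verts G) {1..card (verts G)}" using c by (cases k) auto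
  have "{x \<in> edges G. h (transpose g e x) \<noteq> (h x \<noteq> (x \<in> {g, e} \<and> d))} =
      (if (h g \<noteq> h e) = d then {} else {g, e})"
    using assms(7-9) by (auto simp: transpose_def)
  then have "even (card {x \<in> edges G. h (transpose g e x) \<noteq> (h x \<noteq> (x \<in> {g, e} \<and> d))})"
    using assms(9) by simp
  then show ?thesis using sign_label_perm_transpose[OF fin(1) l assms(4-6)]
    unfolding Odd_Col change_sign.simps by simp
next
  case (Even_Col l)
  then have l: "bij_betw l (edges G) {1..card (edges G)}" using c by (cases k) auto
  show ?thesis using sign_label_perm_transpose[OF fin(2) l assms(7-9)] by (simp add: Even_Col)
qed

text \<open>The solid line \<open>v - g - u - e - w\<close>, where \<open>v\<close>, \<open>u\<close> and \<open>w\<close> carry the dashed half-edges \<open>i\<close>, \<open>j\<close>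
  and the remaining one.\<close>

definition three_line :: "graph \<Rightarrow> nat \<Rightarrow> nat \<Rightarrow> nat \<Rightarrow> nat \<Rightarrow> nat \<Rightarrow>
    (nat \<times> bool) set \<Rightarrow> nat \<times> bool \<Rightarrow> nat \<times> bool \<Rightarrow> graph" where
  "three_line G g e v u w A i j = G\<lparr>ext := insert v (insert u (insert w (ext G))),
     solid := insert g (insert e (solid G)),
     att := \<lambda>h. if fst h = g \<or> fst h = e \<or> att G h \<notin> {v, u, w} then att G h
       else if h = i \<or> h \<in> A then v else if h = j then u else w\<rparr>"

lemma three_line_simps [simp]:
  "verts (three_line G g e v u w A i j) = verts G"
  "edges (three_line G g e v u w A i j) = edges G"
  "ext (three_line G g e v u w A i j) = insert v (insert u (insert w (ext G)))"
  "solid (three_line G g e v u w A i j) = insert g (insert e (solid G))"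
  by (simp_all add: three_line_def)

lemma att_three_line:
  "att (three_line G g e v u w A i j) h =
    (if fst h = g \<or> fst h = e \<or> att G h \<notin> {v, u, w} then att G h
     else if h = i \<or> h \<in> A then v else if h = j then u else w)"
  by (simp add: three_line_def)

section \<open>The two resolutions that lead to a solid line with three dashed half-edges\<close>

context weight
begin

context
  fixes D c g \<beta> e \<epsilon> i j j' v u w
  assumes D: "bcr_graph D" "is_coloring k D c" "card (internal D) \<le> Suc n"
    and g: "stu_edge D g \<beta>" and e: "e \<in> dashed D" "e \<noteq> g"
    and v: "att D (g, \<beta>) = v" and u: "att D (g, \<not> \<beta>) = u" "att D (e, \<epsilon>) = u"
    and w: "att D (e, \<not> \<epsilon>) = w" "w \<noteq> u" "w \<in> internal D"
    and du: "dashed_at D u = {(g, \<not> \<beta>), (e, \<epsilon>), i}" and dw: "dashed_at D w = {(e, \<not> \<epsilon>), j, j'}"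
begin

lemma jacobi_facts:
  "v \<noteq> u" "v \<noteq> w" "v \<in> ext D" "u \<in> internal D" "g \<in> dashed D" "g \<in> edges D" "e \<in> edges D"
  "g \<notin> solid D" "e \<notin> solid D"
  "u \<in> verts D" "w \<in> verts D" "v \<in> verts D"
  "i \<noteq> (g, \<not> \<beta>)" "i \<noteq> (e, \<epsilon>)" "att D i = u" "att D j = w" "att D j' = w" "j \<noteq> j'"
  "j \<noteq> (e, \<not> \<epsilon>)" "j' \<noteq> (e, \<not> \<epsilon>)" "fst i \<noteq> g" "fst i \<noteq> e" "fst j \<noteq> g" "fst j \<noteq> e" "fst j' \<noteq> g" "fst j' \<noteq> e"
  "dashed_at D v = {(g, \<beta>)}" "solid_at D u = {}" "solid_at D w = {}"
proof -
  note F = stu_edgeD[OF D(1) g, unfolded v u(1)]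
  show "v \<in> ext D" "u \<in> internal D" "g \<in> dashed D" "g \<in> edges D" "v \<noteq> u" "u \<in> verts D" "v \<in> verts D"
    "dashed_at D v = {(g, \<beta>)}" "solid_at D u = {}" "g \<notin> solid D"
    using F by blast+
  show vw: "v \<noteq> w" using F(4) w(3) by (auto simp: internal_def)
  show "w \<in> verts D" using w(3) by (simp add: internal_def)
  show "solid_at D w = {}" using bcrD(10)[OF D(1) w(3)] .
  show "e \<in> edges D" "e \<notin> solid D" using e(1) by (simp_all add: dashed_def)
  have "card {(g, \<not> \<beta>), (e, \<epsilon>), i} = 3" using bcrD(9)[OF D(1) F(5)] du by simp
  then show i: "i \<noteq> (g, \<not> \<beta>)" "i \<noteq> (e, \<epsilon>)" by (auto simp: card_insert_if split: if_splits)
  have "card {(e, \<not> \<epsilon>), j, j'} = 3" using bcrD(9)[OF D(1) w(3)] dw by simp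
  then show j: "j \<noteq> j'" "j \<noteq> (e, \<not> \<epsilon>)" "j' \<noteq> (e, \<not> \<epsilon>)" by (auto simp: card_insert_if split: if_splits)
  have "i \<in> dashed_at D u" "j \<in> dashed_at D w" "j' \<in> dashed_at D w" using du dw by simp_all
  then show a: "att D i = u" "att D j = w" "att D j' = w" by (simp_all add: dashed_at_def)
  have ends: "fst h = g \<Longrightarrow> h = (g, \<beta>) \<or> h = (g, \<not> \<beta>)" "fst h = e \<Longrightarrow> h = (e, \<epsilon>) \<or> h = (e, \<not> \<epsilon>)" for h
    by (cases h; cases \<beta>; auto)+
  show "fst i \<noteq> g" "fst i \<noteq> e" using ends[of i] i a(1) v F(7) w(1,2) by auto
  show "fst j \<noteq> g" "fst j \<noteq> e" using ends[of j] j a(2) v vw u w(1,2) by auto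
  show "fst j' \<noteq> g" "fst j' \<noteq> e" using ends[of j'] j a(3) v vw u w(1,2) by auto
qed

lemma jacobi_half_edges:
  assumes "fst h \<in> edges D" "fst h \<noteq> g" "fst h \<noteq> e"
  shows "att D h = v \<Longrightarrow> h \<in> solid_at D v" "att D h = u \<Longrightarrow> h = i" "att D h = w \<Longrightarrow> h = j \<or> h = j'"
proof -
  have m: "h \<in> dashed_at D (att D h) \<or> h \<in> solid_at D (att D h)"
    using assms(1) by (cases h) (simp add: dashed_at_def solid_at_def dashed_def)
  show "h \<in> solid_at D v" if "att D h = v"
    using m assms(2) unfolding that jacobi_facts(27) by auto
  show "h = i" if "att D h = u" using m assms(2,3) unfolding that jacobi_facts(28) du by auto
  show "h = j \<or> h = j'" if "att D h = w" using m assms(2,3) unfolding that jacobi_facts(29) dw by auto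
qed

text \<open>If \<open>v\<close> receives \<open>i\<close>, the edge \<open>e\<close> remains
  attached to \<open>u\<close>, which is next to \<open>v\<close> on the line. Resolving
  \<open>e\<close> prolongs the line beyond \<open>u\<close>, so \<open>i\<close> stays first and
  the order of \<open>j\<close> and \<open>j'\<close> is free.\<close>

lemma jacobi_first:
  assumes A: "A \<in> balanced (solid_at D v)"
  shows "W (resplit True D g \<beta> (insert i A), c) =
      - (W (three_line D g e v u w A i j, c) + W (three_line D g e v u w A i j', c))"
    "bcr_graph (three_line D g e v u w A i j)" "bcr_graph (three_line D g e v u w A i j')"
proof -
  note F = jacobi_facts
  let ?H = "resplit True D g \<beta> (insert i A)"
  have AS: "A \<subseteq> solid_at D v" using A by (simp add: balanced_def)
  have Ah: "fst h \<noteq> g \<and> fst h \<noteq> e \<and> att D h = v" if "h \<in> A" for h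
    using that AS F(8,9) by (auto simp: solid_at_def)
  have p: "(A, i) \<in> stu_pairs D g \<beta>" using A du F(13) by (simp add: stu_pairs_def v u)
  note H = stu_pairs_bcr[OF D(1) g p, simplified fst_conv snd_conv u]
  have atH: "att ?H h = (if fst h = g \<or> att D h \<notin> {v, u} then att D h
      else if h = i \<or> h \<in> A then v else u)" for h
    by (simp add: att_resplit v u)
  have e1: "att ?H (e, \<epsilon>) = u" "att ?H (e, \<not> \<epsilon>) = w"
    using e(2) u(2) w F(2,14) Ah[of "(e, \<epsilon>)"] by (auto simp: atH)
  have se: "stu_edge ?H e \<epsilon>"
    unfolding stu_edge_def e1 H(2) using e w(2,3) by (simp add: u v)
  have sol: "(g, \<not> \<beta>) \<in> solid_at ?H (att ?H (e, \<epsilon>))" by (simp add: e1 solid_at_def u)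
  have dH: "dashed_at ?H w = dashed_at D w"
    by (rule resplit_at_other) (use F(2) w(2) in \<open>simp_all add: u v\<close>)
  have xy: "dashed_at ?H (att ?H (e, \<not> \<epsilon>)) - {(e, \<not> \<epsilon>)} = {j, j'}"
    unfolding e1 dH dw using F(19,20) by auto
  have colH: "is_coloring k ?H c" using D(2) by simp
  have cH: "card (internal ?H) \<le> n" using H(3) D(3) by simp
  have "2 * W (?H, c) = - stu_sum (\<lambda>H. W (H, c)) ?H e \<epsilon>"
    by (rule stuD[OF H(1) colH cH se])
  also have "stu_sum (\<lambda>H. W (H, c)) ?H e \<epsilon> =
      2 * (W (resplit True ?H e \<epsilon> (insert j {(g, \<not> \<beta>)}), c) + W (resplit True ?H e \<epsilon> (insert j' {(g, \<not> \<beta>)}), c))"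
    by (rule stu_sum_solid[OF H(1) colH _ se sol xy F(18)]) (use cH in simp_all)
  finally have main: "W (?H, c) = - (W (resplit True ?H e \<epsilon> (insert j {(g, \<not> \<beta>)}), c) +
      W (resplit True ?H e \<epsilon> (insert j' {(g, \<not> \<beta>)}), c))" by simp
  have eq: "W (resplit True ?H e \<epsilon> (insert x {(g, \<not> \<beta>)}), c) = W (three_line D g e v u w A i x, c) \<and>
      bcr_graph (three_line D g e v u w A i x)" if x: "x = j \<or> x = j'" for x
  proof -
    let ?K = "resplit True ?H e \<epsilon> (insert x {(g, \<not> \<beta>)})"
    have bal: "{(g, \<not> \<beta>)} \<in> balanced (solid_at ?H (att ?H (e, \<epsilon>)))"
      using balanced_mem[OF _ _ sol] finite_at(2)[OF H(1)] bcrD(12)[OF H(1)] se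
      by (auto simp: stu_edge_def)
    have "({(g, \<not> \<beta>)}, x) \<in> stu_pairs ?H e \<epsilon>"
      unfolding stu_pairs_def xy using bal x by auto
    note K = stu_pairs_bcr[OF H(1) se this, simplified fst_conv snd_conv]
    have xw: "att D x = w" "fst x \<noteq> g" "fst x \<noteq> e" using x F by auto
    have K': "att ?K h = (if fst h = e \<or> att ?H h \<notin> {u, w} then att ?H h
        else if h = x \<or> h = (g, \<not> \<beta>) then u else w)" for h
      unfolding att_resplit[of _ ?H] e1 by simp
    have at: "att (three_line D g e v u w A i x) h = att ?K h" for h
    proof -
      consider "fst h = e" | "h = (g, \<beta>)" | "h = (g, \<not> \<beta>)"
        | "fst h \<noteq> e" "fst h \<noteq> g" "att D h \<notin> {v, u, w}" | "fst h \<noteq> e" "fst h \<noteq> g" "att D h = v"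
        | "fst h \<noteq> e" "fst h \<noteq> g" "att D h = u" | "fst h \<noteq> e" "fst h \<noteq> g" "att D h = w"
        by (cases h; cases \<beta>; auto)
      then show ?thesis
      proof cases
        case 1
        then have "h = (e, \<epsilon>) \<or> h = (e, \<not> \<epsilon>)" by (cases h) auto
        then have "att ?H h = att D h" using e1 u w by auto
        then show ?thesis using 1 by (simp add: att_three_line K')
      next
        case 2
        then show ?thesis using e(2) v F(1,2) by (simp del: resplit_simps add: att_three_line K' atH)
      next
        case 3
        then show ?thesis using e(2) u by (simp del: resplit_simps add: att_three_line K' atH)
      next
        case 4
        then show ?thesis by (simp add: att_three_line K' atH)
      next
        case 5
        then have "h \<noteq> x" "h \<noteq> i" "h \<noteq> (g, \<not> \<beta>)" using xw F(1,2,15) by auto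
        then show ?thesis using 5 F(1,2) by (simp add: att_three_line K' atH)
      next
        case 6
        then have "h \<noteq> x" "h \<notin> A" "h \<noteq> (g, \<not> \<beta>)" using xw w(2) F(1) Ah[of h] by auto
        then show ?thesis using 6 F(1,2) by (simp add: att_three_line K' atH)
      next
        case 7
        then have "h \<noteq> i" "h \<notin> A" "h \<noteq> (g, \<not> \<beta>)" using F(2,15) w(2) Ah[of h] by auto
        then show ?thesis using 7 F(2) w(2) by (auto simp add: att_three_line K' atH)
      qed
    qed
    have s: "verts (three_line D g e v u w A i x) = verts ?K" "edges (three_line D g e v u w A i x) = edges ?K"
      "ext (three_line D g e v u w A i x) = ext ?K" "solid (three_line D g e v u w A i x) = solid ?K"
      using e1 by (auto simp add: v u)
    have L: "bcr_graph (three_line D g e v u w A i x)"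
      by (rule bcr_cong[OF K(1) s at])
    moreover have "card (internal ?K) \<le> n" using K(3) cH by simp
    moreover have "is_coloring k ?K c" using D(2) by simp
    ultimately have "W (?K, c) = W (three_line D g e v u w A i x, c)"
      by (intro weight_cong K(1) s[symmetric] at[symmetric])
    then show ?thesis using L by blast
  qed
  show "W (?H, c) = - (W (three_line D g e v u w A i j, c) + W (three_line D g e v u w A i j', c))"
    "bcr_graph (three_line D g e v u w A i j)" "bcr_graph (three_line D g e v u w A i j')"
    unfolding main using eq[of j] eq[of j'] by simp_all
qed

text \<open>If \<open>v\<close> receives \<open>(e, \<epsilon>)\<close>, resolving \<open>e\<close>
  inserts \<open>w\<close> between \<open>v\<close> and \<open>u\<close>, so \<open>i\<close> comes
  last. Exchanging \<open>u\<close> with \<open>w\<close> and \<open>g\<close> with \<open>e\<close>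
  restores the standard form of the line. Its sign -1 cancels the minus sign of the STU relation.
  The assumptions \<open>L\<close> are supplied by \<open>jacobi_first\<close> for other positions
  of the half-edges.\<close>

lemma jacobi_second:
  assumes A: "A \<in> balanced (solid_at D v)"
    and L: "bcr_graph (three_line D g e v u w A j j')" "bcr_graph (three_line D g e v u w A j' j)"
  shows "W (resplit True D g \<beta> (insert (e, \<epsilon>) A), c) =
      W (three_line D g e v u w A j j', c) + W (three_line D g e v u w A j' j, c)"
proof -
  note F = jacobi_facts
  let ?H = "resplit True D g \<beta> (insert (e, \<epsilon>) A)"
  have AS: "A \<subseteq> solid_at D v" using A by (simp add: balanced_def)
  have Ah: "fst h \<noteq> g \<and> fst h \<noteq> e \<and> att D h = v" if "h \<in> A" for h
    using that AS F(8,9) by (auto simp: solid_at_def)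
  have eu: "(e, \<epsilon>) \<in> dashed_at D u - {(g, \<not> \<beta>)}" using du e(2) by simp
  have p: "(A, (e, \<epsilon>)) \<in> stu_pairs D g \<beta>" using A eu by (simp add: stu_pairs_def v u)
  note H = stu_pairs_bcr[OF D(1) g p, simplified fst_conv snd_conv u(1)]
  have atH: "att ?H h = (if fst h = g \<or> att D h \<notin> {v, u} then att D h
      else if h = (e, \<epsilon>) \<or> h \<in> A then v else u)" for h
    by (simp add: att_resplit v u)
  have e1: "att ?H (e, \<epsilon>) = v" "att ?H (e, \<not> \<epsilon>) = w"
    using e(2) u(2) w F(2,14) by (auto simp: atH)
  have se: "stu_edge ?H e \<epsilon>"
    unfolding stu_edge_def e1 H(2) using e w(2,3) by (simp add: u v)
  have solv: "solid_at ?H v = insert (g, \<beta>) A"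
    using split_at(3)[OF D(1) g, of A "(e, \<epsilon>)"] AS eu by (simp add: u v)
  have sol: "(g, \<beta>) \<in> solid_at ?H (att ?H (e, \<epsilon>))" unfolding e1 solv by simp
  have gA: "(g, \<beta>) \<notin> A" using Ah by fastforce
  have Asol: "A = {(g, \<beta>)} \<or> A = solid_at ?H (att ?H (e, \<epsilon>)) - {(g, \<beta>)}"
    unfolding e1 solv using gA by simp
  have dH: "dashed_at ?H w = dashed_at D w"
    by (rule resplit_at_other) (use F(2) w(2) in \<open>simp_all add: u v\<close>)
  have xy: "dashed_at ?H (att ?H (e, \<not> \<epsilon>)) - {(e, \<not> \<epsilon>)} = {j, j'}"
    unfolding e1 dH dw using F(19,20) by auto
  have colH: "is_coloring k ?H c" using D(2) by simp
  have cH: "card (internal ?H) \<le> n" using H(3) D(3) by simp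
  have "2 * W (?H, c) = - stu_sum (\<lambda>H. W (H, c)) ?H e \<epsilon>"
    by (rule stuD[OF H(1) colH cH se])
  also have "stu_sum (\<lambda>H. W (H, c)) ?H e \<epsilon> =
      2 * (W (resplit True ?H e \<epsilon> (insert j A), c) + W (resplit True ?H e \<epsilon> (insert j' A), c))"
    by (rule stu_sum_solid[OF H(1) colH _ se sol xy F(18) Asol]) (use cH in simp)
  finally have main: "W (?H, c) = - (W (resplit True ?H e \<epsilon> (insert j A), c) +
      W (resplit True ?H e \<epsilon> (insert j' A), c))" by simp
  have eq: "W (resplit True ?H e \<epsilon> (insert x A), c) = - W (three_line D g e v u w A x y, c)"
    if xy': "(x = j \<and> y = j') \<or> (x = j' \<and> y = j)" for x y
  proof -
    let ?K = "resplit True ?H e \<epsilon> (insert x A)"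
    let ?L = "three_line D g e v u w A x y"
    have bal: "A \<in> balanced (solid_at ?H (att ?H (e, \<epsilon>)))"
      using A gA unfolding e1 solv by (auto simp: balanced_def insert_Diff_if)
    have "(A, x) \<in> stu_pairs ?H e \<epsilon>"
      unfolding stu_pairs_def xy using bal xy' by auto
    note K = stu_pairs_bcr[OF H(1) se this, simplified fst_conv snd_conv]
    have xw: "att D x = w" "fst x \<noteq> g" "fst x \<noteq> e" "att D y = w" "fst y \<noteq> g" "fst y \<noteq> e" "x \<noteq> y"
      using xy' F by auto
    have atK: "att ?K h = (if fst h = e \<or> att ?H h \<notin> {v, w} then att ?H h
        else if h = x \<or> h \<in> A then v else w)" for h
      unfolding att_resplit[of _ ?H] e1 by simp
    \<comment> \<open>The flips are chosen so that \<open>(e, \<epsilon>)\<close> and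
      \<open>(g, \<beta>)\<close> correspond. Their Booleans agree or both edges have to be
      flipped.\<close>
    let ?f = "(transpose u w, transpose g e, \<lambda>z. z \<in> {g, e} \<and> (\<epsilon> \<noteq> \<beta>))"
    have main: "att ?L (hmap ?f h) = transpose u w (att ?K h)" if h: "fst h \<in> edges D" for h
    proof -
      consider "h = (e, \<epsilon>)" | "h = (e, \<not> \<epsilon>)" | "h = (g, \<beta>)" | "h = (g, \<not> \<beta>)"
        | "fst h \<noteq> e" "fst h \<noteq> g" "att D h \<notin> {v, u, w}" | "fst h \<noteq> e" "fst h \<noteq> g" "att D h = v"
        | "fst h \<noteq> e" "fst h \<noteq> g" "att D h = u" | "fst h \<noteq> e" "fst h \<noteq> g" "att D h = w"
        by (cases h; cases \<beta>; cases \<epsilon>; auto)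
      then show ?thesis
      proof cases
        case 1
        then have "hmap ?f h = (g, \<beta>)" using e(2) by auto
        then show ?thesis using 1 e1 F(1,2) v by (simp add: att_three_line atK transpose_def)
      next
        case 2
        then have "hmap ?f h = (g, \<not> \<beta>)" using e(2) by auto
        then show ?thesis using 2 e1 u by (simp add: att_three_line atK transpose_def)
      next
        case 3
        then have "hmap ?f h = (e, \<epsilon>)" using e(2) by auto
        moreover have "att ?K h = w" using 3 e(2) gA xw v by (auto simp: atK atH)
        ultimately show ?thesis using u by (simp add: att_three_line)
      next
        case 4
        then have "hmap ?f h = (e, \<not> \<epsilon>)" using e(2) by auto
        moreover have "att ?K h = u" using 4 e(2) u w(2) F(1) by (auto simp: atK atH)
        ultimately show ?thesis using w by (simp add: att_three_line)
      next
        case 5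
        then have "hmap ?f h = h" by (cases h) auto
        moreover have "att ?K h = att D h" using 5 by (simp add: atK atH)
        ultimately show ?thesis using 5 by (simp add: att_three_line transpose_def)
      next
        case 6
        then have f: "hmap ?f h = h" by (cases h) auto
        have x: "h \<noteq> x" "h \<noteq> y" "h \<noteq> (e, \<epsilon>)" using xw 6 F(2) by auto
        have "att ?K h = (if h \<in> A then v else u)" using 6 x F(1,2) w(2) by (simp add: atK atH)
        then show ?thesis unfolding f using 6 x F(1,2) by (simp add: att_three_line transpose_def)
      next
        case 7
        then have f: "hmap ?f h = h" by (cases h) auto
        have x: "h \<noteq> x" "h \<noteq> y" "h \<noteq> (e, \<epsilon>)" "h \<notin> A" using xw 7 w(2) F(1) Ah[of h] by auto
        have "att ?K h = u" using 7 x F(1) w(2) by (simp add: atK atH)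
        then show ?thesis unfolding f using 7 x by (simp add: att_three_line)
      next
        case 8
        then have f: "hmap ?f h = h" by (cases h) auto
        have x: "h = x \<or> h = y" using jacobi_half_edges(3)[OF h 8(2,1,3)] xy' by auto
        have hA: "h \<notin> A" using Ah[of h] 8 F(2) by auto
        have "att ?K h = (if h = x then v else w)" using 8 hA F(2) w(2) by (simp add: atK atH)
        then show ?thesis unfolding f using 8 x xw(7) hA F(1,2) by (auto simp add: att_three_line transpose_def)
      qed
    qed
    have sK: "verts ?K = verts D" "edges ?K = edges D" "ext ?K = insert v (insert u (insert w (ext D)))"
      "solid ?K = insert g (insert e (solid D))"
      using e1 by (auto simp add: v u)
    have "is_iso ?f ?K ?L"
    proof -
      have "bij_betw (transpose u w) (verts D) (verts D)" "bij_betw (transpose g e) (edges D) (edges D)"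
        by (intro permutes_imp_bij permutes_swap_id F)+
      moreover have "transpose u w z \<in> insert v (insert u (insert w (ext D))) \<longleftrightarrow>
          z \<in> insert v (insert u (insert w (ext D)))" for z by (simp add: transpose_def)
      moreover have "transpose g e z \<in> insert g (insert e (solid D)) \<longleftrightarrow>
          z \<in> insert g (insert e (solid D))" for z by (simp add: transpose_def)
      moreover have "\<forall>z \<in> edges D. \<forall>d. att ?L (transpose g e z, d \<noteq> (z \<in> {g, e} \<and> (\<epsilon> \<noteq> \<beta>))) =
          transpose u w (att ?K (z, d))"
        using main by (metis fst_conv hmap.simps)
      ultimately show ?thesis unfolding is_iso.simps sK three_line_simps by blast
    qed
    moreover have "bcr_graph ?L" using L xy' by auto
    moreover have "card (internal ?K) \<le> n" using K(3) cH by simp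
    moreover have "is_coloring k ?K c" "is_coloring k ?L c" using D(2) is_coloring_cong[of ?L D] by simp_all
    ultimately have "W (?K, c) = of_int (change_sign ?f ?K c c) * W (?L, c)"
      by (intro orientD K(1))
    moreover have "change_sign ?f ?K c c = -1"
      using F w(2) e(2) sK bcrD(2,3)[OF D(1)] D(2) by (intro change_sign_two_edges[of _ k]) auto
    ultimately show ?thesis by simp
  qed
  show ?thesis unfolding main using eq[of j j'] eq[of j' j] by simp
qed

end

text \<open>The Jacobi identity for the commutator of \<open>p\<close>, \<open>q\<close>, \<open>r\<close> along a solid line: each of the six
  orders occurs twice, with opposite signs.\<close>

lemma stu_sum_jacobi:
  assumes G: "bcr_graph G" "is_coloring k G c" "card (internal G) \<le> Suc n"
    and g: "stu_edge G g \<beta>" and e: "e \<in> dashed G" "e \<noteq> g" "att G (e, \<epsilon>) = att G (g, \<not> \<beta>)"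
    and w: "att G (e, \<not> \<epsilon>) \<noteq> att G (g, \<not> \<beta>)" "att G (e, \<not> \<epsilon>) \<in> internal G"
    and du: "dashed_at G (att G (g, \<not> \<beta>)) = {(g, \<not> \<beta>), (e, \<epsilon>), p}"
    and dw: "dashed_at G (att G (e, \<not> \<epsilon>)) = {(e, \<not> \<epsilon>), q, r}"
  shows "(\<Sum>x\<in>{p, q, r}. stu_sum (\<lambda>H. W (H, c)) (resplit False G e \<epsilon> {(g, \<not> \<beta>), x}) g \<beta>) = 0"
proof -
  define v u w' where vuw: "v = att G (g, \<beta>)" "u = att G (g, \<not> \<beta>)" "w' = att G (e, \<not> \<epsilon>)"
  note F = jacobi_facts[OF G g e(1,2) vuw(1)[symmetric] vuw(2)[symmetric] e(3)[folded vuw] vuw(3)[symmetric]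
      w[folded vuw] du[folded vuw] dw[folded vuw]]
  have ends: "att G (e, \<epsilon>) = u" "att G (e, \<not> \<epsilon>) = w'" "att G (g, \<beta>) = v" "att G (g, \<not> \<beta>) = u"
    using vuw e(3) by auto
  have wu: "w' \<noteq> u" "w' \<in> internal G" using w vuw by auto
  \<comment> \<open>\<open>D x\<close> is the IHX term for \<open>e\<close> in which
    \<open>g\<close> and \<open>x\<close> share the vertex \<open>u\<close>. \<open>L A x y\<close>
    is the line on which \<open>x\<close>, \<open>y\<close> and the remaining half-edge follow each
    other.\<close>
  define D where "D x = resplit False G e \<epsilon> {(g, \<not> \<beta>), x}" for x
  define L where "L A x y = three_line G g e v u w' A x y" for A x y
  define S where "S = solid_at G v"
  have pqr: "p \<noteq> q" "p \<noteq> r" "q \<noteq> r" using F(15-18) wu(1) by auto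
  have gM: "(g, \<not> \<beta>) \<notin> {p, q, r}" using F(13,23,25) by auto
  have eM: "(e, d) \<notin> {p, q, r, (g, \<not> \<beta>)}" for d using F(22,24,26) e(2) by auto
  have M: "dashed_at G (att G (e, \<epsilon>)) \<union> dashed_at G (att G (e, \<not> \<epsilon>)) - {(e, \<epsilon>), (e, \<not> \<epsilon>)} =
      {(g, \<not> \<beta>), p, q, r}"
    using eM unfolding e(3) du dw by auto
  have facts: "bcr_graph (D x)" "is_coloring k (D x) c" "card (internal (D x)) \<le> Suc n"
    "stu_edge (D x) g \<beta>" "e \<in> dashed (D x)" "att (D x) (g, \<beta>) = v" "att (D x) (g, \<not> \<beta>) = u"
    "att (D x) (e, \<epsilon>) = u" "att (D x) (e, \<not> \<epsilon>) = w'" "w' \<in> internal (D x)"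
    "dashed_at (D x) u = {(g, \<not> \<beta>), (e, \<epsilon>), x}" "dashed_at (D x) w' = {(e, \<not> \<epsilon>), y, z}"
    "solid_at (D x) v = S" "three_line (D x) g e v u w' A i j = L A i j"
    if xyz: "{x, y, z} = {p, q, r}" "x \<noteq> y" "x \<noteq> z" "y \<noteq> z" for x y z A i j
  proof -
    have xM: "x \<in> {p, q, r}" using xyz by blast
    have P: "{(g, \<not> \<beta>), x} \<subseteq> dashed_at G (att G (e, \<epsilon>)) \<union> dashed_at G (att G (e, \<not> \<epsilon>)) - {(e, \<epsilon>), (e, \<not> \<epsilon>)}"
      "card {(g, \<not> \<beta>), x} = 2"
      using xM gM unfolding M by auto
    have ne: "att G (e, \<epsilon>) \<noteq> att G (e, \<not> \<epsilon>)" "att G (e, \<epsilon>) \<in> internal G" "att G (e, \<not> \<epsilon>) \<in> internal G"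
      using ends wu F(4) by auto
    note m = bcr_move[OF G(1) e(1) ne P, folded D_def, unfolded M, unfolded ends]
    show "bcr_graph (D x)" by (rule m(1))
    show "is_coloring k (D x) c" using G(2) by (simp add: D_def)
    show "card (internal (D x)) \<le> Suc n" using G(3) by (simp add: D_def)
    show "e \<in> dashed (D x)" using e by (simp add: D_def)
    show a: "att (D x) (g, \<beta>) = v" "att (D x) (g, \<not> \<beta>) = u"
      using F(1,2) e(2) by (simp_all add: D_def att_resplit ends)
    show "att (D x) (e, \<epsilon>) = u" "att (D x) (e, \<not> \<epsilon>) = w'" by (simp_all add: D_def ends)
    show "w' \<in> internal (D x)" using wu by (simp add: D_def)
    show "stu_edge (D x) g \<beta>" unfolding stu_edge_def a using F(3-5) by (simp add: D_def)
    show "dashed_at (D x) u = {(g, \<not> \<beta>), (e, \<epsilon>), x}" using m(2) by auto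
    have "{(g, \<not> \<beta>), p, q, r} - {(g, \<not> \<beta>), x} = {y, z}"
    proof -
      have "{(g, \<not> \<beta>), p, q, r} = insert (g, \<not> \<beta>) {x, y, z}" using xyz(1) by simp
      moreover have "(g, \<not> \<beta>) \<notin> {x, y, z}" using gM xyz(1) by simp
      ultimately show ?thesis using xyz(2-4) by auto
    qed
    then show "dashed_at (D x) w' = {(e, \<not> \<epsilon>), y, z}" using m(3) by simp
    show "solid_at (D x) v = S" unfolding S_def D_def
      by (rule resplit_at_other) (use F(1,2) in \<open>simp_all add: ends\<close>)
    \<comment> \<open>A line only depends on which half-edges are at one of the three vertices, and
      this is the same for all \<open>D x\<close>. Hence the lines obtained from the three IHX terms
      can be compared.\<close>
    have att: "fst h = g \<or> fst h = e \<Longrightarrow> att (D x) h = att G h"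
      "att (D x) h \<in> {v, u, w'} \<longleftrightarrow> att G h \<in> {v, u, w'}"
      "att G h \<notin> {v, u, w'} \<Longrightarrow> att (D x) h = att G h" for h
    proof -
      show "att (D x) h = att G h" if "fst h = g \<or> fst h = e"
      proof (cases "fst h = e")
        case False
        then have "h = (g, \<beta>) \<or> h = (g, \<not> \<beta>)" using that by (cases h) auto
        then show ?thesis using a ends by auto
      qed (simp add: D_def att_resplit)
    qed (simp_all add: D_def att_resplit ends)
    show "three_line (D x) g e v u w' A i j = L A i j"
    proof (rule graph_eqI)
      fix h
      show "att (three_line (D x) g e v u w' A i j) h = att (L A i j) h"
        unfolding L_def att_three_line att(2) using att(1,3) by simp
    qed (simp_all add: L_def D_def)
  qed
  have bcrL: "bcr_graph (L A x y)" if A: "A \<in> balanced S"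
    and xyz: "{x, y, z} = {p, q, r}" "x \<noteq> y" "x \<noteq> z" "y \<noteq> z" for A x y z
  proof -
    note f = facts[OF xyz]
    have "A \<in> balanced (solid_at (D x) v)" unfolding f(13) by (rule A)
    from jacobi_first(2)[OF f(1-5) e(2) f(6-9) wu(1) f(10-12) this]
    show ?thesis unfolding f(14) .
  qed
  have one: "stu_sum (\<lambda>H. W (H, c)) (D x) g \<beta> = (\<Sum>A\<in>balanced S.
      W (L A y z, c) + W (L A z y, c) - W (L A x y, c) - W (L A x z, c))"
    if xyz: "{x, y, z} = {p, q, r}" "x \<noteq> y" "x \<noteq> z" "y \<noteq> z" for x y z
  proof -
    note f = facts[OF xyz]
    have "(e, \<epsilon>) \<noteq> x" "(g, \<not> \<beta>) \<noteq> x" using eM gM xyz(1) by blast+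
    \<comment> \<open>Besides \<open>g\<close> itself, \<open>u\<close> has the half-edges
      \<open>x\<close> and \<open>(e, \<epsilon>)\<close>. One of them goes to \<open>v\<close>,
      which gives the situations of \<open>jacobi_first\<close> and
      \<open>jacobi_second\<close>.\<close>
    then have "stu_pairs (D x) g \<beta> = balanced S \<times> {x, (e, \<epsilon>)}"
      unfolding stu_pairs_def f(6,7,11,13) using e(2) by auto
    then have "stu_sum (\<lambda>H. W (H, c)) (D x) g \<beta> =
        (\<Sum>A\<in>balanced S. \<Sum>h\<in>{x, (e, \<epsilon>)}. W (resplit True (D x) g \<beta> (insert h A), c))"
      unfolding stu_sum_def sum.cartesian_product by (simp add: case_prod_beta)
    also have "\<dots> = (\<Sum>A\<in>balanced S.
      W (L A y z, c) + W (L A z y, c) - W (L A x y, c) - W (L A x z, c))"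
    proof (rule sum.cong[OF refl])
      fix A assume A: "A \<in> balanced S"
      then have A': "A \<in> balanced (solid_at (D x) v)" unfolding f(13) .
      have "{y, z, x} = {p, q, r}" "{z, y, x} = {p, q, r}" using xyz(1) by blast+
      then have "bcr_graph (L A y z)" "bcr_graph (L A z y)"
        using bcrL[OF A, of y z x] bcrL[OF A, of z y x] xyz(2-4) by simp_all
      then have l: "bcr_graph (three_line (D x) g e v u w' A y z)"
        "bcr_graph (three_line (D x) g e v u w' A z y)" unfolding f(14) .
      have "W (resplit True (D x) g \<beta> (insert x A), c) = - (W (L A x y, c) + W (L A x z, c))"
        using jacobi_first(1)[OF f(1-5) e(2) f(6-9) wu(1) f(10-12) A'] unfolding f(14) .
      moreover have "W (resplit True (D x) g \<beta> (insert (e, \<epsilon>) A), c) = W (L A y z, c) + W (L A z y, c)"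
        using jacobi_second[OF f(1-5) e(2) f(6-9) wu(1) f(10-12) A' l] unfolding f(14) .
      ultimately show "(\<Sum>h\<in>{x, (e, \<epsilon>)}. W (resplit True (D x) g \<beta> (insert h A), c)) =
          W (L A y z, c) + W (L A z y, c) - W (L A x y, c) - W (L A x z, c)"
        using \<open>(e, \<epsilon>) \<noteq> x\<close> by simp
    qed
    finally show ?thesis .
  qed
  have perm: "{q, p, r} = {p, q, r}" "{r, p, q} = {p, q, r}" by auto
  have "(\<Sum>x\<in>{p, q, r}. stu_sum (\<lambda>H. W (H, c)) (D x) g \<beta>) =
      stu_sum (\<lambda>H. W (H, c)) (D p) g \<beta> + stu_sum (\<lambda>H. W (H, c)) (D q) g \<beta> +
      stu_sum (\<lambda>H. W (H, c)) (D r) g \<beta>" using pqr by simp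
  also have "\<dots> = 0"
    unfolding one[OF refl pqr] one[OF perm(1) pqr(1)[symmetric] pqr(3,2)]
      one[OF perm(2) pqr(2)[symmetric] pqr(3)[symmetric] pqr(1)] sum.distrib[symmetric]
    by (intro sum.neutral ballI) simp
  finally show ?thesis unfolding D_def .
qed

text \<open>If the third half-edge \<open>z\<close> at the internal vertex leads to another internal vertex, both
  resolutions can be compared through the two other terms of the IHX relation at the edge of \<open>z\<close>:
  there, the edges \<open>e\<close> and \<open>e'\<close> are at different internal vertices.\<close>

lemma stu_sum_same_vertex:
  assumes G: "bcr_graph G" "is_coloring k G c" "card (internal G) \<le> Suc n" "2 \<le> card (internal G)"
    and e: "stu_edge G e b" and e': "stu_edge G e' b'" "e \<noteq> e'"
    and eq: "att G (e, \<not> b) = att G (e', \<not> b')"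
  shows "stu_sum (\<lambda>H. W (H, c)) G e b = stu_sum (\<lambda>H. W (H, c)) G e' b'"
proof -
  define w where "w = att G (e, \<not> b)"
  note E = stu_edgeD[OF G(1) e, folded w_def]
  note E' = stu_edgeD[OF G(1) e'(1), folded eq, folded w_def]
  have "card (dashed_at G w - {(e, \<not> b)} - {(e', \<not> b')}) = 1" using E(13) E'(12) e'(2) by simp
  then obtain z where z0: "dashed_at G w - {(e, \<not> b)} - {(e', \<not> b')} = {z}" by (rule card_1_singletonE)
  then have dw: "dashed_at G w = {(e, \<not> b), (e', \<not> b'), z}" and zne: "z \<noteq> (e, \<not> b)" "z \<noteq> (e', \<not> b')"
    using E(12) E'(12) by blast+
  obtain f \<gamma> where z: "z = (f, \<gamma>)" by (cases z)
  have zw: "att G (f, \<gamma>) = w" "f \<in> dashed G" "f \<in> edges G" using dw z by (auto simp: dashed_at_def dashed_def)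
  have fe: "f \<noteq> e" "f \<noteq> e'"
  proof -
    show "f \<noteq> e" using zne z zw(1) E(7) by (cases "\<gamma> = b") auto
    show "f \<noteq> e'" using zne z zw(1) E'(7) by (cases "\<gamma> = b'") auto
  qed
  define t where "t = att G (f, \<not> \<gamma>)"
  have "t \<in> verts G" using bcrD(6)[OF G(1) zw(3)] by (simp add: t_def)
  then consider (ext) "t \<in> ext G" | (int) "t \<in> internal G" by (auto simp: internal_def)
  then show ?thesis
  proof cases
    case ext
    \<comment> \<open>All three edges at \<open>w\<close> lead to external vertices, so no edge
      joins \<open>?X\<close> to \<open>w\<close>, and \<open>exists_stu_edge\<close> finds an STU
      edge at another internal vertex.\<close>
    let ?X = "internal G - {w}"
    have "?X \<noteq> {}"
    proof
      assume "?X = {}"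
      then have "internal G \<subseteq> {w}" by blast
      then have "card (internal G) \<le> card {w}" by (intro card_mono) auto
      then show False using G(4) by simp
    qed
    moreover have "att G (d, \<not> a) \<in> ?X \<union> ext G" if d: "d \<in> dashed G" "att G (d, a) \<in> ?X" for d a
    proof -
      have "att G (d, \<not> a) \<noteq> w"
      proof
        assume "att G (d, \<not> a) = w"
        then have "(d, \<not> a) \<in> dashed_at G w" using d by (simp add: dashed_at_def)
        then have "(d, a) \<in> {(e, b), (e', b'), (f, \<not> \<gamma>)}" unfolding dw z by auto
        then have "att G (d, a) \<in> ext G" using E(4) E'(4) ext t_def by auto
        then show False using d(2) by (simp add: internal_def)
      qed
      moreover have "att G (d, \<not> a) \<in> verts G" using bcrD(6)[OF G(1)] d(1) by (simp add: dashed_def)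
      ultimately show ?thesis by (simp add: internal_def)
    qed
    ultimately obtain d a where d: "stu_edge G d a" "att G (d, \<not> a) \<in> ?X"
      using exists_stu_edge[OF G(1), of ?X] by (metis Diff_subset)
    have "stu_sum (\<lambda>H. W (H, c)) G e b = stu_sum (\<lambda>H. W (H, c)) G d a"
      by (rule stu_sum_commute[OF G(1-3) e d(1)]) (use d(2) w_def in auto)
    also have "\<dots> = stu_sum (\<lambda>H. W (H, c)) G e' b'"
      by (rule stu_sum_commute[OF G(1-3) d(1) e'(1)]) (use d(2) w_def eq in auto)
    finally show ?thesis .
  next
    case int
    \<comment> \<open>A loop \<open>f\<close> would take two of the three half-edges at
      \<open>w\<close>, but \<open>e\<close> and \<open>e'\<close> already take two.\<close>
    have tw: "t \<noteq> w"
    proof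
      assume "t = w"
      then have "(f, \<not> \<gamma>) \<in> dashed_at G w" using zw(2) by (simp add: dashed_at_def t_def)
      then show False using fe unfolding dw z by auto
    qed
    have "(f, \<not> \<gamma>) \<in> dashed_at G t" using zw(2) by (simp add: dashed_at_def t_def)
    moreover have "card (dashed_at G t) = 3" using bcrD(9)[OF G(1) int] .
    ultimately have "card (dashed_at G t - {(f, \<not> \<gamma>)}) = 2" by simp
    then obtain q r where qr: "dashed_at G t - {(f, \<not> \<gamma>)} = {q, r}" "q \<noteq> r" by (metis card_2_iff)
    then have dt: "dashed_at G t = {(f, \<not> \<gamma>), q, r}" using \<open>(f, \<not> \<gamma>) \<in> dashed_at G t\<close> by blast
    have qt: "att G q = t" "att G r = t" using dt by (auto simp: dashed_at_def)
    let ?s = "\<lambda>H e b. stu_sum (\<lambda>H. W (H, c)) H e b"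
    let ?D = "\<lambda>x y. resplit False G f \<gamma> {x, y}"
    let ?h = "(e, \<not> b)" and ?h' = "(e', \<not> b')"
    have dw1: "dashed_at G (att G ?h) = {?h, (f, \<gamma>), ?h'}" "dashed_at G (att G ?h') = {?h', (f, \<gamma>), ?h}"
      using dw z w_def eq by auto
    \<comment> \<open>Two Jacobi identities for the same edge \<open>f\<close>: in the first
      \<open>e\<close> is resolved and \<open>?h\<close> is the distinguished half-edge, in the
      second \<open>e'\<close> and \<open>?h'\<close>. They share the term \<open>G\<close>, up to
      isomorphism.\<close>
    have J: "(\<Sum>x\<in>{?h', q, r}. ?s (?D ?h x) e b) = 0" "(\<Sum>x\<in>{?h, q, r}. ?s (?D ?h' x) e' b') = 0"
      by (rule stu_sum_jacobi[OF G(1-3) e zw(2) fe(1) _ _ _ dw1(1) dt[unfolded t_def]],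
          use zw(1) tw int in \<open>simp_all add: t_def[symmetric] w_def[symmetric]\<close>)
        (rule stu_sum_jacobi[OF G(1-3) e'(1) zw(2) fe(2) _ _ _ dw1(2) dt[unfolded t_def]],
          use zw(1) tw int eq in \<open>simp_all add: t_def[symmetric] w_def[symmetric]\<close>)
    have dist: "?h \<notin> {q, r}" "?h' \<notin> {q, r}" "?h \<noteq> ?h'"
      using qt tw w_def eq e'(2) by auto
    have M: "dashed_at G (att G (f, \<gamma>)) \<union> dashed_at G (att G (f, \<not> \<gamma>)) - {(f, \<gamma>), (f, \<not> \<gamma>)} = {?h, ?h', q, r}"
    proof -
      have "fst q \<noteq> f" "fst r \<noteq> f"
      proof -
        have "(f, d) \<notin> {q, r}" for d
        proof
          assume a: "(f, d) \<in> {q, r}"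
          then have "att G (f, d) = t" using qt by auto
          then have "d = (\<not> \<gamma>)" using tw zw(1) by (cases "d = \<gamma>") auto
          then show False using a qr(1) by blast
        qed
        then show "fst q \<noteq> f" "fst r \<noteq> f" by (metis insertCI prod.collapse)+
      qed
      then show ?thesis unfolding zw(1) t_def[symmetric] dw dt z using fe by auto
    qed
    have ne: "att G (f, \<gamma>) \<noteq> att G (f, \<not> \<gamma>)" "att G (f, \<gamma>) \<in> internal G" "att G (f, \<not> \<gamma>) \<in> internal G"
      using tw zw(1) int E(5) by (auto simp: t_def[symmetric])
    have D: "bcr_graph (?D x y)" "is_coloring k (?D x y) c" "card (internal (?D x y)) \<le> Suc n"
      if "{x, y} \<subseteq> {?h, ?h', q, r}" "x \<noteq> y" for x y
      using bcr_move(1)[OF G(1) zw(2) ne, of "{x, y}"] that M G(2,3) by simp_all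
    have stuD: "stu_edge (?D x y) e b" "stu_edge (?D x y) e' b'" "att (?D x y) (e, \<not> b) = (if ?h \<in> {x, y} then w else t)"
      "att (?D x y) (e', \<not> b') = (if ?h' \<in> {x, y} then w else t)" for x y
    proof -
      have a: "att (?D x y) (e, b) = att G (e, b)" "att (?D x y) (e', b') = att G (e', b')"
        using E(4) E'(4) ne fe by (auto simp: att_resplit internal_def)
      show a': "att (?D x y) (e, \<not> b) = (if ?h \<in> {x, y} then w else t)"
        "att (?D x y) (e', \<not> b') = (if ?h' \<in> {x, y} then w else t)"
        using fe zw(1) t_def w_def eq by (auto simp: att_resplit)
      show "stu_edge (?D x y) e b" "stu_edge (?D x y) e' b'"
        unfolding stu_edge_def a a' using E(1,4,5) E'(1,4,5) int by auto
    qed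
    have triv: "?s G d a = ?s (?D ?h ?h') d a" if d: "stu_edge G d a" for d a
    proof -
      have "is_iso id_map G (?D ?h ?h')"
        by (rule iso_move_trivial[OF G(1) zw(2) ne(2,3,1)]) (use zw(1) dw z fe in auto)
      then have i: "is_iso (id, id, \<lambda>_. False) G (?D ?h ?h')" by (simp only: id_map_def)
      have s: "{?h, ?h'} \<subseteq> {?h, ?h', q, r}" by blast
      have "?s G d a = of_int (change_sign id_map G c c) * ?s (?D ?h ?h') (id d) (a \<noteq> False)"
        unfolding id_map_def
        by (rule stu_sum_transport[OF G(1) D(1)[OF s dist(3)] G(2) D(2)[OF s dist(3)] i G(3) d])
      then show ?thesis using change_sign_refl[OF G(2)] by simp
    qed
    have compl: "?s (?D x y) d a = ?s (?D x' y') d a"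
      if xy: "{x, y} \<union> {x', y'} = {?h, ?h', q, r}" "{x, y} \<inter> {x', y'} = {}" "x \<noteq> y" "x' \<noteq> y'"
        and d: "stu_edge (?D x y) d a" "d \<noteq> f" for x y x' y' d a
    proof -
      let ?f = "(transpose (att G (f, \<gamma>)) (att G (f, \<not> \<gamma>)), id, \<lambda>x. x = f)"
      have iso: "is_iso ?f (?D x y) (?D x' y')"
        using xy by (intro iso_move_complement[OF G(1) zw(2) ne(2,3)]) (simp_all only: M)
      have sub: "{x, y} \<subseteq> {?h, ?h', q, r}" "{x', y'} \<subseteq> {?h, ?h', q, r}" using xy(1) by blast+
      have "?s (?D x y) d a = of_int (change_sign ?f (?D x y) c c) * ?s (?D x' y') (id d) (a \<noteq> (d = f))"
        by (rule stu_sum_transport[OF D(1)[OF sub(1) xy(3)] D(1)[OF sub(2) xy(4)] D(2)[OF sub(1) xy(3)]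
            D(2)[OF sub(2) xy(4)] iso D(3)[OF sub(1) xy(3)] d(1)])
      moreover have "change_sign ?f (?D x y) c c = 1"
        using bcrD(2,3)[OF G(1)] G(2) zw(3) ne(1) bcrD(6)[OF G(1) zw(3)]
        by (intro change_sign_exchange_ends[of _ k]) auto
      ultimately show ?thesis using d(2) by simp
    qed
    \<comment> \<open>In these terms \<open>e\<close> is at \<open>w\<close> and \<open>e'\<close>
      at \<open>t\<close>, so the two resolutions commute.\<close>
    have comm: "?s (?D ?h x) e b = ?s (?D ?h x) e' b'" if "x \<in> {q, r}" for x
    proof -
      have s: "{?h, x} \<subseteq> {?h, ?h', q, r}" "?h \<noteq> x" using that dist by auto
      show ?thesis
        by (rule stu_sum_commute[OF D[OF s] stuD(1,2)]) (use that dist tw in \<open>auto simp: stuD(3,4)\<close>)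
    qed
    \<comment> \<open>Complementary pairs of half-edges match the remaining terms of the second
      identity with those of the first.\<close>
    have c1: "?s (?D ?h q) e' b' = ?s (?D ?h' r) e' b'" "?s (?D ?h r) e' b' = ?s (?D ?h' q) e' b'"
      using dist qr(2) fe(2) by (intro compl stuD; auto)+
    have hh: "?s (?D ?h' ?h) e' b' = ?s (?D ?h ?h') e' b'" by (simp add: insert_commute)
    have "?s (?D ?h ?h') e b + (?s (?D ?h q) e b + ?s (?D ?h r) e b) = 0"
      "?s (?D ?h' ?h) e' b' + (?s (?D ?h' q) e' b' + ?s (?D ?h' r) e' b') = 0"
      using J dist qr(2) by simp_all
    then show ?thesis using triv[OF e] triv[OF e'(1)] comm[of q] comm[of r] c1 hh by simp
  qed
qed

lemma stu_sum_unique: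
  assumes G: "bcr_graph G" "is_coloring k G c" "card (internal G) \<le> Suc n"
    and one: "\<And>e b e' b'. card (internal G) = 1 \<Longrightarrow> stu_edge G e b \<Longrightarrow> stu_edge G e' b' \<Longrightarrow> e \<noteq> e' \<Longrightarrow>
      stu_sum (\<lambda>H. W (H, c)) G e b = stu_sum (\<lambda>H. W (H, c)) G e' b'"
    and e: "stu_edge G e b" "stu_edge G e' b'"
  shows "stu_sum (\<lambda>H. W (H, c)) G e b = stu_sum (\<lambda>H. W (H, c)) G e' b'"
proof (cases "e = e'")
  case True
  then have "b = b'" using e by (cases b; cases b') (auto simp: stu_edge_def internal_def)
  then show ?thesis using True by simp
next
  case False
  have "internal G \<noteq> {}" using e(1) by (auto simp: stu_edge_def)
  then have "card (internal G) \<noteq> 0" using finite_at(3)[OF G(1)] by simp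
  then consider "card (internal G) = 1" | "2 \<le> card (internal G)" by linarith
  then show ?thesis
  proof cases
    case 1
    then show ?thesis using one e False by blast
  next
    case 2
    then show ?thesis
      using stu_sum_same_vertex[OF G 2 e False] stu_sum_commute[OF G e] by blast
  qed
qed

end

section \<open>Extension of weights from chord diagrams\<close>

text \<open>Merging the two ends forgets how their half-edges were distributed. If the new edge is
  solid, its ends are external, so the merged vertex of \<open>G\<close> has to be external as well;
  hence the assumption for \<open>s\<close>.\<close>

lemma contract_iso_resplit:
  assumes "e \<notin> solid G" "att G (e, False) \<noteq> att G (e, True)"
    "s \<Longrightarrow> att G (e, False) \<in> ext G \<or> att G (e, True) \<in> ext G"
  shows "is_iso id_map (contract G e) (contract (resplit s G e b P) e)"
proof -
  let ?m = "att G (e, False)" and ?q = "att G (e, True)" and ?H = "resplit s G e b P"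
  have end_set: "{att G (e, b), att G (e, \<not> b)} = {?m, ?q}" by (cases b) auto
  have x: "ext ?H = (if s then insert ?m (insert ?q (ext G)) else ext G)" by (cases b) auto
  have 1: "ext (contract ?H e) = ext (contract G e)"
    using assms(2,3) unfolding contract_def Let_def graph.simps resplit_simps(7) x by auto
  have 2: "solid (contract ?H e) = solid (contract G e)" by (auto simp: contract_def Let_def)
  have 3: "att (contract ?H e) h = att (contract G e) h" if h: "fst h \<noteq> e" for h
  proof -
    have "att ?H h = att G h \<or> att G h \<in> {?m, ?q} \<and> att ?H h \<in> {?m, ?q}"
      unfolding att_resplit end_set using end_set by auto
    then show ?thesis by (auto simp: contract_def Let_def)
  qed
  have 4: "verts (contract ?H e) = verts (contract G e)" "edges (contract ?H e) = edges (contract G e)"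
    by (simp_all add: contract_def Let_def)
  have 5: "\<forall>x \<in> edges (contract G e). x \<noteq> e" by (simp add: contract_def Let_def)
  show ?thesis unfolding id_map_def is_iso.simps 1 2 4 using 3 5 by simp
qed

lemma same_contraction_resplit:
  assumes G: "finite (verts G)" "finite (edges G)" "e \<in> edges G" "e \<notin> solid G"
      "att G (e, False) \<in> verts G" "att G (e, True) \<in> verts G"
      "att G (e, False) \<noteq> att G (e, True)"
    and s: "s \<Longrightarrow> att G (e, False) \<in> ext G \<or> att G (e, True) \<in> ext G"
    and c: "is_coloring k G c"
  shows "same_contraction k e (G, c) (resplit s G e b P, c)"
  using contract_iso_resplit[OF G(4,7) s]
  by (intro same_contraction_same_coloring[OF G(1-3,5-7) _ _ _ c]) simp_all

lemma stu_edge_loopless: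
  assumes "bcr_graph G" "stu_edge G e b"
  shows "att G (e, False) \<noteq> att G (e, True)" "att G (e, False) \<in> verts G" "att G (e, True) \<in> verts G"
    "att G (e, False) \<in> ext G \<or> att G (e, True) \<in> ext G"
  using stu_edgeD(4,7-9)[OF assms] by (cases b; auto)+

text \<open>\<open>reexpand\<close> always leaves the chosen half-edges at
  \<open>(e, False)\<close>, and this may be the internal end of \<open>e\<close>. The term is then
  the complementary distribution seen from the external end.\<close>

lemma split_either_end:
  assumes G: "bcr_graph G" "stu_edge G e b" and A: "A \<in> balanced (solid_at G (att G (e, b)))"
    and xy: "dashed_at G (att G (e, \<not> b)) - {(e, \<not> b)} = {x, y}" "x \<noteq> y"
  shows "bcr_graph (resplit True G e d (insert x A))"
    "card (internal (resplit True G e d (insert x A))) = card (internal G) - 1"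
proof -
  let ?S = "solid_at G (att G (e, b))"
  have AS: "A \<subseteq> ?S" using A by (simp add: balanced_def)
  have A': "?S - A \<in> balanced ?S" using A by (auto simp: balanced_def double_diff)
  have p: "(A, x) \<in> stu_pairs G e b" "(?S - A, y) \<in> stu_pairs G e b"
    using A A' xy by (auto simp: stu_pairs_def)
  note H = stu_pairs_bcr(1,3)[OF G p(1), simplified fst_conv snd_conv]
  note H' = stu_pairs_bcr(1)[OF G p(2), simplified fst_conv snd_conv]
  have "bcr_graph (resplit True G e (\<not> b) (insert x A))"
    by (rule bcr_cong[OF H'])
      (use att_split_complement[OF G AS xy] in \<open>simp_all add: insert_commute\<close>)
  then show "bcr_graph (resplit True G e d (insert x A))" using H(1) by (cases "d = b") auto
  have "internal (resplit True G e (\<not> b) (insert x A)) = internal (resplit True G e b (insert x A))"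
    by (simp add: insert_commute)
  then show "card (internal (resplit True G e d (insert x A))) = card (internal G) - 1"
    using H(2) by (cases "d = b") auto
qed

lemma exists_stu_edge_internal:
  assumes "bcr_graph G" "internal G \<noteq> {}"
  shows "\<exists>e b. stu_edge G e b"
proof (rule exists_stu_edge[OF assms order_refl])
  show "att G (d, \<not> a) \<in> internal G \<union> ext G" if "d \<in> dashed G" for d a
    using bcrD(6)[OF assms(1)] that by (simp add: internal_def dashed_def)
qed blast

lemma stu_edge_pair:
  assumes "bcr_graph G" "stu_edge G e b"
  obtains x y where "dashed_at G (att G (e, \<not> b)) - {(e, \<not> b)} = {x, y}" "x \<noteq> y"
  using stu_edgeD(13)[OF assms] by (metis card_2_iff)

section \<open>Linear functionals on formal sums\<close>

definition lin :: "('a \<Rightarrow> rat) \<Rightarrow> ('a \<Rightarrow>\<^sub>0 rat) \<Rightarrow> rat" where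
  "lin W x = (\<Sum>a\<in>Poly_Mapping.keys x. Poly_Mapping.lookup x a * W a)"

lemma lin_superset:
  assumes "finite S" "Poly_Mapping.keys x \<subseteq> S"
  shows "lin W x = (\<Sum>a\<in>S. Poly_Mapping.lookup x a * W a)"
  unfolding lin_def using assms by (intro sum.mono_neutral_left) (auto simp: in_keys_iff)

lemma lin_add: "lin W (x + y) = lin W x + lin W y"
proof -
  let ?S = "Poly_Mapping.keys x \<union> Poly_Mapping.keys y"
  have "Poly_Mapping.keys (x + y) \<subseteq> ?S" by (rule keys_add)
  then show ?thesis using lin_superset[of ?S]
    by (simp add: lookup_add sum.distrib distrib_right)
qed

lemma lin_scale: "lin W (qscale r x) = r * lin W x"
proof -
  have "Poly_Mapping.keys (qscale r x) \<subseteq> Poly_Mapping.keys x" by (auto simp: in_keys_iff)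
  then have "lin W (qscale r x) =
      (\<Sum>a\<in>Poly_Mapping.keys x. Poly_Mapping.lookup (qscale r x) a * W a)"
    by (intro lin_superset) auto
  also have "\<dots> = r * lin W x" by (simp add: lin_def sum_distrib_left mult.assoc)
  finally show ?thesis .
qed

lemma lin_uminus: "lin W (- x) = - lin W x"
  using lin_add[of W x "- x"] by (simp add: lin_def)

lemma lin_diff: "lin W (x - y) = lin W x - lin W y"
  using lin_add[of W x "- y"] by (simp add: lin_uminus)

lemma lin_gen: "lin W (gen X) = W X"
  by (simp add: lin_def gen_def)

lemmas lin_simps = lin_add lin_scale lin_uminus lin_diff lin_gen

lemma lin_cong: "(\<And>a. a \<in> Poly_Mapping.keys x \<Longrightarrow> W a = W' a) \<Longrightarrow> lin W x = lin W' x"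
  by (simp add: lin_def)

lemma lin_span:
  assumes "\<And>x. x \<in> R \<Longrightarrow> lin W x = 0" "x \<in> qvs.span R"
  shows "lin W x = 0"
  using assms(2) by (induction rule: qvs.span_induct_alt) (simp_all add: lin_simps assms(1), simp add: lin_def)

text \<open>All terms are given the coloring \<open>c\<close> of the resolved graph, which is
  admissible by \<open>same_contraction_resplit\<close>. The bound on the keys drives the induction
  that reduces graphs to chord diagrams.\<close>

lemma stu_exists:
  assumes G: "bcr_graph G" "is_coloring k G c" and e: "stu_edge G e b"
  shows "\<exists>H. stu k (G, c) e H \<and>
    Poly_Mapping.keys H \<subseteq> {X \<in> colored_bcr k. card (internal (fst X)) < card (internal G)}"
proof -
  obtain x y where xy: "dashed_at G (att G (e, \<not> b)) - {(e, \<not> b)} = {x, y}" "x \<noteq> y"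
    by (rule stu_edge_pair[OF G(1) e])
  note D = stu_edgeD[OF G(1) e] and L = stu_edge_loopless[OF G(1) e]
  have yx: "dashed_at G (att G (e, \<not> b)) - {(e, \<not> b)} = {y, x}" "y \<noteq> x" using xy by auto
  let ?S = "solid_at G (att G (e, b))"
  let ?T = "\<lambda>P. (resplit True G e False P, c)"
  have "card (internal G) > 0" using D(5) finite_at(3)[OF G(1)] card_gt_0_iff by blast
  then have T: "?T (insert z A) \<in> colored_bcr k" "card (internal (fst (?T (insert z A)))) < card (internal G)"
    if "A \<in> balanced ?S" "z \<in> {x, y}" for z A
    using split_either_end[OF G(1) e that(1) xy, of False] split_either_end[OF G(1) e that(1) yx, of False]
      that(2) G(2) by (auto simp: colored_bcr_def)
  have re: "reexpand G e True True P = resplit True G e False P" for P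
    by (rule reexpand_eq_resplit(1)[OF L(1-3) D(1) L(4)])
  have sc: "same_contraction k e (G, c) (?T P)" for P
    using L bcrD(2,3)[OF G(1)] D(2,3) G(2) by (intro same_contraction_resplit)
  have Gc: "(G, c) \<in> colored_bcr k" using G by (simp add: colored_bcr_def)
  show ?thesis
  proof (cases "?S = {}")
    case True
    have "stu k (G, c) e (- gen (?T {x}))"
      by (rule stu.no_solid[OF Gc D(1) refl refl D(4,5) xy True, of _ c])
        (use T(1)[of "{}" x] True sc re in \<open>simp_all del: same_contraction.simps\<close>)
    moreover have "Poly_Mapping.keys (- gen (?T {x})) \<subseteq> {?T {x}}" by (simp add: gen_def)
    moreover have "{?T {x}} \<subseteq> {X \<in> colored_bcr k. card (internal (fst X)) < card (internal G)}"
      using T[of "{}" x] True by (simp del: resplit_simps)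
    ultimately show ?thesis by (intro exI conjI) (assumption, rule subset_trans)
  next
    case False
    then obtain a where a: "a \<in> ?S" by blast
    have bal: "{a} \<in> balanced ?S"
      using balanced_mem[OF finite_at(2)[OF G(1)] bcrD(12)[OF G(1) D(4)] a] by simp
    have "stu k (G, c) e (- gen (?T {a, x}) - gen (?T {a, y}))"
      by (rule stu.solid[OF Gc D(1) refl refl D(4,5) xy a, of _ c _ c])
        (use T(1)[OF bal, of x] T(1)[OF bal, of y] sc re in
          \<open>simp_all add: insert_commute del: same_contraction.simps\<close>)
    moreover have "Poly_Mapping.keys (- gen (?T {a, x}) - gen (?T {a, y})) \<subseteq> {?T {a, x}, ?T {a, y}}"
      using keys_diff[of "- gen (?T {a, x})" "gen (?T {a, y})"] by (auto simp: gen_def)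
    moreover have "{?T {a, x}, ?T {a, y}} \<subseteq> {X \<in> colored_bcr k. card (internal (fst X)) < card (internal G)}"
      using T[OF bal, of x] T[OF bal, of y] by (simp add: insert_commute del: resplit_simps)
    ultimately show ?thesis by (intro exI conjI) (assumption, rule subset_trans)
  qed
qed

context weight
begin

text \<open>The colorings \<open>c\<close> and \<open>c'\<close> differ by an even change. So every
  term of a relation can be evaluated with the coloring of the first graph.\<close>

lemma weight_same_contraction:
  assumes H: "bcr_graph H" "bcr_graph H'" "verts H' = verts H" "edges H' = edges H"
      "\<And>b. att H' (e, b) = att H (e, b)"
    and e: "e \<in> edges H" "att H (e, False) \<noteq> att H (e, True)"
    and c: "is_coloring k H c" "is_coloring k H' c'" "card (internal H') \<le> n"
    and sc: "same_contraction k e (H, c) (H', c')"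
  shows "W (H', c') = W (H', c)"
proof -
  have "change_sign id_map H c c' = 1"
    by (rule same_contraction_change_sign[OF bcrD(2,3)[OF H(1)] e(1) bcrD(6)[OF H(1) e(1)]
      bcrD(6)[OF H(1) e(1)] e(2) H(3-5) c(1,2) sc])
  then have s: "change_sign id_map H' c c' = 1" using change_sign_cong[OF H(3,4)] by simp
  have "is_coloring k H' c" using c(1) is_coloring_cong[OF H(3,4)] by simp
  moreover have "is_iso id_map H' H'" by (simp add: id_map_def)
  ultimately have "W (H', c) = of_int (change_sign id_map H' c c') * W (H', c')"
    using orientD[OF H(2,2) _ c(2) _ c(3)] by blast
  then show ?thesis using s by simp
qed

lemma weight_either_end:
  assumes G: "bcr_graph G" "is_coloring k G c" "card (internal G) \<le> Suc n" "stu_edge G e b"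
    and A: "A \<in> balanced (solid_at G (att G (e, b)))"
    and xy: "dashed_at G (att G (e, \<not> b)) - {(e, \<not> b)} = {x, y}" "x \<noteq> y"
  shows "W (resplit True G e d (insert x A), c) = W (resplit True G e b (insert x A), c)"
proof (cases "d = b")
  case False
  then have d: "d = (\<not> b)" by simp
  let ?S = "solid_at G (att G (e, b))"
  have AS: "A \<subseteq> ?S" using A by (simp add: balanced_def)
  have A': "?S - A \<in> balanced ?S" using A by (auto simp: balanced_def double_diff)
  have yx: "dashed_at G (att G (e, \<not> b)) - {(e, \<not> b)} = {y, x}" "y \<noteq> x" using xy by auto
  have "W (resplit True G e (\<not> b) (insert x A), c) = W (resplit True G e b (insert y (?S - A)), c)"
    by (rule weight_cong[OF split_either_end(1)[OF G(1,4) A xy] split_either_end(1)[OF G(1,4) A' yx]])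
      (use G(2,3) split_either_end(2)[OF G(1,4) A xy, of "\<not> b"] att_split_complement[OF G(1,4) AS xy]
        in \<open>simp_all add: insert_commute\<close>)
  then show ?thesis unfolding d using stu_swap[OF G A xy] by simp
qed simp

text \<open>A relation given by \<open>stu\<close> involves choices of colorings and of half-edges,
  while the doubled sum is free of them. This is the bridge from the relations to the computations
  with sums.\<close>

lemma stu_value:
  assumes "stu k (G, c) e H" "stu_edge G e b" "card (internal G) \<le> Suc n"
  shows "2 * lin W H = - stu_sum (\<lambda>H. W (H, c)) G e b"
proof -
  \<comment> \<open>Only one end of \<open>e\<close> is external, so the half-edge in the relation
    is the one in \<open>stu_edge\<close>.\<close>
  have same: "b' = b" if "att G (e, b') \<in> ext G" for b'
    using that assms(2) by (cases "b' = b") (auto simp: stu_edge_def internal_def)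
  have val: "W (reexpand G e True True (insert x A), cT) = W (resplit True G e b (insert x A), c)"
    if G: "(G, c) \<in> colored_bcr k" and A: "A \<in> balanced (solid_at G (att G (e, b)))"
      and xy: "dashed_at G (att G (e, \<not> b)) - {(e, \<not> b)} = {x, y}" "x \<noteq> y"
      and T: "(reexpand G e True True (insert x A), cT) \<in> colored_bcr k"
        "same_contraction k e (G, c) (reexpand G e True True (insert x A), cT)" for A x y cT
  proof -
    have G': "bcr_graph G" "is_coloring k G c" using G by (auto simp: colored_bcr_def)
    note D = stu_edgeD[OF G'(1) assms(2)] and L = stu_edge_loopless[OF G'(1) assms(2)]
    have re: "reexpand G e True True (insert x A) = resplit True G e False (insert x A)"
      by (rule reexpand_eq_resplit(1)[OF L(1-3) D(1) L(4)])
    note s = split_either_end[OF G'(1) assms(2) A xy, of False]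
    have "W (resplit True G e False (insert x A), cT) = W (resplit True G e False (insert x A), c)"
      by (rule weight_same_contraction[OF G'(1) s(1) _ _ _ D(2) L(1) G'(2)])
        (use T s(2) assms(3) in \<open>simp_all add: re colored_bcr_def\<close>)
    then show ?thesis unfolding re using weight_either_end[OF G' assms(3,2) A xy] by simp
  qed
  from assms(1) show ?thesis
  proof cases
    case (solid v b' w x y a T cT U cU)
    have b: "b' = b" using same solid by blast
    have G: "bcr_graph G" "is_coloring k G c" using solid(2) by (auto simp: colored_bcr_def)
    have a: "a \<in> solid_at G (att G (e, b))" and xy: "dashed_at G (att G (e, \<not> b)) - {(e, \<not> b)} = {x, y}"
      "x \<noteq> y" using solid b by simp_all
    then have yx: "dashed_at G (att G (e, \<not> b)) - {(e, \<not> b)} = {y, x}" "y \<noteq> x" by auto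
    have bal: "{a} \<in> balanced (solid_at G (att G (e, b)))"
      using balanced_mem[OF finite_at(2)[OF G(1)] bcrD(12)[OF G(1)] a] assms(2)
      by (simp add: stu_edge_def)
    have "W T = W (resplit True G e b (insert x {a}), c)"
      unfolding solid(11) using val[OF solid(2) bal xy] solid(11,13,14) by (simp add: insert_commute)
    moreover have "W U = W (resplit True G e b (insert y {a}), c)"
      unfolding solid(12) using val[OF solid(2) bal yx] solid(12,13,15) by (simp add: insert_commute)
    ultimately show ?thesis using stu_sum_solid[OF G assms(3,2) a xy, of "{a}"] solid(1)
      by (simp add: lin_simps)
  next
    case (no_solid v b' w x y T cT)
    have b: "b' = b" using same no_solid by blast
    have G: "bcr_graph G" "is_coloring k G c" using no_solid(2) by (auto simp: colored_bcr_def)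
    have a: "solid_at G (att G (e, b)) = {}" and xy: "dashed_at G (att G (e, \<not> b)) - {(e, \<not> b)} = {x, y}"
      "x \<noteq> y" using no_solid b by simp_all
    have "W T = W (resplit True G e b (insert x {}), c)"
      unfolding no_solid(11) using no_solid(11-13) by (intro val[OF no_solid(2) _ xy]) (simp_all add: a)
    then show ?thesis using stu_sum_no_solid[OF G assms(3,2) a xy] no_solid(1)
      by (simp add: lin_simps)
  qed
qed

end

text \<open>One STU relation at an arbitrarily chosen edge, solved for the value of the graph; the
  division by 2 undoes the double counting in \<open>stu_sum\<close>. The stage \<open>n\<close> is
  meant for graphs with at most \<open>n\<close> internal vertices, and later stages keep the values
  of earlier ones there.\<close>

primrec wt :: "(colored_graph \<Rightarrow> rat) \<Rightarrow> nat \<Rightarrow> colored_graph \<Rightarrow> rat" where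
  "wt W 0 X = W X"
| "wt W (Suc n) X = (if card (internal (fst X)) \<le> n then wt W n X
     else let p = SOME p. stu_edge (fst X) (fst p) (snd p)
       in - stu_sum (\<lambda>H. wt W n (H, snd X)) (fst X) (fst p) (snd p) / 2)"

lemma weight_wt:
  assumes orient: "orient_inv k 0 W"
    and four_term: "\<And>G c e b e' b'. bcr_graph G \<Longrightarrow> is_coloring k G c \<Longrightarrow> card (internal G) = 1 \<Longrightarrow>
      stu_edge G e b \<Longrightarrow> stu_edge G e' b' \<Longrightarrow> e \<noteq> e' \<Longrightarrow>
      stu_sum (\<lambda>H. W (H, c)) G e b = stu_sum (\<lambda>H. W (H, c)) G e' b'"
  shows "weight k n (wt W n)"
proof (induction n)
  case 0
  have "wt W 0 = W" by (rule ext) simp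
  moreover have "stu_inv k 0 W" unfolding stu_inv_def
  proof (intro allI impI)
    fix G c e b
    assume "bcr_graph G" "card (internal G) \<le> 0" "stu_edge G e b"
    then show "2 * W (G, c) = - stu_sum (\<lambda>H. W (H, c)) G e b"
      using finite_at(3)[of G] by (auto simp: stu_edge_def)
  qed
  ultimately show ?case using orient by unfold_locales simp_all
next
  case (Suc n)
  interpret weight k n "wt W n" by (rule Suc)
  have low: "wt W (Suc n) (G, c) = wt W n (G, c)" if "card (internal G) \<le> n" for G c
    using that by simp
  have sums: "stu_sum (\<lambda>H. wt W (Suc n) (H, c)) G e b = stu_sum (\<lambda>H. wt W n (H, c)) G e b"
    if "bcr_graph G" "card (internal G) \<le> Suc n" "stu_edge G e b" for G c e b
    unfolding stu_sum_def
    by (intro sum.cong refl low) (use stu_pairs_bcr(3)[OF that(1,3)] that(2) in simp)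
  have val: "2 * wt W (Suc n) (G, c) = - stu_sum (\<lambda>H. wt W n (H, c)) G e b"
    if G: "bcr_graph G" "is_coloring k G c" "card (internal G) = Suc n" "stu_edge G e b" for G c e b
  proof -
    define p where "p = (SOME p. stu_edge G (fst p) (snd p))"
    have p: "stu_edge G (fst p) (snd p)" unfolding p_def
      using G(4) by (intro someI[of "\<lambda>p. stu_edge G (fst p) (snd p)" "(e, b)"]) simp
    have "stu_sum (\<lambda>H. wt W n (H, c)) G (fst p) (snd p) = stu_sum (\<lambda>H. wt W n (H, c)) G e b"
    proof (rule stu_sum_unique[OF G(1,2) _ _ p G(4)])
      fix e b e' b'
      assume a: "card (internal G) = 1" "stu_edge G e b" "stu_edge G e' b'" "e \<noteq> e'"
      \<comment> \<open>With a single internal vertex the terms are chord diagrams and are evaluated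
        by \<open>W\<close> itself, so the 4T relations are the induction base for the independence
        of the edge.\<close>
      have n: "n = 0" using a(1) G(3) by simp
      show "stu_sum (\<lambda>H. wt W n (H, c)) G e b = stu_sum (\<lambda>H. wt W n (H, c)) G e' b'"
        unfolding n wt.simps(1) by (rule four_term[OF G(1,2) a])
    qed (use G(3) in simp)
    then show ?thesis using G(3) by (simp add: p_def[symmetric] Let_def)
  qed
  have "orient_inv k (Suc n) (wt W (Suc n))" unfolding orient_inv_def
  proof (intro allI impI)
    fix f G c G' c'
    assume G: "bcr_graph G" "bcr_graph G'" "is_coloring k G c" "is_coloring k G' c'" "is_iso f G G'"
      "card (internal G) \<le> Suc n"
    obtain fV fE fl where f: "f = (fV, fE, fl)" by (metis prod_cases3)
    have c': "card (internal G') = card (internal G)" using iso_card_internal G(1,2,5) f by blast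
    show "wt W (Suc n) (G, c) = of_int (change_sign f G c c') * wt W (Suc n) (G', c')"
    proof (cases "card (internal G) \<le> n")
      case True
      show ?thesis unfolding low[OF True] low[OF True[folded c']] by (rule orientD[OF G(1-5) True])
    next
      case False
      then have n: "card (internal G) = Suc n" using G(6) by simp
      then have "internal G \<noteq> {}" by auto
      then obtain e b where e: "stu_edge G e b" using exists_stu_edge_internal[OF G(1)] by blast
      have "2 * wt W (Suc n) (G, c) = - stu_sum (\<lambda>H. wt W n (H, c)) G e b"
        by (rule val[OF G(1,3) n e])
      also have "stu_sum (\<lambda>H. wt W n (H, c)) G e b = of_int (change_sign f G c c') *
          stu_sum (\<lambda>H. wt W n (H, c')) G' (fE e) (b \<noteq> fl e)"
        using stu_sum_transport[OF G(1-4) G(5)[unfolded f] G(6) e] f by simp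
      also have "stu_sum (\<lambda>H. wt W n (H, c')) G' (fE e) (b \<noteq> fl e) = - (2 * wt W (Suc n) (G', c'))"
        using val[OF G(2,4) n[folded c'] iso_stu_edge(1)[OF G(1,2) G(5)[unfolded f] e]] by simp
      finally show ?thesis by simp
    qed
  qed
  moreover have "stu_inv k (Suc n) (wt W (Suc n))" unfolding stu_inv_def
  proof (intro allI impI)
    fix G c e b
    assume G: "bcr_graph G" "is_coloring k G c" "card (internal G) \<le> Suc n" "stu_edge G e b"
    show "2 * wt W (Suc n) (G, c) = - stu_sum (\<lambda>H. wt W (Suc n) (H, c)) G e b"
      unfolding sums[OF G(1,3,4)]
    proof (cases "card (internal G) \<le> n")
      case True
      then show "2 * wt W (Suc n) (G, c) = - stu_sum (\<lambda>H. wt W n (H, c)) G e b"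
        unfolding low[OF True] by (intro stuD G)
    next
      case False
      then show "2 * wt W (Suc n) (G, c) = - stu_sum (\<lambda>H. wt W n (H, c)) G e b"
        using G by (intro val) auto
    qed
  qed
  ultimately show ?case by unfold_locales
qed

text \<open>The stages \<open>wt W n\<close> agree wherever \<open>n\<close> bounds the number of
  internal vertices. Taking this number itself for \<open>n\<close> glues them to a single
  functional that is a weight for every bound.\<close>

lemma weight_extension:
  assumes orient: "orient_inv k 0 W"
    and four_term: "\<And>G c e b e' b'. bcr_graph G \<Longrightarrow> is_coloring k G c \<Longrightarrow> card (internal G) = 1 \<Longrightarrow>
      stu_edge G e b \<Longrightarrow> stu_edge G e' b' \<Longrightarrow> e \<noteq> e' \<Longrightarrow>
      stu_sum (\<lambda>H. W (H, c)) G e b = stu_sum (\<lambda>H. W (H, c)) G e' b'"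
  obtains W' where "\<And>n. weight k n W'" "\<And>G c. internal G = {} \<Longrightarrow> W' (G, c) = W (G, c)"
proof
  define W' where "W' X = wt W (card (internal (fst X))) X" for X
  have agree: "wt W n (G, c) = W' (G, c)" if "card (internal G) \<le> n" for n G c
    using that by (induction n) (auto simp: W'_def le_Suc_eq)
  show "W' (G, c) = W (G, c)" if "internal G = {}" for G c using that by (simp add: W'_def)
  show "weight k n W'" for n
  proof -
    interpret weight k n "wt W n" by (rule weight_wt[OF assms])
    show ?thesis
    proof
      show "orient_inv k n W'" unfolding orient_inv_def
      proof (intro allI impI)
        fix f G c G' c'
        assume G: "bcr_graph G" "bcr_graph G'" "is_coloring k G c" "is_coloring k G' c'" "is_iso f G G'"
          "card (internal G) \<le> n"
        obtain fV fE fl where f: "f = (fV, fE, fl)" by (metis prod_cases3)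
        have c': "card (internal G') = card (internal G)" using iso_card_internal G(1,2,5) f by blast
        show "W' (G, c) = of_int (change_sign f G c c') * W' (G', c')"
          using orientD[OF G] agree[OF G(6)] agree[of G' n c'] c' G(6) by simp
      qed
      show "stu_inv k n W'" unfolding stu_inv_def
      proof (intro allI impI)
        fix G c e b
        assume G: "bcr_graph G" "is_coloring k G c" "card (internal G) \<le> n" "stu_edge G e b"
        have "stu_sum (\<lambda>H. W' (H, c)) G e b = stu_sum (\<lambda>H. wt W n (H, c)) G e b"
          unfolding stu_sum_def
          by (intro sum.cong refl agree[symmetric]) (use stu_pairs_bcr(3)[OF G(1,4)] G(3) in simp)
        then show "2 * W' (G, c) = - stu_sum (\<lambda>H. W' (H, c)) G e b"
          using stuD[OF G] agree[OF G(3)] by simp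
      qed
    qed
  qed
qed

section \<open>The IHX and chord relations\<close>

text \<open>A parity condition replaces cycles, because it is easily compared before and after a
  contraction.\<close>

definition even_set :: "graph \<Rightarrow> nat set \<Rightarrow> bool" where
  "even_set G F \<longleftrightarrow> F \<noteq> {} \<and> F \<subseteq> solid G \<and> (\<forall>v. even (card {h \<in> F \<times> UNIV. att G h = v}))"

text \<open>Along the cycle, every visit to \<open>z\<close> is counted once as first and once as
  second end of an edge. The two counts are sums that differ by a cyclic shift of the index.\<close>

lemma solid_cycle_even_set:
  assumes "has_solid_cycle G"
  shows "\<exists>F. even_set G F"
proof -
  obtain vs es where c: "vs \<noteq> []" "distinct es" "length es = length vs" "set es \<subseteq> solid G"
    "\<And>i. i < length vs \<Longrightarrow> joins G (es ! i) (vs ! i) (vs ! (Suc i mod length vs))"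
    using assms unfolding has_solid_cycle_def by blast
  have "even (card {h \<in> set es \<times> UNIV. att G h = z})" for z
  proof -
    let ?f = "\<lambda>i. of_bool (vs ! i = z) :: nat"
    let ?B = "\<lambda>e. {b. att G (e, b) = z}"
    obtain m where m: "length vs = Suc m" using c(1) by (cases vs) auto
    have deg: "card (?B e) = of_bool (x = z) + of_bool (y = z)" if xy: "joins G e x y" for e x y
    proof -
      obtain b where b: "att G (e, b) = x" "att G (e, \<not> b) = y" using xy by (auto simp: joins_def)
      have "?B e = (if x = z then {b} else {}) \<union> (if y = z then {\<not> b} else {})"
      proof (rule set_eqI)
        fix a show "a \<in> ?B e \<longleftrightarrow> a \<in> (if x = z then {b} else {}) \<union> (if y = z then {\<not> b} else {})"
          using b by (cases "a = b") auto
      qed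
      then show ?thesis by simp
    qed
    have "{h \<in> set es \<times> UNIV. att G h = z} = Sigma (set es) ?B" by auto
    then have "card {h \<in> set es \<times> UNIV. att G h = z} = (\<Sum>e\<in>set es. card (?B e))" by simp
    also have "\<dots> = (\<Sum>i<length es. card (?B (es ! i)))"
      by (rule sum.reindex_bij_betw[symmetric]) (rule bij_betw_nth[OF c(2) refl refl])
    also have "\<dots> = (\<Sum>i<Suc m. ?f i + ?f (Suc i mod Suc m))"
    proof (rule sum.cong)
      fix i assume "i \<in> {..<Suc m}"
      then show "card (?B (es ! i)) = ?f i + ?f (Suc i mod Suc m)"
        using deg[OF c(5)[of i]] m by simp
    qed (simp add: c(3) m)
    also have "\<dots> = (\<Sum>i<Suc m. ?f i) + (\<Sum>i<Suc m. ?f (Suc i mod Suc m))" by (rule sum.distrib)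
    also have "(\<Sum>i<Suc m. ?f (Suc i mod Suc m)) = (\<Sum>i<m. ?f (Suc i)) + ?f 0"
      by simp
    also have "\<dots> = (\<Sum>i<Suc m. ?f i)" by (simp only: sum.lessThan_Suc_shift add.commute)
    finally show ?thesis by simp
  qed
  moreover have "set es \<noteq> {}" using c(1,3) by auto
  ultimately show ?thesis using c(4) unfolding even_set_def by blast
qed

text \<open>The first vertex of a broken line that is on an edge of \<open>F\<close> has degree 1 in \<open>F\<close>.\<close>

lemma broken_lines_no_even_set:
  assumes G: "bcr_graph G"
  shows "\<not> even_set G F"
proof
  assume F: "even_set G F"
  obtain Ps where Ps0: "\<forall>(vs, es) \<in> Ps. solid_path G vs es"
    and Ps2: "\<forall>p \<in> Ps. \<forall>q \<in> Ps. p \<noteq> q \<longrightarrow> set (fst p) \<inter> set (fst q) = {}"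
    and Ps3: "(\<Union>p \<in> Ps. set (snd p)) = solid G"
    using bcrD(13)[OF G] unfolding broken_lines_def by (elim exE conjE)
  have edge: "\<exists>vs es j. (vs, es) \<in> Ps \<and> j < length es \<and> es ! j = s" if "s \<in> F" for s
  proof -
    have "s \<in> (\<Union>p \<in> Ps. set (snd p))" using that F unfolding Ps3 even_set_def by blast
    then show ?thesis by (metis UN_E in_set_conv_nth prod.collapse)
  qed
  have path: "distinct vs \<and> length vs = Suc (length es) \<and>
      (\<forall>j < length es. joins G (es ! j) (vs ! j) (vs ! Suc j))" if "(vs, es) \<in> Ps" for vs es
    using Ps0 that unfolding solid_path_def by blast
  obtain s where "s \<in> F" using F by (auto simp: even_set_def)
  then obtain vs es j0 where p: "(vs, es) \<in> Ps" and j0: "j0 < length es \<and> es ! j0 \<in> F" using edge by metis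
  define i where "i = (LEAST j. j < length es \<and> es ! j \<in> F)"
  have i: "i < length es" "es ! i \<in> F" unfolding i_def using LeastI[of "\<lambda>j. j < length es \<and> es ! j \<in> F", OF j0] by blast+
  have least: "i \<le> j" if "j < length es" "es ! j \<in> F" for j
    unfolding i_def using that by (intro Least_le) blast
  note q = path[OF p]
  have "joins G (es ! i) (vs ! i) (vs ! Suc i)" using q i by blast
  then obtain c where c: "att G (es ! i, c) = vs ! i" "att G (es ! i, \<not> c) = vs ! Suc i"
    by (auto simp: joins_def)
  have ne: "vs ! Suc i \<noteq> vs ! i" using q i nth_eq_iff_index_eq[of vs "Suc i" i] by simp
  have "{h \<in> F \<times> UNIV. att G h = vs ! i} = {(es ! i, c)}"
  proof (intro equalityI subsetI)
    fix h assume "h \<in> {h \<in> F \<times> UNIV. att G h = vs ! i}"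
    then obtain s' d where h: "h = (s', d)" "s' \<in> F" "att G (s', d) = vs ! i" by (cases h) auto
    obtain us fs j where u: "(us, fs) \<in> Ps" "j < length fs" "fs ! j = s'" using edge[OF h(2)] by blast
    note q' = path[OF u(1)]
    have "joins G s' (us ! j) (us ! Suc j)" using q' u by blast
    then obtain a where a: "att G (s', a) = us ! j" "att G (s', \<not> a) = us ! Suc j"
      by (auto simp: joins_def)
    have vi: "vs ! i = us ! j \<or> vs ! i = us ! Suc j"
    proof (cases "d = a")
      case False
      then have "d = (\<not> a)" by simp
      then show ?thesis using a h(3) by simp
    qed (use a h(3) in simp)
    then have "vs ! i \<in> set us" using q' u(2) by auto
    moreover have "vs ! i \<in> set vs" using q i(1) by simp
    ultimately have "(us, fs) = (vs, es)" using Ps2 p u(1) by fastforce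
    then have e: "us = vs" "fs = es" by simp_all
    \<comment> \<open>The broken lines are disjoint, so \<open>s'\<close> lies on the same line and
      is the edge just before or just after the vertex \<open>vs ! i\<close>. The choice of
      \<open>i\<close> as least index excludes the former.\<close>
    have "i = j \<or> i = Suc j" using vi q u(2) i(1) unfolding e by (simp add: nth_eq_iff_index_eq)
    moreover have "i \<le> j" using least[of j] u h(2) unfolding e by blast
    ultimately have "s' = es ! i" using u(3) e by simp
    moreover have "d = c" using h(3) c ne \<open>s' = es ! i\<close> by (cases "d = c") auto
    ultimately show "h \<in> {(es ! i, c)}" using h(1) by simp
  qed (use i c in auto)
  moreover have "even (card {h \<in> F \<times> UNIV. att G h = vs ! i})"
    using F unfolding even_set_def by blast
  ultimately show False by simp
qed

lemma even_set_cong: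
  assumes "even_set G F" "solid G = solid H" "\<And>h. fst h \<in> solid G \<Longrightarrow> att H h = att G h"
  shows "even_set H F"
proof -
  have F: "F \<subseteq> solid G" using assms(1) by (simp add: even_set_def)
  have "{h \<in> F \<times> UNIV. att H h = v} = {h \<in> F \<times> UNIV. att G h = v}" for v
  proof (rule Collect_cong)
    fix h show "(h \<in> F \<times> UNIV \<and> att H h = v) = (h \<in> F \<times> UNIV \<and> att G h = v)"
      using assms(3)[of h] F by (cases h) auto
  qed
  then show ?thesis using assms(1,2) by (simp add: even_set_def)
qed

lemma chord_edgeD:
  assumes G: "bcr_graph G" and e: "e \<in> dashed G" "att G (e, i) \<in> ext G" "att G (e, \<not> i) \<in> ext G"
  shows "att G (e, d) \<in> ext G" "att G (e, False) \<noteq> att G (e, True)" "e \<in> edges G" "e \<notin> solid G"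
    "att G (e, d) \<in> verts G" "reexpand G e True False P = resplit False G e False P"
    "is_coloring k G c \<Longrightarrow> same_contraction k e (G, c) (resplit False G e False P, c)"
proof -
  show x: "att G (e, d) \<in> ext G" for d using e(2,3) by (cases "d = i") auto
  show e': "e \<in> edges G" "e \<notin> solid G" using e(1) by (auto simp: dashed_def)
  show v: "att G (e, d) \<in> verts G" for d using bcrD(6)[OF G e'(1)] .
  \<comment> \<open>A loop would give an external vertex two dashed half-edges.\<close>
  show ne: "att G (e, False) \<noteq> att G (e, True)"
  proof
    assume "att G (e, False) = att G (e, True)"
    then have "{(e, False)} = {(e, True)}"
      using dashed_at_ext[OF G e(1) x[of False]] dashed_at_ext[OF G e(1) x[of True]] by simp
    then show False by simp
  qed
  show "reexpand G e True False P = resplit False G e False P"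
    by (rule reexpand_eq_resplit(2)[OF ne v v e(1) x x])
  show "same_contraction k e (G, c) (resplit False G e False P, c)" if "is_coloring k G c"
    using ne v e' that by (intro same_contraction_resplit bcrD(2,3)[OF G]) auto
qed

text \<open>In the contraction the half-edges of \<open>F\<close> at the two ends meet in one
  vertex, so their number is even. If \<open>P\<close> contains an even number of them, so does the
  other part, and the parities at all other vertices are those in the contraction.\<close>

lemma even_set_resplit:
  assumes G: "bcr_graph G" and e: "e \<in> dashed G" "att G (e, i) \<in> ext G" "att G (e, \<not> i) \<in> ext G"
    and F: "even_set (contract G e) F"
    and P: "P \<subseteq> solid_at G (att G (e, False)) \<union> solid_at G (att G (e, True))" "even (card (P \<inter> F \<times> UNIV))"
  shows "even_set (resplit False G e d P) F"
    "even (card ((solid_at G (att G (e, False)) \<union> solid_at G (att G (e, True))) \<inter> F \<times> UNIV))"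
proof -
  let ?S = "solid_at G (att G (e, False)) \<union> solid_at G (att G (e, True))"
  let ?H = "resplit False G e d P" and ?m = "att G (e, False)" and ?q = "att G (e, True)"
  note C = chord_edgeD[OF G e]
  have Fs: "F \<noteq> {}" "F \<subseteq> solid G" "e \<notin> F"
    using F C(4) by (auto simp: even_set_def contract_def Let_def)
  have ev: "even (card {h \<in> F \<times> UNIV. att (contract G e) h = z})" for z
    using F by (simp add: even_set_def)
  have attc: "att (contract G e) h = (if att G h = ?q then ?m else att G h)" for h
    by (simp add: contract_def Let_def)
  have S: "?S \<inter> F \<times> UNIV = {h \<in> F \<times> UNIV. att (contract G e) h = ?m}"
    using Fs(2) C(2) by (auto simp: attc solid_at_def)
  show evS: "even (card (?S \<inter> F \<times> UNIV))" unfolding S by (rule ev)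
  have ends: "{att G (e, d), att G (e, \<not> d)} = {?m, ?q}" by (cases d) auto
  have attH: "att ?H h = (if att G h \<in> {?m, ?q} then if h \<in> P then att G (e, d) else att G (e, \<not> d) else att G h)"
    if "h \<in> F \<times> UNIV" for h
  proof -
    have "fst h \<noteq> e" using that Fs(3) by auto
    then show ?thesis unfolding att_resplit ends by simp
  qed
  have dne: "att G (e, d) \<noteq> att G (e, \<not> d)" using C(2) by (cases d) auto
  have inS: "h \<in> ?S \<longleftrightarrow> att G h \<in> {?m, ?q}" if "h \<in> F \<times> UNIV" for h
    using that Fs(2) by (auto simp: solid_at_def)
  have "even (card {h \<in> F \<times> UNIV. att ?H h = z})" for z
  proof -
    consider "z = att G (e, d)" | "z = att G (e, \<not> d)" | "z \<notin> {?m, ?q}" using ends by blast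
    then show ?thesis
    proof cases
      case 1
      have z: "z \<in> {?m, ?q}" using ends 1 by blast
      have "att ?H h = z \<longleftrightarrow> h \<in> P" if h: "h \<in> F \<times> UNIV" for h
      proof (cases "att G h \<in> {?m, ?q}")
        case True
        then show ?thesis using attH[OF h] dne 1 by simp
      next
        case False
        then have "h \<notin> P" using inS[OF h] P(1) by blast
        then show ?thesis using attH[OF h] False z by (metis (full_types))
      qed
      then have "{h \<in> F \<times> UNIV. att ?H h = z} = P \<inter> F \<times> UNIV" by blast
      then show ?thesis using P(2) by simp
    next
      case 2
      have z: "z \<in> {?m, ?q}" using ends 2 by blast
      have "att ?H h = z \<longleftrightarrow> h \<in> ?S - P" if h: "h \<in> F \<times> UNIV" for h
      proof (cases "att G h \<in> {?m, ?q}")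
        case True
        then show ?thesis using attH[OF h] inS[OF h] dne 2 by simp
      next
        case False
        then have "h \<notin> ?S" using inS[OF h] by blast
        then show ?thesis using attH[OF h] False z by (metis (full_types) DiffD1)
      qed
      then have "{h \<in> F \<times> UNIV. att ?H h = z} = ?S \<inter> F \<times> UNIV - P \<inter> F \<times> UNIV" by blast
      moreover have "finite ?S" using G by simp
      moreover have "P \<inter> F \<times> UNIV \<subseteq> ?S \<inter> F \<times> UNIV" using P(1) by blast
      ultimately show ?thesis using evS P(2) finite_subset[OF P(1)] by (simp add: card_Diff_subset)
    next
      case 3
      have "att G (e, d) \<in> {?m, ?q}" "att G (e, \<not> d) \<in> {?m, ?q}" using ends by blast+
      then have "att ?H h = z \<longleftrightarrow> att (contract G e) h = z" if "h \<in> F \<times> UNIV" for h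
        unfolding attH[OF that] attc using 3 by auto
      then have "{h \<in> F \<times> UNIV. att ?H h = z} = {h \<in> F \<times> UNIV. att (contract G e) h = z}"
        by blast
      then show ?thesis using ev by simp
    qed
  qed
  then show "even_set ?H F" using Fs by (simp add: even_set_def)
qed

text \<open>A solid cycle in the contraction would survive in one of the terms of the relation.\<close>

lemma no_solid_cycle_contract:
  assumes G: "bcr_graph G" and e: "e \<in> dashed G" "att G (e, i) \<in> ext G" "att G (e, \<not> i) \<in> ext G"
    and \<P>: "\<And>P. P \<in> \<P> \<Longrightarrow> bcr_graph (resplit False G e False P)"
      "\<And>P. P \<in> \<P> \<Longrightarrow> P \<subseteq> solid_at G (att G (e, i)) \<union> solid_at G (att G (e, \<not> i))"
    and par: "\<And>X. even (card ((solid_at G (att G (e, i)) \<union> solid_at G (att G (e, \<not> i))) \<inter> X)) \<Longrightarrow>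
      even (card (solid_at G (att G (e, i)) \<inter> X)) \<or> (\<exists>P \<in> \<P>. even (card (P \<inter> X)))"
  shows "\<not> has_solid_cycle (contract G e)"
proof
  assume "has_solid_cycle (contract G e)"
  then obtain F where F: "even_set (contract G e) F" using solid_cycle_even_set by blast
  have S: "solid_at G (att G (e, i)) \<union> solid_at G (att G (e, \<not> i)) =
      solid_at G (att G (e, False)) \<union> solid_at G (att G (e, True))" by (cases i) auto
  have "even (card ((solid_at G (att G (e, i)) \<union> solid_at G (att G (e, \<not> i))) \<inter> F \<times> UNIV))"
    using even_set_resplit(2)[OF G e F, of "{}"] S by simp
  from par[OF this] show False
  proof
    assume ev: "even (card (solid_at G (att G (e, i)) \<inter> F \<times> UNIV))"
    \<comment> \<open>Returning to the end \<open>(e, i)\<close> the half-edges that it has in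
      \<open>G\<close> reproduces \<open>G\<close> as far as solid edges are concerned.\<close>
    let ?H = "resplit False G e i (solid_at G (att G (e, i)))"
    have H: "even_set ?H F" by (rule even_set_resplit(1)[OF G e F _ ev]) (use S in blast)
    have "att G h = att ?H h" if h: "fst h \<in> solid G" for h
    proof -
      have "h \<in> solid_at G (att G (e, i)) \<longleftrightarrow> att G h = att G (e, i)"
        using h by (cases h) (auto simp: solid_at_def)
      then show ?thesis by (auto simp: att_resplit)
    qed
    then have "even_set G F" by (intro even_set_cong[OF H]) simp_all
    then show False using broken_lines_no_even_set[OF G] by blast
  next
    assume "\<exists>P \<in> \<P>. even (card (P \<inter> F \<times> UNIV))"
    then obtain P where P: "P \<in> \<P>" "even (card (P \<inter> F \<times> UNIV))" by blast
    have "even_set (resplit False G e False P) F"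
      by (rule even_set_resplit(1)[OF G e F _ P(2)]) (use \<P>(2)[OF P(1)] S in blast)
    then show False using broken_lines_no_even_set[OF \<P>(1)[OF P(1)]] by blast
  qed
qed

text \<open>The first re-expansion moves half-edges only between the two ends of \<open>e\<close>,
  and the second one redistributes all of these.\<close>

lemma resplit_twice: "resplit False (resplit False G e b P') e b P = resplit False G e b P"
  by (rule graph_eqI) (auto simp: att_resplit)

section \<open>IHX relations for the extended functional\<close>

locale weight_system =
  fixes k :: orientation_case and W :: "colored_graph \<Rightarrow> rat"
  assumes weight: "\<And>n. weight k n W"
begin

lemmas orient = weight.orientD[OF weight _ _ _ _ _ order_refl]
lemmas stu = weight.stuD[OF weight _ _ order_refl]
lemmas same_contraction = weight.weight_same_contraction[OF weight _ _ _ _ _ _ _ _ _ order_refl]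

lemma weight_move_complement:
  assumes G: "bcr_graph G" "is_coloring k G c" and e: "e \<in> dashed G" "att G (e, b) \<noteq> att G (e, \<not> b)"
    "att G (e, b) \<in> internal G" "att G (e, \<not> b) \<in> internal G"
    and P: "P \<union> Q = dashed_at G (att G (e, b)) \<union> dashed_at G (att G (e, \<not> b)) - {(e, b), (e, \<not> b)}"
      "P \<inter> Q = {}" "card P = 2" "card Q = 2"
  shows "W (resplit False G e b P, c) = W (resplit False G e b Q, c)"
proof -
  let ?f = "(transpose (att G (e, b)) (att G (e, \<not> b)), id, \<lambda>x. x = e)"
  have b: "bcr_graph (resplit False G e b P)" "bcr_graph (resplit False G e b Q)"
    by (rule bcr_move(1)[OF G(1) e _ P(3)], use P(1) in blast, rule bcr_move(1)[OF G(1) e _ P(4)], use P(1) in blast)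
  have "W (resplit False G e b P, c) = of_int (change_sign ?f (resplit False G e b P) c c) *
      W (resplit False G e b Q, c)"
    using G(2) by (intro orient b iso_move_complement[OF G(1) e(1,3,4) P(1,2)]) simp_all
  moreover have "change_sign ?f G c c = 1"
    using bcrD(2,3)[OF G(1)] G(2) e by (intro change_sign_exchange_ends[of _ k]) (auto simp: internal_def dashed_def)
  ultimately show ?thesis by simp
qed

lemma ihx_jacobi:
  assumes G: "bcr_graph G" "is_coloring k G c" and e: "e \<in> dashed G" "att G (e, b) \<noteq> att G (e, \<not> b)"
    "att G (e, b) \<in> internal G" "att G (e, \<not> b) \<in> internal G"
    and M: "dashed_at G (att G (e, b)) \<union> dashed_at G (att G (e, \<not> b)) - {(e, b), (e, \<not> b)} = {(g, \<not> \<beta>), p, q, r}"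
      "distinct [(g, \<not> \<beta>), p, q, r]"
    and g: "stu_edge G g \<beta>"
  shows "(\<Sum>x\<in>{p, q, r}. W (resplit False G e b {(g, \<not> \<beta>), x}, c)) = 0"
proof -
  let ?h = "(g, \<not> \<beta>)"
  let ?D = "\<lambda>x. resplit False G e b {?h, x}"
  interpret weight k "card (internal G)" W by (rule weight)
  have hM: "?h \<in> dashed_at G (att G (e, b)) \<union> dashed_at G (att G (e, \<not> b))" using M(1) by blast
  have gu: "att G ?h = att G (e, b) \<or> att G ?h = att G (e, \<not> b)" using hM by (auto simp: dashed_at_def)
  have "att G (g, \<beta>) \<in> ext G" using g by (simp add: stu_edge_def)
  then have gv: "att G (g, \<beta>) \<noteq> att G (e, b)" "att G (g, \<beta>) \<noteq> att G (e, \<not> b)" using e(3,4) by (auto simp: internal_def)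
  have eg: "e \<noteq> g" using gv by (cases "\<beta> = b") auto
  have D: "bcr_graph (?D x)" "dashed_at (?D x) (att G (e, b)) = {(e, b), ?h, x}"
      "dashed_at (?D x) (att G (e, \<not> b)) = insert (e, \<not> b) ({?h, p, q, r} - {?h, x})"
      "is_coloring k (?D x) c" "card (internal (?D x)) = card (internal G)" "stu_edge (?D x) g \<beta>"
      "att (?D x) ?h = att G (e, b)"
    if "x \<in> {p, q, r}" for x
  proof -
    have P: "{?h, x} \<subseteq> dashed_at G (att G (e, b)) \<union> dashed_at G (att G (e, \<not> b)) - {(e, b), (e, \<not> b)}"
      "card {?h, x} = 2" using that M(2) unfolding M(1) by auto
    note m = bcr_move[OF G(1) e P, unfolded M(1)]
    show "bcr_graph (?D x)" "dashed_at (?D x) (att G (e, b)) = {(e, b), ?h, x}"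
      "dashed_at (?D x) (att G (e, \<not> b)) = insert (e, \<not> b) ({?h, p, q, r} - {?h, x})"
      by (rule m(1), rule m(2), rule m(3))
    show "is_coloring k (?D x) c" "card (internal (?D x)) = card (internal G)" using G(2) by simp_all
    show a: "att (?D x) ?h = att G (e, b)" using gu eg by (auto simp: att_resplit)
    have "att (?D x) (g, \<beta>) = att G (g, \<beta>)" using gv by (simp add: att_resplit)
    then show "stu_edge (?D x) g \<beta>" using g e(3) unfolding stu_edge_def a by simp
  qed
  have d: "dashed_at (?D p) (att G (e, \<not> b)) = {(e, \<not> b), q, r}"
    using D(3)[of p] M(2) by auto
  \<comment> \<open>In \<open>G\<close> the edge \<open>g\<close> may be at either end of
    \<open>e\<close>, but \<open>stu_sum_jacobi\<close> expects it at \<open>(e, b)\<close>. So it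
    is applied to \<open>?D p\<close>, whose re-expansions are those of \<open>G\<close> by
    \<open>resplit_twice\<close>.\<close>
  have "(\<Sum>x\<in>{p, q, r}. stu_sum (\<lambda>H. W (H, c)) (resplit False (?D p) e b {?h, x}) g \<beta>) = 0"
    by (rule stu_sum_jacobi[OF D(1,4)])
      (use D[of p] d e eg in \<open>simp_all add: insert_commute\<close>)
  then have "(\<Sum>x\<in>{p, q, r}. stu_sum (\<lambda>H. W (H, c)) (?D x) g \<beta>) = 0" unfolding resplit_twice .
  moreover have "- 2 * W (?D x, c) = stu_sum (\<lambda>H. W (H, c)) (?D x) g \<beta>" if x: "x \<in> {p, q, r}" for x
    using stuD[OF D(1)[OF x] D(4)[OF x] _ D(6)[OF x]] D(5)[OF x] by simp
  then have "- 2 * (\<Sum>x\<in>{p, q, r}. W (?D x, c)) = (\<Sum>x\<in>{p, q, r}. stu_sum (\<lambda>H. W (H, c)) (?D x) g \<beta>)"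
    unfolding sum_distrib_left by (intro sum.cong refl)
  ultimately show ?thesis by simp
qed

text \<open>Induction on the number of internal vertices. An STU edge whose internal end is not on
  \<open>e\<close> can be resolved in all three terms at once. If there is none, every STU edge ends
  on \<open>e\<close> and provides one of the four half-edges, so the Jacobi identity
  applies.\<close>

lemma ihx_zero:
  assumes "bcr_graph G" "is_coloring k G c" and "e \<in> dashed G" "att G (e, b) \<noteq> att G (e, \<not> b)"
    "att G (e, b) \<in> internal G" "att G (e, \<not> b) \<in> internal G"
    and "dashed_at G (att G (e, b)) \<union> dashed_at G (att G (e, \<not> b)) - {(e, b), (e, \<not> b)} = {h1, h2, h3, h4}"
    and dist: "distinct [h1, h2, h3, h4]"
  shows "(\<Sum>x\<in>{h2, h3, h4}. W (resplit False G e b {h1, x}, c)) = 0"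
  using assms(1-7)
proof (induction "card (internal G)" arbitrary: G rule: less_induct)
  case less
  note G = less.prems(1,2) and e = less.prems(3-6) and M = less.prems(7)
  let ?u = "att G (e, b)" and ?w = "att G (e, \<not> b)"
  let ?D = "\<lambda>G x. resplit False G e b {h1, x}"
  show ?case
  proof (cases "\<exists>g \<beta>. stu_edge G g \<beta> \<and> att G (g, \<not> \<beta>) \<notin> {?u, ?w}")
    case True
    then obtain g \<beta> where g: "stu_edge G g \<beta>" "att G (g, \<not> \<beta>) \<notin> {?u, ?w}" by blast
    have gv: "att G (g, \<beta>) \<notin> {?u, ?w}" using g(1) e(3,4) by (auto simp: stu_edge_def internal_def)
    have disj: "{att G (g, \<beta>), att G (g, \<not> \<beta>)} \<inter> {?u, ?w} = {}" using g(2) gv by simp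
    have disj': "{?u, ?w} \<inter> {att G (g, \<beta>), att G (g, \<not> \<beta>)} = {}" using disj by blast
    have eg: "e \<noteq> g" using gv by (cases "\<beta> = b") auto
    let ?G = "\<lambda>p. resplit True G g \<beta> (insert (snd p) (fst p))"
    have one: "2 * W (?D G x, c) = - (\<Sum>p\<in>stu_pairs G g \<beta>. W (?D (?G p) x, c))"
      if x: "x \<in> {h2, h3, h4}" for x
    proof -
      have P: "{h1, x} \<subseteq> dashed_at G ?u \<union> dashed_at G ?w - {(e, b), (e, \<not> b)}" "card {h1, x} = 2"
        unfolding M using x dist by auto
      have "bcr_graph (?D G x)" by (rule bcr_move(1)[OF G(1) e P])
      moreover have at: "att (?D G x) (g, \<beta>) = att G (g, \<beta>)" "att (?D G x) (g, \<not> \<beta>) = att G (g, \<not> \<beta>)"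
        using gv g(2) by (simp_all add: att_resplit)
      then have "stu_edge (?D G x) g \<beta>" using g(1) by (simp add: stu_edge_def)
      moreover have "stu_pairs (?D G x) g \<beta> = stu_pairs G g \<beta>"
        unfolding stu_pairs_def at using gv g(2) by (simp add: resplit_at_other)
      ultimately show ?thesis using stu[of "?D G x" c g \<beta>] G(2)
        by (simp add: stu_sum_def resplit_commute[OF disj])
    qed
    have zero: "(\<Sum>x\<in>{h2, h3, h4}. W (?D (?G p) x, c)) = 0" if p: "p \<in> stu_pairs G g \<beta>" for p
    proof (rule less.hyps)
      note b = stu_pairs_bcr[OF G(1) g(1) p]
      show "bcr_graph (?G p)" by (rule b(1))
      have "att G (g, \<not> \<beta>) \<in> internal G" using g(1) by (simp add: stu_edge_def)
      then have "0 < card (internal G)" using finite_at(3)[OF G(1)] card_gt_0_iff by blast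
      then show "card (internal (?G p)) < card (internal G)" unfolding b(3) by simp
      show "is_coloring k (?G p) c" using G(2) by simp
      have a: "att (?G p) (e, b) = ?u" "att (?G p) (e, \<not> b) = ?w"
        using disj' by (auto simp: att_resplit)
      show "e \<in> dashed (?G p)" using e eg by simp
      show "att (?G p) (e, b) \<noteq> att (?G p) (e, \<not> b)" unfolding a by (rule e(2))
      show "att (?G p) (e, b) \<in> internal (?G p)" "att (?G p) (e, \<not> b) \<in> internal (?G p)"
        unfolding a b(2) using e g(2) by auto
      have "dashed_at (?G p) ?u = dashed_at G ?u" "dashed_at (?G p) ?w = dashed_at G ?w"
        using gv g(2) by (simp_all add: resplit_at_other)
      then show "dashed_at (?G p) (att (?G p) (e, b)) \<union> dashed_at (?G p) (att (?G p) (e, \<not> b)) -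
          {(e, b), (e, \<not> b)} = {h1, h2, h3, h4}" unfolding a using M by simp
    qed
    have "2 * (\<Sum>x\<in>{h2, h3, h4}. W (?D G x, c)) =
        (\<Sum>x\<in>{h2, h3, h4}. - (\<Sum>p\<in>stu_pairs G g \<beta>. W (?D (?G p) x, c)))"
      unfolding sum_distrib_left by (intro sum.cong refl one)
    also have "\<dots> = - (\<Sum>p\<in>stu_pairs G g \<beta>. \<Sum>x\<in>{h2, h3, h4}. W (?D (?G p) x, c))"
      unfolding sum_negf by (subst sum.swap) (rule refl)
    also have "\<dots> = 0" using zero by (simp del: sum.insert)
    finally show ?thesis by simp
  next
    case False
    have "internal G \<noteq> {}" using e(3) by blast
    then obtain g \<beta> where g: "stu_edge G g \<beta>" using exists_stu_edge_internal[OF G(1)] by blast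
    then have gu: "att G (g, \<not> \<beta>) \<in> {?u, ?w}" using False by blast
    have gd: "g \<in> dashed G" "att G (g, \<beta>) \<in> ext G" using g by (auto simp: stu_edge_def)
    have "g \<noteq> e" using gd(2) e(3,4) by (cases "\<beta> = b") (auto simp: internal_def)
    then have "(g, \<not> \<beta>) \<in> {h1, h2, h3, h4}"
      unfolding M[symmetric] using gu gd(1) by (auto simp: dashed_at_def)
    let ?F = "\<lambda>P. W (resplit False G e b P, c)"
    have jac: "?F {h, p} + ?F {h, q} + ?F {h, r} = 0"
      if h: "h = (g, \<not> \<beta>)" "{h, p, q, r} = {h1, h2, h3, h4}" "distinct [h, p, q, r]" for h p q r
    proof -
      have "(\<Sum>x\<in>{p, q, r}. ?F {(g, \<not> \<beta>), x}) = 0"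
        by (rule ihx_jacobi[OF G e _ _ g]) (use h M in simp_all)
      then show ?thesis using h(1,3) by simp
    qed
    \<comment> \<open>The three terms are the three partitions into pairs, so they can be listed by
      the partner of any of the four half-edges, in particular of the one on the STU edge.\<close>
    have compl: "?F {p, q} = ?F {h, r}"
      if h: "{h, p, q, r} = {h1, h2, h3, h4}" "distinct [h, p, q, r]" for h p q r
    proof (rule weight_move_complement[OF G e])
      show "{p, q} \<union> {h, r} = dashed_at G ?u \<union> dashed_at G ?w - {(e, b), (e, \<not> b)}"
        unfolding M h(1)[symmetric] by auto
      show "{p, q} \<inter> {h, r} = {}" "card {p, q} = 2" "card {h, r} = 2" using h(2) by auto
    qed
    have sum: "(\<Sum>x\<in>{h2, h3, h4}. ?F {h1, x}) = ?F {h1, h2} + ?F {h1, h3} + ?F {h1, h4}"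
      using dist by (simp add: add.assoc)
    consider "h1 = (g, \<not> \<beta>)" | "h2 = (g, \<not> \<beta>)" | "h3 = (g, \<not> \<beta>)" | "h4 = (g, \<not> \<beta>)"
      using \<open>(g, \<not> \<beta>) \<in> {h1, h2, h3, h4}\<close> by blast
    then show ?thesis
    proof cases
      case 1
      then show ?thesis unfolding sum using jac[of h1 h2 h3 h4] dist by simp
    next
      case 2
      have s: "{h2, h1, h3, h4} = {h1, h2, h3, h4}" by auto
      have "?F {h2, h1} + ?F {h2, h3} + ?F {h2, h4} = 0" by (rule jac[OF 2 s]) (use dist in auto)
      moreover have "?F {h2, h3} = ?F {h1, h4}" "?F {h2, h4} = ?F {h1, h3}"
        by (rule compl; use dist in auto)+
      ultimately show ?thesis unfolding sum by (simp add: insert_commute)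
    next
      case 3
      have s: "{h3, h1, h2, h4} = {h1, h2, h3, h4}" by auto
      have "?F {h3, h1} + ?F {h3, h2} + ?F {h3, h4} = 0" by (rule jac[OF 3 s]) (use dist in auto)
      moreover have "?F {h3, h2} = ?F {h1, h4}" "?F {h3, h4} = ?F {h1, h2}"
        by (rule compl; use dist in auto)+
      ultimately show ?thesis unfolding sum by (simp add: insert_commute)
    next
      case 4
      have s: "{h4, h1, h2, h3} = {h1, h2, h3, h4}" by auto
      have "?F {h4, h1} + ?F {h4, h2} + ?F {h4, h3} = 0" by (rule jac[OF 4 s]) (use dist in auto)
      moreover have "?F {h4, h2} = ?F {h1, h3}" "?F {h4, h3} = ?F {h1, h2}"
        by (rule compl; use dist in auto)+
      ultimately show ?thesis unfolding sum by (simp add: insert_commute)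
    qed
  qed
qed

lemma lin_ihx:
  assumes "r \<in> ihx_rels k"
  shows "lin W r = 0"
  using assms
proof cases
  case (1 G e u w h1 h2 h3 h4 D1 c1 D2 c2 D3 c3)
  have uw: "u = att G (e, False)" "w = att G (e, \<not> False)" using 1 by simp_all
  have ue: "u \<notin> ext G" "w \<notin> ext G" using 1 by (auto simp: internal_def)
  have v: "att G (e, False) \<in> verts G" "att G (e, True) \<in> verts G" using 1 by (auto simp: internal_def)
  have re: "reexpand G e False False P = resplit False G e False P" for P
    using 1 ue v by (intro reexpand_eq_resplit(3)) auto
  have col: "is_coloring k G c1" using 1(11,14) by (auto simp: colored_bcr_def re)
  have e: "att G (e, False) \<noteq> att G (e, \<not> False)" using 1 by simp
  \<comment> \<open>The first term serves as reference: the two others are evaluated with its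
    coloring \<open>c1\<close>.\<close>
  have "W D = W (resplit False G e False {h1, x}, c1)"
    if D: "D = (resplit False G e False {h1, x}, c)" "D \<in> colored_bcr k" "same_contraction k e D1 D" for D x c
    unfolding D(1)
  proof (rule same_contraction)
    show "same_contraction k e (resplit False G e False {h1, h2}, c1) (resplit False G e False {h1, x}, c)"
      using D 1(11) re by simp
  qed (use 1 D e in \<open>auto simp: colored_bcr_def re dashed_def\<close>)
  then have "W D2 = W (resplit False G e False {h1, h3}, c1)" "W D3 = W (resplit False G e False {h1, h4}, c1)"
    using 1 re by auto
  then have "lin W r = (\<Sum>x\<in>{h2, h3, h4}. W (resplit False G e False {h1, x}, c1))"
    using 1(1,10,11) by (simp add: lin_simps re add.assoc)
  also have "\<dots> = 0"
    by (rule ihx_zero[OF 1(2) col 1(3)]) (use 1 in simp_all)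
  finally show ?thesis .
qed

text \<open>An STU edge avoids the ends of the chord \<open>e\<close>: its internal end is not
  external, and the only dashed half-edge at an end of \<open>e\<close> belongs to \<open>e\<close>.
  So all terms can be resolved simultaneously until no internal vertex is left. \<open>t\<close> and
  \<open>S\<close> record the data at the chord that these resolutions preserve and that
  \<open>base\<close> relies on.\<close>

lemma chord_zero:
  assumes "bcr_graph G" "is_coloring k G c" "e \<in> dashed G"
    "\<And>d. att G (e, d) = t d" "\<And>d. t d \<in> ext G" "\<And>d. solid_at G (t d) = S d"
    "\<And>P. P \<in> \<P> \<Longrightarrow> bcr_graph (resplit False G e False P)"
    and base: "\<And>G. bcr_graph G \<Longrightarrow> is_coloring k G c \<Longrightarrow> e \<in> dashed G \<Longrightarrow>
      (\<And>d. att G (e, d) = t d) \<Longrightarrow> (\<And>d. t d \<in> ext G) \<Longrightarrow> (\<And>d. solid_at G (t d) = S d) \<Longrightarrow>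
      (\<And>P. P \<in> \<P> \<Longrightarrow> bcr_graph (resplit False G e False P)) \<Longrightarrow> internal G = {} \<Longrightarrow>
      W (G, c) + (\<Sum>P\<in>\<P>. W (resplit False G e False P, c)) = 0"
  shows "W (G, c) + (\<Sum>P\<in>\<P>. W (resplit False G e False P, c)) = 0"
  using assms(1-7)
proof (induction "card (internal G)" arbitrary: G rule: less_induct)
  case less
  note G = less.prems(1,2) and e = less.prems(3) and t = less.prems(4,5) and S = less.prems(6)
    and bP = less.prems(7)
  show ?case
  proof (cases "internal G = {}")
    case True
    then show ?thesis using base[of G] less.prems by blast
  next
    case False
    then obtain g \<beta> where g: "stu_edge G g \<beta>" using exists_stu_edge_internal[OF G(1)] by blast
    note D = stu_edgeD[OF G(1) g]
    have eg: "e \<noteq> g" using D(6) t(1)[of "\<not> \<beta>"] t(2)[of "\<not> \<beta>"] by auto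
    have te: "dashed_at G (t d) = {(e, d)}" for d
      using dashed_at_ext[OF G(1) e, of d] t[of d] by simp
    have tg: "t d \<noteq> att G (g, \<beta>)" "t d \<noteq> att G (g, \<not> \<beta>)" for d
    proof -
      show "t d \<noteq> att G (g, \<not> \<beta>)" using D(6) t(2)[of d] by auto
      show "t d \<noteq> att G (g, \<beta>)"
      proof
        assume "t d = att G (g, \<beta>)"
        then have "{(e, d)} = {(g, \<beta>)}" using te[of d] D(10) by metis
        then show False using eg by simp
      qed
    qed
    have disj: "{att G (g, \<beta>), att G (g, \<not> \<beta>)} \<inter> {att G (e, False), att G (e, \<not> False)} = {}"
      unfolding t(1) using tg by auto
    let ?G = "\<lambda>p. resplit True G g \<beta> (insert (snd p) (fst p))"
    have W1: "2 * W (G, c) = - (\<Sum>p\<in>stu_pairs G g \<beta>. W (?G p, c))"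
      using stu[OF G g] by (simp add: stu_sum_def)
    have pb: "bcr_graph (resplit False (?G p) e False P)" "2 * W (resplit False G e False P, c) =
        - (\<Sum>p\<in>stu_pairs G g \<beta>. W (resplit False (?G p) e False P, c))"
      if P: "P \<in> \<P>" and p: "p \<in> stu_pairs G g \<beta>" for P p
    proof -
      let ?H = "resplit False G e False P"
      have at: "att ?H (g, \<beta>) = att G (g, \<beta>)" "att ?H (g, \<not> \<beta>) = att G (g, \<not> \<beta>)"
        using tg by (simp_all add: att_resplit t(1) eq_commute[of _ "t _"])
      have s: "stu_edge ?H g \<beta>" using g unfolding stu_edge_def at by simp
      have pairs: "stu_pairs ?H g \<beta> = stu_pairs G g \<beta>"
        unfolding stu_pairs_def at using tg by (simp add: resplit_at_other t(1) eq_commute[of _ "t _"])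
      show "bcr_graph (resplit False (?G p) e False P)"
        using stu_pairs_bcr(1)[OF bP[OF P] s, of p] p unfolding pairs resplit_commute[OF disj] by blast
      have "is_coloring k ?H c" using G(2) by simp
      then show "2 * W (?H, c) = - (\<Sum>p\<in>stu_pairs G g \<beta>. W (resplit False (?G p) e False P, c))"
        using stu[OF bP[OF P] _ s] by (simp add: stu_sum_def pairs resplit_commute[OF disj])
    qed
    have zero: "W (?G p, c) + (\<Sum>P\<in>\<P>. W (resplit False (?G p) e False P, c)) = 0"
      if p: "p \<in> stu_pairs G g \<beta>" for p
    proof (rule less.hyps)
      note b = stu_pairs_bcr[OF G(1) g p]
      show "bcr_graph (?G p)" by (rule b(1))
      have "0 < card (internal G)" using finite_at(3)[OF G(1)] False card_gt_0_iff by blast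
      then show "card (internal (?G p)) < card (internal G)" unfolding b(3) by simp
      show "is_coloring k (?G p) c" using G(2) by simp
      show "e \<in> dashed (?G p)" using e eg by simp
      show "att (?G p) (e, d) = t d" for d using tg t(1) by (simp add: att_resplit)
      show "t d \<in> ext (?G p)" for d using t(2) by simp
      show "solid_at (?G p) (t d) = S d" for d using tg S by (simp add: resplit_at_other)
      show "bcr_graph (resplit False (?G p) e False P)" if "P \<in> \<P>" for P using pb(1)[OF that p] .
    qed
    show ?thesis
    proof (cases "stu_pairs G g \<beta> = {}")
      case True
      have "stu_pairs G g \<beta> \<noteq> {}"
      proof -
        obtain x y where "dashed_at G (att G (g, \<not> \<beta>)) - {(g, \<not> \<beta>)} = {x, y}"
          using stu_edge_pair[OF G(1) g] by blast
        moreover have "balanced (solid_at G (att G (g, \<beta>))) \<noteq> {}"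
        proof (cases "solid_at G (att G (g, \<beta>)) = {}")
          case False
          then obtain s where "s \<in> solid_at G (att G (g, \<beta>))" by blast
          then show ?thesis
            using balanced_mem[OF finite_at(2)[OF G(1)] bcrD(12)[OF G(1) D(4)]] by blast
        qed simp
        ultimately show ?thesis by (simp add: stu_pairs_def)
      qed
      then show ?thesis using True by blast
    next
      case False
      then obtain p0 where p0: "p0 \<in> stu_pairs G g \<beta>" by blast
      have "2 * (W (G, c) + (\<Sum>P\<in>\<P>. W (resplit False G e False P, c))) =
          - (\<Sum>p\<in>stu_pairs G g \<beta>. W (?G p, c)) +
          (\<Sum>P\<in>\<P>. - (\<Sum>p\<in>stu_pairs G g \<beta>. W (resplit False (?G p) e False P, c)))"
        unfolding distrib_left W1 sum_distrib_left using pb(2)[OF _ p0] by (simp cong: sum.cong)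
      also have "\<dots> = - (\<Sum>p\<in>stu_pairs G g \<beta>. W (?G p, c) + (\<Sum>P\<in>\<P>. W (resplit False (?G p) e False P, c)))"
        unfolding sum_negf sum.distrib by (subst sum.swap) simp
      also have "\<dots> = 0" using zero by (simp del: sum.insert)
      finally show ?thesis by simp
    qed
  qed
qed

end

section \<open>Chord relations for the extended functional\<close>

lemma even_card_Int_two:
  assumes "a \<noteq> b"
  shows "even (card ({a, b} \<inter> X)) \<longleftrightarrow> (a \<in> X \<longleftrightarrow> b \<in> X)"
  using assms by (cases "a \<in> X"; cases "b \<in> X") (simp_all add: Int_insert_left)

lemma even_card_Int_four:
  assumes "distinct [a, b, c, d]"
  shows "even (card ({a, b, c, d} \<inter> X)) \<longleftrightarrow> (a \<in> X \<longleftrightarrow> b \<in> X) = (c \<in> X \<longleftrightarrow> d \<in> X)"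
  using assms
  by (cases "a \<in> X"; cases "b \<in> X"; cases "c \<in> X"; cases "d \<in> X") (simp_all add: Int_insert_left)

context weight_system
begin

lemma chord_term:
  assumes G: "bcr_graph G" "is_coloring k G c" and e: "e \<in> dashed G" "att G (e, i) \<in> ext G" "att G (e, \<not> i) \<in> ext G"
    and D: "(reexpand G e True False P, c') \<in> colored_bcr k"
      "same_contraction k e (G, c) (reexpand G e True False P, c')"
  shows "W (reexpand G e True False P, c') = W (resplit False G e False P, c)"
    "bcr_graph (resplit False G e False P)"
proof -
  note C = chord_edgeD[OF G(1) e]
  show b: "bcr_graph (resplit False G e False P)" using D(1) by (simp add: colored_bcr_def C(6))
  show "W (reexpand G e True False P, c') = W (resplit False G e False P, c)"
    unfolding C(6)
    by (rule same_contraction[OF G(1) b _ _ _ C(3,2) G(2)]) (use D C(6) in \<open>simp_all add: colored_bcr_def del: same_contraction.simps\<close>)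
qed

text \<open>The shape of all three chord relations: \<open>\<P>\<close> describes the terms other than the first one.\<close>

lemma chord_relation_zero:
  assumes G: "bcr_graph G" "is_coloring k G c" and e: "e \<in> dashed G" "att G (e, i) \<in> ext G" "att G (e, \<not> i) \<in> ext G"
    and \<P>: "\<And>P. P \<in> \<P> \<Longrightarrow> bcr_graph (resplit False G e False P)"
      "\<And>P. P \<in> \<P> \<Longrightarrow> P \<subseteq> solid_at G (att G (e, i)) \<union> solid_at G (att G (e, \<not> i))"
    and par: "\<And>X. even (card ((solid_at G (att G (e, i)) \<union> solid_at G (att G (e, \<not> i))) \<inter> X)) \<Longrightarrow>
      even (card (solid_at G (att G (e, i)) \<inter> X)) \<or> (\<exists>P \<in> \<P>. even (card (P \<inter> X)))"
    and base: "\<And>H. (H, c) \<in> colored_chord k \<Longrightarrow> e \<in> dashed H \<Longrightarrow>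
      att H (e, i) \<in> ext H \<Longrightarrow> att H (e, \<not> i) \<in> ext H \<Longrightarrow>
      solid_at H (att H (e, i)) = solid_at G (att G (e, i)) \<Longrightarrow>
      solid_at H (att H (e, \<not> i)) = solid_at G (att G (e, \<not> i)) \<Longrightarrow>
      \<not> has_solid_cycle (contract H e) \<Longrightarrow>
      (\<And>P. P \<in> \<P> \<Longrightarrow> (reexpand H e True False P, c) \<in> colored_chord k \<and>
        same_contraction k e (H, c) (reexpand H e True False P, c)) \<Longrightarrow>
      W (H, c) + (\<Sum>P\<in>\<P>. W (reexpand H e True False P, c)) = 0"
  shows "W (G, c) + (\<Sum>P\<in>\<P>. W (resplit False G e False P, c)) = 0"
proof (rule chord_zero[OF G e(1) refl _ refl \<P>(1)])
  show "att G (e, d) \<in> ext G" for d by (rule chord_edgeD(1)[OF G(1) e])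
  fix H
  assume H: "bcr_graph H" "is_coloring k H c" "e \<in> dashed H" "\<And>d. att H (e, d) = att G (e, d)"
    "\<And>d. att G (e, d) \<in> ext H" "\<And>d. solid_at H (att G (e, d)) = solid_at G (att G (e, d))"
    "\<And>P. P \<in> \<P> \<Longrightarrow> bcr_graph (resplit False H e False P)" "internal H = {}"
  have eH: "att H (e, i) \<in> ext H" "att H (e, \<not> i) \<in> ext H" unfolding H(4) by (rule H(5))+
  note C = chord_edgeD[OF H(1,3) eH]
  have S: "solid_at H (att H (e, i)) = solid_at G (att G (e, i))"
    "solid_at H (att H (e, \<not> i)) = solid_at G (att G (e, \<not> i))" unfolding H(4) by (rule H(6))+
  \<comment> \<open>The terms obtained from \<open>H\<close> are BCR graphs again, which excludes a
    solid cycle and makes the relation between chord diagrams available.\<close>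
  have "\<not> has_solid_cycle (contract H e)"
    by (rule no_solid_cycle_contract[OF H(1,3) eH H(7)]) (use S \<P>(2) par in simp_all)
  moreover have "(reexpand H e True False P, c) \<in> colored_chord k \<and>
        same_contraction k e (H, c) (reexpand H e True False P, c)" if "P \<in> \<P>" for P
    using H(2,7,8) that C(7)[OF H(2)] unfolding C(6)
    by (simp add: colored_chord_def bcr_chord_diagram_def del: same_contraction.simps)
  moreover have "(H, c) \<in> colored_chord k" using H(1,2,8)
    by (simp add: colored_chord_def bcr_chord_diagram_def)
  ultimately have "W (H, c) + (\<Sum>P\<in>\<P>. W (reexpand H e True False P, c)) = 0"
    using base[of H] H(3) eH S by blast
  then show "W (H, c) + (\<Sum>P\<in>\<P>. W (resplit False H e False P, c)) = 0" unfolding C(6) .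
qed

lemma lin_chord:
  assumes base: "\<And>r. r \<in> chord_rels k (colored_chord k) \<Longrightarrow> lin W r = 0"
    and r: "r \<in> chord_rels k (colored_bcr k)"
  shows "lin W r = 0"
  using r
proof cases
  case (two_solid D1 G c e u i v a b c' d D2 c2 D3 c3)
  have G: "bcr_graph G" "is_coloring k G c" using two_solid(2,15) by (auto simp: colored_bcr_def)
  have e: "e \<in> dashed G" "att G (e, i) \<in> ext G" "att G (e, \<not> i) \<in> ext G" using two_solid by simp_all
  have S: "solid_at G (att G (e, i)) = {a, b}" "solid_at G (att G (e, \<not> i)) = {c', d}" using two_solid by simp_all
  have ne: "att G (e, i) \<noteq> att G (e, \<not> i)" using chord_edgeD(2)[OF G(1) e] by (cases i) auto
  have "{a, b} \<inter> {c', d} = {}" unfolding S[symmetric] using ne by (auto simp: solid_at_def)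
  then have dist: "distinct [a, b, c', d]" using two_solid(9,12) by auto
  have t: "W D2 = W (resplit False G e False {a, c'}, c)" "bcr_graph (resplit False G e False {a, c'})"
    "W D3 = W (resplit False G e False {a, d}, c)" "bcr_graph (resplit False G e False {a, d})"
    unfolding two_solid(13,14) using two_solid(2,13-17) by (intro chord_term[OF G e]; simp del: same_contraction.simps)+
  have "W (G, c) + (\<Sum>P\<in>{{a, c'}, {a, d}}. W (resplit False G e False P, c)) = 0"
  proof (rule chord_relation_zero[OF G e, unfolded S])
    \<comment> \<open>If \<open>a\<close> is in \<open>X\<close>, so is one of the three other
      half-edges; if not, one of these is missing as well. Pairing it with \<open>a\<close> gives a
      part that meets \<open>X\<close> evenly.\<close>
    fix X assume "even (card (({a, b} \<union> {c', d}) \<inter> X))"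
    then have "(a \<in> X \<longleftrightarrow> b \<in> X) = (c' \<in> X \<longleftrightarrow> d \<in> X)"
      using even_card_Int_four[OF dist] by (simp add: insert_commute)
    moreover have "a \<noteq> b" "a \<noteq> c'" "a \<noteq> d" using dist by auto
    ultimately show "even (card ({a, b} \<inter> X)) \<or> (\<exists>P\<in>{{a, c'}, {a, d}}. even (card (P \<inter> X)))"
      by (simp add: even_card_Int_two) blast
  next
    fix H assume H: "(H, c) \<in> colored_chord k" "e \<in> dashed H"
      "att H (e, i) \<in> ext H" "att H (e, \<not> i) \<in> ext H"
      "solid_at H (att H (e, i)) = {a, b}" "solid_at H (att H (e, \<not> i)) = {c', d}"
      "\<not> has_solid_cycle (contract H e)"
      "\<And>P. P \<in> {{a, c'}, {a, d}} \<Longrightarrow> (reexpand H e True False P, c) \<in> colored_chord k \<and>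
        same_contraction k e (H, c) (reexpand H e True False P, c)"
    have "gen (H, c) + gen (reexpand H e True False {a, c'}, c) + gen (reexpand H e True False {a, d}, c)
        \<in> chord_rels k (colored_chord k)"
      by (rule chord_rels.two_solid[OF refl H(2) refl refl H(3-5) two_solid(9) H(7,6) two_solid(12) refl refl])
        (use H(1) H(8)[of "{a, c'}"] H(8)[of "{a, d}"] in \<open>simp_all del: same_contraction.simps\<close>)
    from base[OF this] show "W (H, c) + (\<Sum>P\<in>{{a, c'}, {a, d}}. W (reexpand H e True False P, c)) = 0"
      using dist by (simp add: lin_simps doubleton_eq_iff)
  qed (use t dist in auto)
  then show ?thesis using two_solid(1,2) t(1,3) dist by (simp add: lin_simps doubleton_eq_iff)
next
  case (one_solid D1 G c e u i v a b c' D2 c2 D3 c3)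
  have G: "bcr_graph G" "is_coloring k G c" using one_solid(2,14) by (auto simp: colored_bcr_def)
  have e: "e \<in> dashed G" "att G (e, i) \<in> ext G" "att G (e, \<not> i) \<in> ext G" using one_solid by simp_all
  have S: "solid_at G (att G (e, i)) = {a, b}" "solid_at G (att G (e, \<not> i)) = {c'}" using one_solid by simp_all
  have ne: "att G (e, i) \<noteq> att G (e, \<not> i)" using chord_edgeD(2)[OF G(1) e] by (cases i) auto
  have "{a, b} \<inter> {c'} = {}" unfolding S[symmetric] using ne by (auto simp: solid_at_def)
  then have dist: "distinct [a, b, c']" using one_solid(9) by auto
  have t: "W D2 = W (resplit False G e False {a, c'}, c)" "bcr_graph (resplit False G e False {a, c'})"
    "W D3 = W (resplit False G e False {b, c'}, c)" "bcr_graph (resplit False G e False {b, c'})"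
    unfolding one_solid(12,13) using one_solid(2,12-16) by (intro chord_term[OF G e]; simp del: same_contraction.simps)+
  have "W (G, c) + (\<Sum>P\<in>{{a, c'}, {b, c'}}. W (resplit False G e False P, c)) = 0"
  proof (rule chord_relation_zero[OF G e, unfolded S])
    \<comment> \<open>Two of the three half-edges are both in \<open>X\<close> or both
      outside.\<close>
    fix X
    have "a \<noteq> b" "a \<noteq> c'" "b \<noteq> c'" using dist by auto
    then show "even (card ({a, b} \<inter> X)) \<or> (\<exists>P\<in>{{a, c'}, {b, c'}}. even (card (P \<inter> X)))"
      by (simp add: even_card_Int_two) blast
  next
    fix H assume H: "(H, c) \<in> colored_chord k" "e \<in> dashed H"
      "att H (e, i) \<in> ext H" "att H (e, \<not> i) \<in> ext H"
      "solid_at H (att H (e, i)) = {a, b}" "solid_at H (att H (e, \<not> i)) = {c'}"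
      "\<not> has_solid_cycle (contract H e)"
      "\<And>P. P \<in> {{a, c'}, {b, c'}} \<Longrightarrow> (reexpand H e True False P, c) \<in> colored_chord k \<and>
        same_contraction k e (H, c) (reexpand H e True False P, c)"
    have "gen (H, c) + gen (reexpand H e True False {a, c'}, c) + gen (reexpand H e True False {b, c'}, c)
        \<in> chord_rels k (colored_chord k)"
      by (rule chord_rels.one_solid[OF refl H(2) refl refl H(3-5) one_solid(9) H(7,6) refl refl])
        (use H(1) H(8)[of "{a, c'}"] H(8)[of "{b, c'}"] in \<open>simp_all del: same_contraction.simps\<close>)
    from base[OF this] show "W (H, c) + (\<Sum>P\<in>{{a, c'}, {b, c'}}. W (reexpand H e True False P, c)) = 0"
      using dist by (simp add: lin_simps doubleton_eq_iff)
  qed (use t dist in auto)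
  then show ?thesis using one_solid(1,2) t(1,3) dist by (simp add: lin_simps doubleton_eq_iff)
next
  case (no_solid D1 G c e u i v a b D2 c2)
  have G: "bcr_graph G" "is_coloring k G c" using no_solid(2,13) by (auto simp: colored_bcr_def)
  have e: "e \<in> dashed G" "att G (e, i) \<in> ext G" "att G (e, \<not> i) \<in> ext G" using no_solid by simp_all
  have S: "solid_at G (att G (e, i)) = {a, b}" "solid_at G (att G (e, \<not> i)) = {}" using no_solid by simp_all
  have t: "W D2 = W (resplit False G e False {a}, c)" "bcr_graph (resplit False G e False {a})"
    unfolding no_solid(12) using no_solid(2,12-14) by (intro chord_term[OF G e]; simp del: same_contraction.simps)+
  have "W (G, c) + (\<Sum>P\<in>{{a}}. W (resplit False G e False P, c)) = 0"
  proof (rule chord_relation_zero[OF G e, unfolded S])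
    fix H assume H: "(H, c) \<in> colored_chord k" "e \<in> dashed H"
      "att H (e, i) \<in> ext H" "att H (e, \<not> i) \<in> ext H"
      "solid_at H (att H (e, i)) = {a, b}" "solid_at H (att H (e, \<not> i)) = {}"
      "\<not> has_solid_cycle (contract H e)"
      "\<And>P. P \<in> {{a}} \<Longrightarrow> (reexpand H e True False P, c) \<in> colored_chord k \<and>
        same_contraction k e (H, c) (reexpand H e True False P, c)"
    have "gen (H, c) + gen (reexpand H e True False {a}, c) \<in> chord_rels k (colored_chord k)"
      by (rule chord_rels.no_solid[OF refl H(2) refl refl H(3-5) no_solid(9) H(7,6) refl])
        (use H(1) H(8)[of "{a}"] in \<open>simp_all del: same_contraction.simps\<close>)
    from base[OF this] show "W (H, c) + (\<Sum>P\<in>{{a}}. W (reexpand H e True False P, c)) = 0"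
      by (simp add: lin_simps)
  qed (use t in auto)
  then show ?thesis using no_solid(1,2) t(1) by (simp add: lin_simps)
qed

lemma lin_stu:
  assumes "r \<in> stu_rels k"
  shows "lin W r = 0"
proof -
  obtain G c e H where r: "r = gen (G, c) - H" "stu k (G, c) e H"
    using assms unfolding stu_rels_def by auto
  interpret weight k "card (internal G)" W by (rule weight)
  from r(2) obtain b where G: "(G, c) \<in> colored_bcr k" and e: "stu_edge G e b"
    by cases (auto simp: stu_edge_def)
  have "2 * W (G, c) = - stu_sum (\<lambda>H. W (H, c)) G e b"
    using G e by (intro stuD) (auto simp: colored_bcr_def)
  moreover have "2 * lin W H = - stu_sum (\<lambda>H. W (H, c)) G e b"
    by (rule stu_value[OF r(2) e]) simp
  ultimately show ?thesis using r(1) by (simp add: lin_simps)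
qed

lemma lin_orientation:
  assumes "r \<in> orientation_rels (colored_bcr k)"
  shows "lin W r = 0"
proof -
  obtain f G c G' c' where r: "r = gen (G, c) - qscale (of_int (change_sign f G c c')) (gen (G', c'))"
    and G: "bcr_graph G" "bcr_graph G'" "is_coloring k G c" "is_coloring k G' c'" "is_iso f G G'"
    using assms unfolding orientation_rels_def colored_bcr_def by blast
  show ?thesis unfolding r lin_simps using orient[OF G] by simp
qed

end

section \<open>The quotient spaces\<close>

interpretation qvs_pair: vector_space_pair "qscale :: rat \<Rightarrow> ('a \<Rightarrow>\<^sub>0 rat) \<Rightarrow> _" "(*) :: rat \<Rightarrow> rat \<Rightarrow> rat"
  by unfold_locales (simp_all add: algebra_simps)

lemma poly_mapping_sum_single:
  "y = (\<Sum>a\<in>Poly_Mapping.keys y. qscale (Poly_Mapping.lookup y a) (Poly_Mapping.single a 1))"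
  by (rule poly_mapping_eqI)
    (simp add: lookup_sum lookup_single when_def in_keys_iff if_distrib[where f = "\<lambda>x. _ * x"] cong: if_cong)

text \<open>A basis of the span of \<open>R\<close> stays independent when \<open>x\<close> is
  added, so a linear map can be prescribed as 0 on the basis and 1 at \<open>x\<close>. Its values
  on the generators give \<open>W\<close>.\<close>

lemma separating_functional:
  assumes "x \<notin> qvs.span R"
  obtains W :: "'a \<Rightarrow> rat" where "\<And>y. y \<in> R \<Longrightarrow> lin W y = 0" "lin W (x :: 'a \<Rightarrow>\<^sub>0 rat) = 1"
proof -
  obtain B where B: "B \<subseteq> R" "qvs.independent B" "qvs.span B = qvs.span R"
    by (metis qvs.basis_exists qvs.span_eq qvs.span_superset qvs.span_mono qvs.span_span subset_antisym)
  have xB: "x \<notin> qvs.span B" using assms B(3) by simp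
  then have ind: "qvs.independent (insert x B)" using B(2) qvs.independent_insertI by blast
  obtain g where g: "Vector_Spaces.linear qscale (*) g" "\<forall>y \<in> insert x B. g y = (if y = x then 1 else 0)"
    using qvs_pair.linear_independent_extend[OF ind, of "\<lambda>y. if y = x then 1 else 0"] by blast
  interpret g: Vector_Spaces.linear qscale "(*)" g by (rule g(1))
  define W where "W a = g (Poly_Mapping.single a 1)" for a
  have "x \<notin> B" using xB qvs.span_base by blast
  then have gB: "g y = 0" if "y \<in> B" for y using g(2) that by auto
  have lin: "lin W y = g y" for y
  proof -
    have "g y = (\<Sum>a\<in>Poly_Mapping.keys y. Poly_Mapping.lookup y a * W a)"
      by (subst poly_mapping_sum_single) (simp add: g.sum g.scale W_def)
    then show ?thesis by (simp add: lin_def)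
  qed
  have "g y = 0" if "y \<in> qvs.span B" for y
    using that by (induction rule: qvs.span_induct_alt) (simp_all add: g.zero g.add g.scale gB)
  then have "lin W y = 0" if "y \<in> R" for y using that B(3) lin qvs.span_base by metis
  moreover have "lin W x = 1" using g(2) lin by simp
  ultimately show ?thesis by (rule that)
qed

section \<open>Comparison of the two quotients\<close>

lemma chord_relations_subset: "chord_relations k \<subseteq> bcr_relations k"
proof -
  let ?R = "ihx_rels k \<union> stu_rels k \<union> orientation_rels (colored_bcr k) \<union> chord_rels k (colored_bcr k)"
  have sub: "colored_chord k \<subseteq> colored_bcr k"
    by (auto simp: colored_chord_def colored_bcr_def bcr_chord_diagram_def)
  have "orientation_rels (colored_chord k) \<subseteq> orientation_rels (colored_bcr k)"
    using sub unfolding orientation_rels_def by blast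
  moreover have "chord_rels k (colored_chord k) \<subseteq> chord_rels k (colored_bcr k)"
  proof
    fix r assume "r \<in> chord_rels k (colored_chord k)"
    then show "r \<in> chord_rels k (colored_bcr k)"
    proof cases
      case (two_solid D1 G c e u i v a b c' d D2 c2 D3 c3)
      show ?thesis unfolding two_solid(1)
        by (rule chord_rels.two_solid[OF two_solid(2-14) _ two_solid(16,17)]) (use two_solid(15) sub in blast)
    next
      case (one_solid D1 G c e u i v a b c' D2 c2 D3 c3)
      show ?thesis unfolding one_solid(1)
        by (rule chord_rels.one_solid[OF one_solid(2-13) _ one_solid(15,16)]) (use one_solid(14) sub in blast)
    next
      case (no_solid D1 G c e u i v a b D2 c2)
      show ?thesis unfolding no_solid(1)
        by (rule chord_rels.no_solid[OF no_solid(2-12) _ no_solid(14)]) (use no_solid(13) sub in blast)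
    qed
  qed
  moreover have "four_term_rels k \<subseteq> qvs.span ?R"
  proof
    fix r assume "r \<in> four_term_rels k"
    then obtain S e e' H H' where r: "r = H - H'" "stu k S e H" "stu k S e' H'"
      unfolding four_term_rels_def by blast
    then have "gen S - H \<in> ?R" "gen S - H' \<in> ?R" unfolding stu_rels_def by blast+
    \<comment> \<open>A 4T relation is the difference of two STU relations for the same graph, which
      cancels.\<close>
    then have "(gen S - H') - (gen S - H) \<in> qvs.span ?R"
      by (intro qvs.span_diff qvs.span_base)
    then show "r \<in> qvs.span ?R" using r(1) by simp
  qed
  ultimately have "orientation_rels (colored_chord k) \<union> four_term_rels k \<union> chord_rels k (colored_chord k)
      \<subseteq> qvs.span ?R" using qvs.span_superset[of ?R] by blast
  then show ?thesis unfolding chord_relations_def bcr_relations_def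
    by (metis qvs.span_mono qvs.span_span)
qed

lemma subspace_chord_space: "qvs.subspace (chord_space k)"
proof (rule qvs.subspaceI)
  show "0 \<in> chord_space k" by (simp add: chord_space_def)
  show "x + y \<in> chord_space k" if "x \<in> chord_space k" "y \<in> chord_space k" for x y
    using that keys_add[of x y] unfolding chord_space_def by blast
  show "qscale r x \<in> chord_space k" if "x \<in> chord_space k" for r x
    using that by (auto simp: chord_space_def in_keys_iff)
qed

lemma gen_chord_space: "X \<in> colored_chord k \<Longrightarrow> gen X \<in> chord_space k"
  by (simp add: chord_space_def gen_def)

lemma coset_eq_iff:
  assumes R: "qvs.subspace R"
  shows "x +o R = y +o R \<longleftrightarrow> x - y \<in> R"
proof
  assume "x +o R = y +o R"
  moreover have "x + 0 \<in> x +o R" by (rule set_plus_intro2[OF qvs.subspace_0[OF R]])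
  ultimately have "x \<in> y +o R" by simp
  then show "x - y \<in> R" by (auto simp: elt_set_plus_def)
next
  have sub: "x +o R \<subseteq> y +o R" if xy: "x - y \<in> R" for x y
  proof
    fix z assume "z \<in> x +o R"
    then obtain b where b: "b \<in> R" "z = x + b" by (auto simp: elt_set_plus_def)
    have z: "z = y + ((x - y) + b)" using b(2) by simp
    show "z \<in> y +o R" unfolding z by (intro set_plus_intro2 qvs.subspace_add[OF R xy b(1)])
  qed
  assume xy: "x - y \<in> R"
  then have "y - x \<in> R" using qvs.subspace_neg[OF R xy] by simp
  then show "x +o R = y +o R" using sub xy by blast
qed

lemma chord_space_inter:
  assumes x: "x \<in> bcr_relations k"
    and c: "x \<in> chord_space k"
  shows "x \<in> chord_relations k"
proof (rule ccontr)
  let ?R = "orientation_rels (colored_chord k) \<union> four_term_rels k \<union> chord_rels k (colored_chord k)"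
  assume "x \<notin> chord_relations k"
  then obtain W0 where W0: "\<And>y. y \<in> ?R \<Longrightarrow> lin W0 y = 0" "lin W0 x = 1"
    unfolding chord_relations_def using separating_functional by blast
  \<comment> \<open>Nothing is known about \<open>W0\<close> on graphs with internal vertices. With
    the bound 0, the conditions speak of chord diagrams only.\<close>
  have o: "orient_inv k 0 W0" unfolding orient_inv_def
  proof (intro allI impI)
    fix f G c G' c'
    assume G: "bcr_graph G" "bcr_graph G'" "is_coloring k G c" "is_coloring k G' c'" "is_iso f G G'"
      "card (internal G) \<le> 0"
    obtain fV fE fl where f: "f = (fV, fE, fl)" by (metis prod_cases3)
    have "card (internal G') = card (internal G)" using iso_card_internal G(1,2,5) f by blast
    then have "internal G = {}" "internal G' = {}"
      using G(6) finite_at(3)[OF G(1)] finite_at(3)[OF G(2)] by simp_all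
    then have "(G, c) \<in> colored_chord k" "(G', c') \<in> colored_chord k"
      using G by (simp_all add: colored_chord_def bcr_chord_diagram_def)
    then have "gen (G, c) - qscale (of_int (change_sign f G c c')) (gen (G', c')) \<in> ?R"
      using G(5) unfolding orientation_rels_def by blast
    from W0(1)[OF this] show "W0 (G, c) = of_int (change_sign f G c c') * W0 (G', c')"
      by (simp add: lin_simps)
  qed
  have s: "stu_inv k 0 W0" unfolding stu_inv_def
  proof (intro allI impI)
    fix G c e b
    assume "bcr_graph G" "card (internal G) \<le> 0" "stu_edge G e b"
    then show "2 * W0 (G, c) = - stu_sum (\<lambda>H. W0 (H, c)) G e b"
      using finite_at(3)[of G] by (auto simp: stu_edge_def)
  qed
  interpret W0: weight k 0 W0 by (unfold_locales; fact)
  have "stu_sum (\<lambda>H. W0 (H, c)) G e b = stu_sum (\<lambda>H. W0 (H, c)) G e' b'"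
    if G: "bcr_graph G" "is_coloring k G c" "card (internal G) = 1"
      and e: "stu_edge G e b" "stu_edge G e' b'" "e \<noteq> e'" for G c e b e' b'
  proof -
    obtain H H' where H: "stu k (G, c) e H" "stu k (G, c) e' H'"
      using stu_exists[OF G(1,2) e(1)] stu_exists[OF G(1,2) e(2)] by blast
    \<comment> \<open>The 4T relation says that the two STU relations at \<open>G\<close> prescribe
      the same value, which makes the first stage of the extension well defined.\<close>
    have "H - H' \<in> ?R" using H G(3) e(3) unfolding four_term_rels_def by force
    then have "lin W0 H = lin W0 H'" using W0(1) by (force simp: lin_simps)
    then show ?thesis
      using W0.stu_value[OF H(1) e(1)] W0.stu_value[OF H(2) e(2)] G(3) by simp
  qed
  from weight_extension[OF o this] obtain W where W: "\<And>n. weight k n W"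
    "\<And>G c. internal G = {} \<Longrightarrow> W (G, c) = W0 (G, c)" by blast
  interpret weight_system k W by (rule weight_system.intro) (rule W(1))
  have agree: "lin W y = lin W0 y" if "y \<in> chord_space k" for y
    using that W(2) by (intro lin_cong) (auto simp: chord_space_def colored_chord_def bcr_chord_diagram_def)
  have "lin W r = 0" if r: "r \<in> chord_rels k (colored_chord k)" for r
  proof -
    from r have "r \<in> chord_space k"
    proof cases
      case (two_solid D1 G c e u i v a b c' d D2 c2 D3 c3)
      show ?thesis unfolding two_solid(1)
        by (intro qvs.subspace_add[OF subspace_chord_space] gen_chord_space) (use two_solid(15) in blast)+
    next
      case (one_solid D1 G c e u i v a b c' D2 c2 D3 c3)
      show ?thesis unfolding one_solid(1)
        by (intro qvs.subspace_add[OF subspace_chord_space] gen_chord_space) (use one_solid(14) in blast)+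
    next
      case (no_solid D1 G c e u i v a b D2 c2)
      show ?thesis unfolding no_solid(1)
        by (intro qvs.subspace_add[OF subspace_chord_space] gen_chord_space) (use no_solid(13) in blast)+
    qed
    then show ?thesis using agree W0(1) r by simp
  qed
  then have "lin W x = 0" using x unfolding bcr_relations_def
    by (intro lin_span[OF _ x[unfolded bcr_relations_def]])
      (use lin_ihx lin_stu lin_orientation lin_chord in blast)
  then show False using agree[OF c] W0(2) by simp
qed

lemma reduce_to_chords:
  assumes "X \<in> colored_bcr k"
  shows "\<exists>y \<in> chord_space k. gen X - y \<in> bcr_relations k"
  using assms
proof (induction "card (internal (fst X))" arbitrary: X rule: less_induct)
  case less
  obtain G c where X: "X = (G, c)" by (cases X)
  have G: "bcr_graph G" "is_coloring k G c" using less.prems by (auto simp: X colored_bcr_def)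
  let ?B = "bcr_relations k"
  have sub: "qvs.subspace ?B" by (simp add: bcr_relations_def qvs.subspace_span)
  show ?case
  proof (cases "internal G = {}")
    case True
    then have "gen X \<in> chord_space k" using G
      by (simp add: X chord_space_def gen_def colored_chord_def bcr_chord_diagram_def)
    moreover have "gen X - gen X \<in> ?B" using qvs.subspace_0[OF sub] by simp
    ultimately show ?thesis by blast
  next
    case False
    then obtain e b where e: "stu_edge G e b" using exists_stu_edge_internal[OF G(1)] by blast
    obtain H where H: "stu k (G, c) e H"
      "Poly_Mapping.keys H \<subseteq> {X \<in> colored_bcr k. card (internal (fst X)) < card (internal G)}"
      using stu_exists[OF G e] by blast
    have "\<forall>Y \<in> Poly_Mapping.keys H. \<exists>y \<in> chord_space k. gen Y - y \<in> ?B"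
      using less.hyps H(2) X by auto
    then obtain y where y: "\<And>Y. Y \<in> Poly_Mapping.keys H \<Longrightarrow> y Y \<in> chord_space k \<and> gen Y - y Y \<in> ?B"
      by metis
    define z where "z = (\<Sum>Y\<in>Poly_Mapping.keys H. qscale (Poly_Mapping.lookup H Y) (y Y))"
    note cs = subspace_chord_space
    have z: "z \<in> chord_space k" unfolding z_def using y by (intro qvs.subspace_sum[OF cs] qvs.subspace_scale[OF cs]) blast
    have Heq: "H = (\<Sum>Y\<in>Poly_Mapping.keys H. qscale (Poly_Mapping.lookup H Y) (gen Y))"
      unfolding gen_def by (rule poly_mapping_sum_single)
    have "H - z = (\<Sum>Y\<in>Poly_Mapping.keys H. qscale (Poly_Mapping.lookup H Y) (gen Y - y Y))"
      unfolding z_def by (subst Heq) (simp add: sum_subtractf qvs.scale_right_diff_distrib)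
    also have "\<dots> \<in> ?B" using y by (intro qvs.subspace_sum[OF sub] qvs.subspace_scale[OF sub]) blast
    finally have "H - z \<in> ?B" .
    moreover have "gen X - H \<in> ?B" unfolding bcr_relations_def X
      by (rule qvs.span_base) (use H(1) in \<open>auto simp: stu_rels_def\<close>)
    ultimately have "gen X - z \<in> ?B" using qvs.subspace_add[OF sub, of "gen X - H" "H - z"] by simp
    then show ?thesis using z by blast
  qed
qed

lemma bcr_space_reduce:
  assumes "x \<in> bcr_space k"
  shows "\<exists>y \<in> chord_space k. x - y \<in> bcr_relations k"
proof -
  let ?B = "bcr_relations k"
  have sub: "qvs.subspace ?B" by (simp add: bcr_relations_def qvs.subspace_span)
  note cs = subspace_chord_space
  have "\<forall>Y \<in> Poly_Mapping.keys x. \<exists>y \<in> chord_space k. gen Y - y \<in> ?B"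
    using assms reduce_to_chords unfolding bcr_space_def by blast
  then obtain y where y: "\<And>Y. Y \<in> Poly_Mapping.keys x \<Longrightarrow> y Y \<in> chord_space k \<and> gen Y - y Y \<in> ?B"
    by metis
  define z where "z = (\<Sum>Y\<in>Poly_Mapping.keys x. qscale (Poly_Mapping.lookup x Y) (y Y))"
  have "z \<in> chord_space k" unfolding z_def using y by (intro qvs.subspace_sum[OF cs] qvs.subspace_scale[OF cs]) blast
  moreover have xeq: "x = (\<Sum>Y\<in>Poly_Mapping.keys x. qscale (Poly_Mapping.lookup x Y) (gen Y))"
    unfolding gen_def by (rule poly_mapping_sum_single)
  have "x - z = (\<Sum>Y\<in>Poly_Mapping.keys x. qscale (Poly_Mapping.lookup x Y) (gen Y - y Y))"
    unfolding z_def by (subst xeq) (simp add: sum_subtractf qvs.scale_right_diff_distrib)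
  moreover have "\<dots> \<in> ?B" using y by (intro qvs.subspace_sum[OF sub] qvs.subspace_scale[OF sub]) blast
  ultimately show ?thesis by metis
qed

theorem theorem0p3:
  fixes k :: orientation_case
  shows "\<exists>\<phi>. (\<forall>x \<in> chord_space k. \<phi> (x +o chord_relations k) = iota x +o bcr_relations k) \<and>
    quot_iso (chord_space k) (chord_relations k) (bcr_space k) (bcr_relations k) \<phi>"
proof -
  let ?C = "chord_relations k" and ?B = "bcr_relations k"
  have sC: "qvs.subspace ?C" by (simp add: chord_relations_def qvs.subspace_span)
  have sB: "qvs.subspace ?B" by (simp add: bcr_relations_def qvs.subspace_span)
  note cs = subspace_chord_space
  note coset = coset_eq_iff[OF sB]
  \<comment> \<open>Adding the larger subspace to a coset of the smaller one gives the induced map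
    without a choice of representatives.\<close>
  define \<phi> where "\<phi> X = X + ?B" for X
  have \<phi>: "\<phi> (x +o ?C) = x +o ?B" for x
  proof -
    have "?C + ?B = ?B"
    proof
      show "?C + ?B \<subseteq> ?B" using qvs.subspace_add[OF sB] chord_relations_subset
        by (blast elim!: set_plus_elim)
      show "?B \<subseteq> ?C + ?B" using set_plus_intro[OF qvs.subspace_0[OF sC], of _ ?B] by fastforce
    qed
    then show ?thesis by (simp add: \<phi>_def set_plus_rearrange3)
  qed
  have "quot_iso (chord_space k) ?C (bcr_space k) ?B \<phi>" unfolding quot_iso_def
  proof (intro conjI ballI allI)
    show "bij_betw \<phi> (quot_space (chord_space k) ?C) (quot_space (bcr_space k) ?B)"
      unfolding bij_betw_def
    proof
      show "inj_on \<phi> (quot_space (chord_space k) ?C)"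
      proof (rule inj_onI)
        fix X Y assume "X \<in> quot_space (chord_space k) ?C" "Y \<in> quot_space (chord_space k) ?C" "\<phi> X = \<phi> Y"
        then obtain x y where xy: "x \<in> chord_space k" "y \<in> chord_space k" "X = x +o ?C" "Y = y +o ?C"
          "x - y \<in> ?B" by (auto simp: quot_space_def \<phi> coset)
        have "x - y \<in> ?C"
          using chord_space_inter[OF xy(5)] qvs.subspace_diff[OF cs xy(1,2)] by blast
        then show "X = Y" unfolding xy(3,4) coset_eq_iff[OF sC] .
      qed
      show "\<phi> ` quot_space (chord_space k) ?C = quot_space (bcr_space k) ?B"
      proof (intro equalityI subsetI)
        fix Y assume "Y \<in> \<phi> ` quot_space (chord_space k) ?C"
        then obtain x where "x \<in> chord_space k" "Y = x +o ?B" by (auto simp: quot_space_def \<phi>)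
        then show "Y \<in> quot_space (bcr_space k) ?B"
          using iota_chord_space by (auto simp: quot_space_def iota_def)
      next
        fix Y assume "Y \<in> quot_space (bcr_space k) ?B"
        then obtain x where x: "x \<in> bcr_space k" "Y = x +o ?B" by (auto simp: quot_space_def)
        then obtain y where y: "y \<in> chord_space k" "x - y \<in> ?B" using bcr_space_reduce by blast
        then have "Y = \<phi> (y +o ?C)" unfolding \<phi> x(2) coset by simp
        then show "Y \<in> \<phi> ` quot_space (chord_space k) ?C" using y(1) by (auto simp: quot_space_def)
      qed
    qed
  next
    fix X Y assume "X \<in> quot_space (chord_space k) ?C" "Y \<in> quot_space (chord_space k) ?C"
    then obtain x y where "X = x +o ?C" "Y = y +o ?C" by (auto simp: quot_space_def)
    then show "\<phi> (X + Y) = \<phi> X + \<phi> Y" by (simp add: quot_add[OF sC] quot_add[OF sB] \<phi>)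
  next
    fix r X assume "X \<in> quot_space (chord_space k) ?C"
    then obtain x where "X = x +o ?C" by (auto simp: quot_space_def)
    then show "\<phi> (quot_scale ?C r X) = quot_scale ?B r (\<phi> X)"
      by (simp add: quot_scale[OF sC] quot_scale[OF sB] \<phi>)
  qed
  then show ?thesis using \<phi> by (intro exI[of _ \<phi>]) (simp add: iota_def)
qed

end
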